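(* Consider the problem $$(SP)\qquad \text{minimize}\quad Ef(x,\bar u)\quad\text{over }x\in\mathcal N$$ and the dual problem $$(D)\qquad \text{maximize}\quad \langle\bar u,y\rangle-Ef^*(p,y)\quad\text{over }(p,y)\in\mathcal X_a^\perp\times\mathcal Y.$$ Assume that $(SP)$ is feasible (i.e. $Ef(x,\bar u)<\infty$ for some $x\in\mathcal N$), that $$\{x\in\mathcal N: f^\infty(x,0)\le0\ \text{a.s.}\}$$ is a linear space, and that there exist $p\in\mathcal X_a^\perp$ and $\epsilon>0$ such that $$\inf_{y\in\mathcal Y}Ef^*(\lambda p,y)<\infty\qquad\text{for all }\lambda\in[1-\epsilon,1+\epsilon].$$ Then $\inf(SP)=\sup(D)$, and $(SP)$ has a solution.
   Context: $(\Omega,\mathcal F,P)$ is a probability space with a filtration $(\mathcal F_t)_{t=0}^T$ (an increasing sequence of sub-$\sigma$-algebras of $\mathcal F$). $n=n_0+\dots+n_T$ and $\mathcal N$ is the linear space of all $x=(x_t)_{t=0}^T\in L^0(\mathbb R^n)$ such that $x_t$ is $\mathbb R^{n_t}$-valued and $\mathcal F_t$-measurable for every $t$. Random variables equal a.s. are identified. Convention: the expectation of an extended real-valued random variable is $+\infty$ unless its positive part is integrable. $f$ is a convex normal integrand on $\mathbb R^n\times\mathbb R^m\times\Omega$: $f(\cdot,\omega)$ is a closed convex extended real-valued function for every $\omega$ (closed: lower semicontinuous and either proper or identically $+\infty$ or identically $-\infty$) and $\omega\mapsto\operatorname{epi}f(\cdot,\omega)$ is a measurable set-valued mapping. $Ef(x,u):=\int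 f(x(\omega),u(\omega),\omega)\,dP(\omega)$; $f^*(v,y,\omega):=\sup_{x,u}\{x\cdot v+u\cdot y-f(x,u,\omega)\}$ and $Ef^*$ is the corresponding integral functional. $f^\infty(\cdot,\cdot,\omega)$ is the recession function of $f(\cdot,\cdot,\omega)$; for a closed proper convex $g$, $g^\infty(x):=\sup_{\lambda>0}\frac{g(\bar x+\lambda x)-g(\bar x)}{\lambda}$, which is independent of $\bar x\in\operatorname{dom}g$. A linear space $\mathcal U$ of $\mathbb R^m$-valued random variables is decomposable if $1_Au+1_{\Omega\setminus A}u'\in\mathcal U$ for all $u\in\mathcal U$, $u'\in L^\infty$, $A\in\mathcal F$; it is solid if $\bar u\in\mathcal U$, $u\in L^0$ and $|u^i|\le|\bar u^i|$ a.s. for all components $i$ imply $u\in\mathcal U$. $\mathcal X,\mathcal V$ are solid decomposable spaces of $\mathbb R^n$-valued random variables in separating duality under $\langle x,v\rangle:=E[x\cdot v]$ and $\mathcal U,\mathcal Y$ are solid decomposable spaces of $\mathbb R^m$-valued random variables in separating duality under $\langle u,y\rangle:=E[u\cdot y]$ (in particular the products are integrable). $\bar u\in\mathcal U$ is fixed. $\mathcal X_a:=\mathcal X\cap\mathcal N$ and $\mathcal X_a^\perp:=\{v\in\mathcal V: \langle x,v\rangle=0\ \forall x\in\mathcal X_a\}$. *)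

theory Defs
  imports "HOL-Probability.Probability"
begin

definition epi :: "('a \<Rightarrow> ereal) \<Rightarrow> ('a \<times> real) set" where
  "epi g = {(z, \<alpha>). g z \<le> ereal \<alpha>}"

definition edom :: "('a \<Rightarrow> ereal) \<Rightarrow> 'a set" where
  "edom g = {z. g z < \<infinity>}"

definition proper_fun :: "('a \<Rightarrow> ereal) \<Rightarrow> bool" where
  "proper_fun g \<longleftrightarrow> edom g \<noteq> {} \<and> (\<forall>z. g z > -\<infinity>)"

definition lsc_fun :: "('a::topological_space \<Rightarrow> ereal) \<Rightarrow> bool" where
  "lsc_fun g \<longleftrightarrow> (\<forall>z. g z \<le> Liminf (nhds z) g)"

definition closed_fun :: "('a::topological_space \<Rightarrow> ereal) \<Rightarrow> bool" where
  "closed_fun g \<longleftrightarrow>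
     lsc_fun g \<and> (proper_fun g \<or> g = (\<lambda>_. \<infinity>) \<or> g = (\<lambda>_. -\<infinity>))"

definition convex_fun :: "('a::real_vector \<Rightarrow> ereal) \<Rightarrow> bool" where
  "convex_fun g \<longleftrightarrow> convex (epi g)"

definition conj_fun :: "('a::real_inner \<Rightarrow> ereal) \<Rightarrow> 'a \<Rightarrow> ereal" where
  "conj_fun g v = (SUP z. ereal (z \<bullet> v) - g z)"

text \<open>For closed proper convex \<open>g\<close> the difference quotient's supremum does not depend on the
  base point in the domain, so an arbitrary one is chosen. For improper \<open>g\<close> the value carries no
  meaning.\<close>

definition recession_fun :: "('a::real_vector \<Rightarrow> ereal) \<Rightarrow> 'a \<Rightarrow> ereal" where
  "recession_fun g z =
     (let z0 = (SOME z0. z0 \<in> edom g)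
      in SUP c\<in>{0<..}. (g (z0 + c *\<^sub>R z) - g z0) / ereal c)"

definition measurable_multifun :: "'w measure \<Rightarrow> ('w \<Rightarrow> 'b::topological_space set) \<Rightarrow> bool" where
  "measurable_multifun M S \<longleftrightarrow>
     (\<forall>O'. open O' \<longrightarrow> {\<omega> \<in> space M. S \<omega> \<inter> O' \<noteq> {}} \<in> sets M)"

definition convex_normal_integrand ::
    "'w measure \<Rightarrow> ('w \<Rightarrow> 'a::real_normed_vector \<Rightarrow> ereal) \<Rightarrow> bool" where
  "convex_normal_integrand M f \<longleftrightarrow>
     (\<forall>\<omega>\<in>space M. closed_fun (f \<omega>) \<and> convex_fun (f \<omega>)) \<and>
     measurable_multifun M (\<lambda>\<omega>. epi (f \<omega>))"

text \<open>Expectation of an extended real-valued random variable, equal to \<open>\<infinity>\<close> unless the positive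
  part is integrable; \<open>e2ennreal\<close> maps negative arguments to \<open>0\<close>, so the two integrals are those
  of the positive and the negative part.\<close>

definition ext_expectation :: "'w measure \<Rightarrow> ('w \<Rightarrow> ereal) \<Rightarrow> ereal" where
  "ext_expectation M X =
     (if (\<integral>\<^sup>+\<omega>. e2ennreal (X \<omega>) \<partial>M) < \<infinity>
      then enn2ereal (\<integral>\<^sup>+\<omega>. e2ennreal (X \<omega>) \<partial>M) - enn2ereal (\<integral>\<^sup>+\<omega>. e2ennreal (- X \<omega>) \<partial>M)
      else \<infinity>)"

definition integral_functional ::
    "'w measure \<Rightarrow> ('w \<Rightarrow> 'a \<Rightarrow> ereal) \<Rightarrow> ('w \<Rightarrow> 'a) \<Rightarrow> ereal" where
  "integral_functional M f z = ext_expectation M (\<lambda>\<omega>. f \<omega> (z \<omega>))"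

text \<open>Classes of a.s. equal random variables are represented by sets of measurable functions; the
  spaces of strategies below, and all solid spaces, are saturated under a.s. equality.\<close>

definition linear_space :: "('w \<Rightarrow> 'a::real_vector) set \<Rightarrow> bool" where
  "linear_space S \<longleftrightarrow>
     (\<lambda>_. 0) \<in> S \<and>
     (\<forall>u\<in>S. \<forall>u'\<in>S. (\<lambda>\<omega>. u \<omega> + u' \<omega>) \<in> S) \<and>
     (\<forall>c. \<forall>u\<in>S. (\<lambda>\<omega>. c *\<^sub>R u \<omega>) \<in> S)"

definition Linfty :: "'w measure \<Rightarrow> ('w \<Rightarrow> 'a::real_normed_vector) set" where
  "Linfty M = {u \<in> borel_measurable M. \<exists>C. AE \<omega> in M. norm (u \<omega>) \<le> C}"

definition decomposable :: "'w measure \<Rightarrow> ('w \<Rightarrow> 'a::real_normed_vector) set \<Rightarrow> bool" where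
  "decomposable M S \<longleftrightarrow>
     (\<forall>u\<in>S. \<forall>u'\<in>Linfty M. \<forall>A\<in>sets M. (\<lambda>\<omega>. if \<omega> \<in> A then u \<omega> else u' \<omega>) \<in> S)"

definition solid :: "'w measure \<Rightarrow> ('w \<Rightarrow> real ^ 'k) set \<Rightarrow> bool" where
  "solid M S \<longleftrightarrow>
     (\<forall>u'\<in>S. \<forall>u\<in>borel_measurable M.
        (\<forall>i. AE \<omega> in M. \<bar>u \<omega> $ i\<bar> \<le> \<bar>u' \<omega> $ i\<bar>) \<longrightarrow> u \<in> S)"

definition solid_decomposable_space :: "'w measure \<Rightarrow> ('w \<Rightarrow> real ^ 'k) set \<Rightarrow> bool" where
  "solid_decomposable_space M S \<longleftrightarrow>
     S \<subseteq> borel_measurable M \<and> linear_space S \<and> decomposable M S \<and> solid M S"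

definition pairing :: "'w measure \<Rightarrow> ('w \<Rightarrow> 'a::real_inner) \<Rightarrow> ('w \<Rightarrow> 'a) \<Rightarrow> real" where
  "pairing M u y = (\<integral>\<omega>. u \<omega> \<bullet> y \<omega> \<partial>M)"

definition separating_duality ::
    "'w measure \<Rightarrow> ('w \<Rightarrow> 'a::real_inner) set \<Rightarrow> ('w \<Rightarrow> 'a) set \<Rightarrow> bool" where
  "separating_duality M U Y \<longleftrightarrow>
     (\<forall>u\<in>U. \<forall>y\<in>Y. integrable M (\<lambda>\<omega>. u \<omega> \<bullet> y \<omega>)) \<and>
     (\<forall>u\<in>U. (\<forall>y\<in>Y. pairing M u y = 0) \<longrightarrow> (AE \<omega> in M. u \<omega> = 0)) \<and>
     (\<forall>y\<in>Y. (\<forall>u\<in>U. pairing M u y = 0) \<longrightarrow> (AE \<omega> in M. y \<omega> = 0))"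

definition finite_filtration :: "'w measure \<Rightarrow> nat \<Rightarrow> (nat \<Rightarrow> 'w measure) \<Rightarrow> bool" where
  "finite_filtration M T F \<longleftrightarrow>
     (\<forall>t\<le>T. subalgebra M (F t)) \<and> (\<forall>s t. s \<le> t \<longrightarrow> t \<le> T \<longrightarrow> subalgebra (F t) (F s))"

text \<open>The decomposition of the \<open>n\<close> coordinates into blocks of sizes \<open>n\<^sub>0, \<dots>, n\<^sub>T\<close> is given by a
  map \<open>stage\<close> from coordinates to \<open>{0..T}\<close>: the block \<open>x\<^sub>t\<close> of \<open>x\<close> consists of the coordinates
  \<open>i\<close> with \<open>stage i = t\<close>, and \<open>n\<^sub>t\<close> is their number. A block is measurable iff each of its
  coordinates is; as a.s. equal random variables are identified, each coordinate is required
  to have a version that is measurable at its stage.\<close>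

definition adapted_strategies ::
    "'w measure \<Rightarrow> (nat \<Rightarrow> 'w measure) \<Rightarrow> ('n \<Rightarrow> nat) \<Rightarrow> ('w \<Rightarrow> real ^ 'n) set" where
  "adapted_strategies M F stage =
     {x \<in> borel_measurable M.
        \<forall>i. \<exists>g\<in>borel_measurable (F (stage i)). AE \<omega> in M. x \<omega> $ i = g \<omega>}"

definition annihilator ::
    "'w measure \<Rightarrow> ('w \<Rightarrow> 'a::real_inner) set \<Rightarrow> ('w \<Rightarrow> 'a) set \<Rightarrow> ('w \<Rightarrow> 'a) set" where
  "annihilator M V X = {v \<in> V. \<forall>x\<in>X. pairing M x v = 0}"

definition primal_obj ::
    "'w measure \<Rightarrow> ('w \<Rightarrow> 'a \<times> 'b \<Rightarrow> ereal) \<Rightarrow> ('w \<Rightarrow> 'b) \<Rightarrow> ('w \<Rightarrow> 'a) \<Rightarrow> ereal" where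
  "primal_obj M f u x = integral_functional M f (\<lambda>\<omega>. (x \<omega>, u \<omega>))"

definition conj_obj ::
    "'w measure \<Rightarrow> ('w \<Rightarrow> 'a::real_inner \<times> 'b::real_inner \<Rightarrow> ereal) \<Rightarrow>
     ('w \<Rightarrow> 'a) \<Rightarrow> ('w \<Rightarrow> 'b) \<Rightarrow> ereal" where
  "conj_obj M f p y = integral_functional M (\<lambda>\<omega>. conj_fun (f \<omega>)) (\<lambda>\<omega>. (p \<omega>, y \<omega>))"

definition dual_obj ::
    "'w measure \<Rightarrow> ('w \<Rightarrow> 'a::real_inner \<times> 'b::real_inner \<Rightarrow> ereal) \<Rightarrow> ('w \<Rightarrow> 'b) \<Rightarrow>
     ('w \<Rightarrow> 'a) \<Rightarrow> ('w \<Rightarrow> 'b) \<Rightarrow> ereal" where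
  "dual_obj M f u p y = ereal (pairing M u y) - conj_obj M f p y"

end

theory Submission
  imports Defs
begin

text \<open>Fix a dual feasible \<open>q = (p, y)\<close> and subtract from \<open>f\<close> the affine minorant with slope \<open>q\<close>.
  What remains is nonnegative, so one can minimize its expectation over \<open>x\<close> together with a
  perturbation \<open>\<zeta>\<close> of the argument \<open>(x, ubar)\<close> that is charged by
  \<open>\<kappa> * v * (sqrt (1 + norm \<zeta> ^ 2) - 1)\<close>. Minimizers exist: Komlos-type convex combinations make costs and
  perturbations converge, and the linearity of the recession directions replaces a bound on \<open>x\<close>.
  Since the penalty is smooth and has linear growth, stationarity at a minimizer corrects \<open>q\<close> by a
  bounded function to a dual feasible point whose dual value is at least the minimum. Letting
  \<open>\<kappa>\<close> tend to infinity forces \<open>\<zeta>\<close> to \<open>0\<close>, and the same compactness argument yields a strategy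
  whose value is at most the supremum of (D).\<close>

section \<open>Measurable selections\<close>

text \<open>A strategy of (SP) is merely measurable, while \<open>p\<close> annihilates only
  strategies from \<open>X\<close>. So E[x . p] = 0 has to be earned: it holds once x . p has an
  integrable bound on one side, and every appeal to \<open>p\<close> goes through such a bound. The
  multipliers 1 + \<epsilon> and 1 - \<epsilon> serve twice. Along a direction d of recession of the
  tilted epigraph \<open>C\<close> they force d . p = 0, so that the tilt by \<open>q\<close>
  creates no directions beyond those assumed to form a linear space. In the limit problem, 1 +
  \<epsilon> bounds x . p from above. A dual solution need not exist, so no multiplier can be read
  off from a primal solution. The penalty regularizes the problem instead: it is finite everywhere
  and has a bounded gradient, and bounded functions belong to \<open>V\<close> and \<open>Y\<close>,
  so the corrected \<open>q\<close> stays in the dual spaces. Perturbing the strategy coordinates as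
  well as \<open>ubar\<close> is what makes the correction annihilate adapted strategies: shifting x
  by b and \<zeta> by the opposite amount leaves the argument of f unchanged.\<close>

lemma borel_measurable_fst_comp [measurable (raw)]:
  fixes z :: "'w \<Rightarrow> 'a::topological_space \<times> 'b::topological_space"
  assumes "z \<in> borel_measurable M"
  shows "(\<lambda>\<omega>. fst (z \<omega>)) \<in> borel_measurable M"
  by (rule measurable_compose[OF assms borel_measurable_continuous_onI[OF continuous_on_fst[OF continuous_on_id]]])

lemma borel_measurable_snd_comp [measurable (raw)]:
  fixes z :: "'w \<Rightarrow> 'a::topological_space \<times> 'b::topological_space"
  assumes "z \<in> borel_measurable M"
  shows "(\<lambda>\<omega>. snd (z \<omega>)) \<in> borel_measurable M"
  by (rule measurable_compose[OF assms borel_measurable_continuous_onI[OF continuous_on_snd[OF continuous_on_id]]])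

lemma lsc_fun_closed_epi:
  fixes g :: "'a::metric_space \<Rightarrow> ereal"
  assumes "lsc_fun g"
  shows "closed (epi g)"
  unfolding closed_sequential_limits
proof (intro allI impI, elim conjE)
  fix s :: "nat \<Rightarrow> 'a \<times> real" and l
  assume s: "\<forall>n. s n \<in> epi g" and lim: "s \<longlonglongrightarrow> l"
  have f: "(\<lambda>n. fst (s n)) \<longlonglongrightarrow> fst l" and sn: "(\<lambda>n. snd (s n)) \<longlonglongrightarrow> snd l"
    using lim by (auto intro: tendsto_fst tendsto_snd)
  have "\<not> ereal (snd l) < Liminf (nhds (fst l)) g"
  proof
    assume "ereal (snd l) < Liminf (nhds (fst l)) g"
    then obtain y where y: "ereal (snd l) < y" "y < Liminf (nhds (fst l)) g" using dense by blast
    have "\<forall>\<^sub>F x in nhds (fst l). y < g x" using less_LiminfD[OF y(2)] .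
    with f have "\<forall>\<^sub>F n in sequentially. y < g (fst (s n))"
      by (rule eventually_compose_filterlim[rotated])
    moreover have "\<forall>\<^sub>F n in sequentially. ereal (snd (s n)) < y"
      using sn y(1) by (intro order_tendstoD) auto
    ultimately have "\<forall>\<^sub>F n in sequentially. False"
    proof eventually_elim
      case (elim n)
      have "g (fst (s n)) \<le> ereal (snd (s n))" using s by (auto simp: epi_def split: prod.splits)
      then have "y < y" using elim by (meson order_less_le_trans order_less_trans)
      then show False by simp
    qed
    then show False by simp
  qed
  moreover have "g (fst l) \<le> Liminf (nhds (fst l)) g"
    using assms by (auto simp: lsc_fun_def)
  ultimately have "g (fst l) \<le> ereal (snd l)" by simp
  then show "l \<in> epi g" by (auto simp: epi_def split: prod.splits)
qed

text \<open>Each of the two distances is estimated with the projection that belongs to the other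
  point. This squeezes the difference quotient between two expressions with the same limit, because
  the projection is continuous.\<close>

lemma closest_point_inner_limit:
  fixes q h :: "'b::euclidean_space"
  assumes S: "closed S" "convex S" "S \<noteq> {}"
  shows "(\<lambda>n. real (Suc n) * ((infdist (q + (1 / real (Suc n)) *\<^sub>R h) S)\<^sup>2 - (infdist q S)\<^sup>2) / 2)
    \<longlonglongrightarrow> h \<bullet> (q - closest_point S q)"
proof -
  let ?c = "closest_point S"
  define e where "e n = 1 / real (Suc n)" for n
  have en: "e n > 0" for n by (simp add: e_def)
  have e0: "e \<longlonglongrightarrow> 0" unfolding e_def using LIMSEQ_inverse_real_of_nat by (simp add: inverse_eq_divide)
  have inf: "infdist z S = dist z (?c z)" for z
  proof -
    have "?c z \<in> S" using S by (intro closest_point_in_set)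
    moreover have "\<forall>y\<in>S. dist z (?c z) \<le> dist z y" using S closest_point_le by blast
    ultimately show ?thesis using S
      by (metis infdist_notempty cINF_greatest infdist_le order_antisym)
  qed
  have le: "(infdist z S)\<^sup>2 \<le> (norm (z - y))\<^sup>2" if "y \<in> S" for z y
    using infdist_le[OF that, of z] infdist_nonneg[of z S] by (intro power_mono) (auto simp: dist_norm)
  have sq: "(norm (a + t *\<^sub>R h))\<^sup>2 = (norm a)\<^sup>2 + 2 * t * (h \<bullet> a) + t\<^sup>2 * (norm h)\<^sup>2" for a t
    unfolding power2_norm_eq_inner by (simp add: inner_simps inner_commute[of a h] algebra_simps power2_eq_square)
  have up: "(infdist (q + t *\<^sub>R h) S)\<^sup>2 - (infdist q S)\<^sup>2 \<le> 2 * t * (h \<bullet> (q - ?c q)) + t\<^sup>2 * (norm h)\<^sup>2" for t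
  proof -
    have "(infdist (q + t *\<^sub>R h) S)\<^sup>2 \<le> (norm ((q - ?c q) + t *\<^sub>R h))\<^sup>2"
      using le[OF closest_point_in_set[OF S(1,3)], of "q + t *\<^sub>R h" q] by (simp add: algebra_simps)
    then show ?thesis unfolding sq by (simp add: inf dist_norm)
  qed
  have lo: "(infdist (q + t *\<^sub>R h) S)\<^sup>2 - (infdist q S)\<^sup>2 \<ge> 2 * t * (h \<bullet> (q + t *\<^sub>R h - ?c (q + t *\<^sub>R h))) - t\<^sup>2 * (norm h)\<^sup>2" for t
  proof -
    have "(infdist q S)\<^sup>2 \<le> (norm ((q + t *\<^sub>R h - ?c (q + t *\<^sub>R h)) + (- t) *\<^sub>R h))\<^sup>2"
      using le[OF closest_point_in_set[OF S(1,3)], of q "q + t *\<^sub>R h"] by (simp add: algebra_simps)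
    then show ?thesis unfolding sq by (simp add: inf dist_norm)
  qed
  have q: "(\<lambda>n. q + e n *\<^sub>R h) \<longlonglongrightarrow> q"
    using tendsto_add[OF tendsto_const[of q] tendsto_scaleR[OF e0 tendsto_const[of h]]] by simp
  have cq: "(\<lambda>n. ?c (q + e n *\<^sub>R h)) \<longlonglongrightarrow> ?c q"
    using continuous_at_closest_point[OF S(2,1,3), of q] q by (rule isCont_tendsto_compose)
  have l1: "(\<lambda>n. h \<bullet> (q - ?c q) + e n * (norm h)\<^sup>2 / 2) \<longlonglongrightarrow> h \<bullet> (q - ?c q)"
    by (rule tendsto_eq_intros e0 refl | simp)+
  have l2: "(\<lambda>n. h \<bullet> (q + e n *\<^sub>R h - ?c (q + e n *\<^sub>R h)) - e n * (norm h)\<^sup>2 / 2) \<longlonglongrightarrow> h \<bullet> (q - ?c q)"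
    by (rule tendsto_eq_intros e0 q cq refl | simp)+
  have E: "real (Suc n) = 1 / e n" for n by (simp add: e_def)
  have "(\<lambda>n. (1 / e n) * ((infdist (q + e n *\<^sub>R h) S)\<^sup>2 - (infdist q S)\<^sup>2) / 2) \<longlonglongrightarrow> h \<bullet> (q - ?c q)"
  proof (rule tendsto_sandwich[OF _ _ l2 l1]; intro always_eventually allI)
    fix n
    show "(1 / e n) * ((infdist (q + e n *\<^sub>R h) S)\<^sup>2 - (infdist q S)\<^sup>2) / 2 \<le> h \<bullet> (q - ?c q) + e n * (norm h)\<^sup>2 / 2"
      using up[of "e n"] en[of n] by (simp add: field_simps power2_eq_square)
    show "h \<bullet> (q + e n *\<^sub>R h - ?c (q + e n *\<^sub>R h)) - e n * (norm h)\<^sup>2 / 2 \<le> (1 / e n) * ((infdist (q + e n *\<^sub>R h) S)\<^sup>2 - (infdist q S)\<^sup>2) / 2"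
      using lo[of "e n"] en[of n] by (simp add: field_simps power2_eq_square)
  qed
  then show ?thesis by (simp add: E e_def)
qed

lemma measurable_multifun_nonempty:
  assumes "measurable_multifun M S"
  shows "{\<omega> \<in> space M. S \<omega> \<noteq> {}} \<in> sets M"
  using assms[unfolded measurable_multifun_def, rule_format, of UNIV] by simp

lemma borel_measurable_infdist_multifun:
  fixes S :: "'w \<Rightarrow> 'b::euclidean_space set"
  assumes "measurable_multifun M S"
  shows "(\<lambda>\<omega>. infdist q (S \<omega>)) \<in> borel_measurable M"
proof (rule borel_measurableI_less)
  fix r :: real
  \<comment> \<open>The distance to the empty set is 0 by convention, so the points with empty value
    enter exactly when r is positive.\<close>
  have "{\<omega> \<in> space M. infdist q (S \<omega>) < r} =
    {\<omega> \<in> space M. S \<omega> \<inter> ball q r \<noteq> {}} \<union> ((space M - {\<omega> \<in> space M. S \<omega> \<noteq> {}}) \<inter> {\<omega> \<in> space M. 0 < r})"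
    (is "?L = ?R")
  proof (intro set_eqI)
    fix \<omega>
    show "\<omega> \<in> ?L \<longleftrightarrow> \<omega> \<in> ?R"
    proof (cases "S \<omega> = {}")
      case True then show ?thesis by (auto simp: infdist_def)
    next
      case False
      have "infdist q (S \<omega>) < r \<longleftrightarrow> (\<exists>y\<in>S \<omega>. dist q y < r)"
        unfolding infdist_notempty[OF False] using False by (subst cINF_less_iff) auto
      then show ?thesis using False by (auto simp: ball_def)
    qed
  qed
  then show "{\<omega> \<in> space M. infdist q (S \<omega>) < r} \<in> sets M"
    using assms measurable_multifun_nonempty[OF assms]
    by (auto simp: measurable_multifun_def)
qed

text \<open>Projections of a countable dense set are dense in \<open>S\<close>; they are measurable because
  \<open>q - closest_point S q\<close> is the gradient of half the squared distance to \<open>S\<close>.\<close>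

theorem castaing_representation:
  fixes S :: "'w \<Rightarrow> 'b::euclidean_space set"
  assumes S: "measurable_multifun M S" "\<And>\<omega>. \<omega> \<in> space M \<Longrightarrow> closed (S \<omega>) \<and> convex (S \<omega>)"
  obtains c :: "nat \<Rightarrow> 'w \<Rightarrow> 'b" where
    "\<And>j. c j \<in> borel_measurable M"
    "\<And>\<omega>. \<omega> \<in> space M \<Longrightarrow> S \<omega> \<noteq> {} \<Longrightarrow> closure (range (\<lambda>j. c j \<omega>)) = S \<omega>"
proof -
  obtain D :: "'b set" where D: "countable D" "\<And>X. open X \<Longrightarrow> X \<noteq> {} \<Longrightarrow> \<exists>d\<in>D. d \<in> X"
    using countable_dense_setE by blast
  then have "D \<noteq> {}" by (metis empty_iff open_UNIV UNIV_not_empty)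
  define d where "d = from_nat_into D"
  have dr: "range d = D" unfolding d_def using D(1) \<open>D \<noteq> {}\<close> by (simp add: range_from_nat_into)
  define c where "c j \<omega> = (if S \<omega> \<noteq> {} then closest_point (S \<omega>) (d j) else 0)" for j \<omega>
  have c: "c j \<in> borel_measurable M" for j
  proof (subst borel_measurable_euclidean_space, intro ballI)
    fix h :: 'b
    have "(\<lambda>\<omega>. if S \<omega> \<noteq> {} then h \<bullet> d j - h \<bullet> (d j - closest_point (S \<omega>) (d j)) else 0) \<in> borel_measurable M"
    proof (rule borel_measurable_LIMSEQ_real)
      show "(\<lambda>n. if S \<omega> \<noteq> {} then h \<bullet> d j - real (Suc n) * ((infdist (d j + (1 / real (Suc n)) *\<^sub>R h) (S \<omega>))\<^sup>2 - (infdist (d j) (S \<omega>))\<^sup>2) / 2 else 0)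
        \<longlonglongrightarrow> (if S \<omega> \<noteq> {} then h \<bullet> d j - h \<bullet> (d j - closest_point (S \<omega>) (d j)) else 0)"
        if "\<omega> \<in> space M" for \<omega>
        using tendsto_diff[OF tendsto_const closest_point_inner_limit, of "S \<omega>" "h \<bullet> d j" "d j" h] S(2)[OF that]
        by auto
      have [measurable]: "Measurable.pred M (\<lambda>\<omega>. S \<omega> \<noteq> {})"
        using measurable_multifun_nonempty[OF S(1)] by (simp add: pred_def)
      have [measurable]: "(\<lambda>\<omega>. infdist q (S \<omega>)) \<in> borel_measurable M" for q
        by (rule borel_measurable_infdist_multifun[OF S(1)])
      show "(\<lambda>\<omega>. if S \<omega> \<noteq> {} then h \<bullet> d j - real (Suc n) * ((infdist (d j + (1 / real (Suc n)) *\<^sub>R h) (S \<omega>))\<^sup>2 - (infdist (d j) (S \<omega>))\<^sup>2) / 2 else 0)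
        \<in> borel_measurable M" for n
        by measurable
    qed
    then show "(\<lambda>\<omega>. c j \<omega> \<bullet> h) \<in> borel_measurable M"
      by (rule measurable_cong[THEN iffD1, rotated]) (auto simp: c_def inner_diff_right inner_commute)
  qed
  have "closure (range (\<lambda>j. c j \<omega>)) = S \<omega>" if \<omega>: "\<omega> \<in> space M" "S \<omega> \<noteq> {}" for \<omega>
  proof (rule antisym)
    have cl: "closed (S \<omega>)" using S(2)[OF \<omega>(1)] by simp
    show "closure (range (\<lambda>j. c j \<omega>)) \<subseteq> S \<omega>"
      using cl \<omega>(2) closest_point_in_set[OF cl \<omega>(2)] by (intro closure_minimal) (auto simp: c_def)
    show "S \<omega> \<subseteq> closure (range (\<lambda>j. c j \<omega>))"
    proof
      fix s assume s: "s \<in> S \<omega>"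
      show "s \<in> closure (range (\<lambda>j. c j \<omega>))"
        unfolding closure_approachable
      proof (intro allI impI)
        fix e :: real assume "e > 0"
        \<comment> \<open>Radius e / 2 suffices: the projection of \<open>z\<close> is no farther
          from \<open>z\<close> than \<open>s\<close> is, hence within e of
          \<open>s\<close>.\<close>
        then obtain z where z: "z \<in> D" "z \<in> ball s (e/2)" using D(2)[of "ball s (e/2)"] by auto
        obtain j where j: "z = d j" using z(1) dr by auto
        have "dist s (c j \<omega>) \<le> dist s z + dist z (c j \<omega>)" by (rule dist_triangle)
        also have "dist z (c j \<omega>) \<le> dist z s"
          using closest_point_le[OF cl s, of z] \<omega>(2) by (simp add: c_def j)
        finally have "dist (c j \<omega>) s < e" using z(2) by (simp add: dist_commute)
        then show "\<exists>y\<in>range (\<lambda>j. c j \<omega>). dist y s < e" by blast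
      qed
    qed
  qed
  with c show ?thesis by (rule that)
qed

section \<open>Measurability of normal integrands and their conjugates along measurable
  functions\<close>

lemma borel_measurable_ereal_iff_atMost_real:
  fixes f :: "'w \<Rightarrow> ereal"
  assumes "\<And>r::real. {\<omega> \<in> space M. f \<omega> \<le> ereal r} \<in> sets M"
  shows "f \<in> borel_measurable M"
  unfolding borel_measurable_iff_Iic_ereal
proof
  fix a :: ereal
  have [measurable]: "Measurable.pred M (\<lambda>\<omega>. f \<omega> \<le> ereal r)" for r :: real
    unfolding pred_def by (rule assms)
  have "{\<omega> \<in> space M. f \<omega> \<le> a} \<in> sets M"
  proof (cases a)
    case MInf
    have *: "f \<omega> \<le> -\<infinity> \<longleftrightarrow> (\<forall>n::nat. f \<omega> \<le> ereal (- real n))" for \<omega>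
    proof (cases "f \<omega>")
      case (real r)
      obtain n where "- r < real n" using reals_Archimedean2 by blast
      with real show ?thesis by (auto intro!: exI[of _ n])
    qed auto
    show ?thesis unfolding MInf * by measurable
  next
    case (real r)
    show ?thesis unfolding real by (rule assms)
  next
    case PInf
    show ?thesis unfolding PInf by simp
  qed
  also have "{\<omega> \<in> space M. f \<omega> \<le> a} = f -` {..a} \<inter> space M" by auto
  finally show "f -` {..a} \<inter> space M \<in> sets M" .
qed

lemma normal_integrand_castaing:
  fixes f :: "'w \<Rightarrow> 'a::euclidean_space \<Rightarrow> ereal"
  assumes "convex_normal_integrand M f"
  obtains c :: "nat \<Rightarrow> 'w \<Rightarrow> 'a \<times> real" where
    "\<And>j. c j \<in> borel_measurable M"
    "\<And>\<omega>. \<omega> \<in> space M \<Longrightarrow> epi (f \<omega>) \<noteq> {} \<Longrightarrow> closure (range (\<lambda>j. c j \<omega>)) = epi (f \<omega>)"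
  using assms castaing_representation[of M "\<lambda>\<omega>. epi (f \<omega>)"]
  by (auto simp: convex_normal_integrand_def closed_fun_def convex_fun_def intro: lsc_fun_closed_epi)

text \<open>A sublevel condition says that (z, r) lies in the closed epigraph, that is, that it is
  approximated by the countably many measurable selections.\<close>

lemma borel_measurable_normal_integrand:
  fixes f :: "'w \<Rightarrow> 'a::euclidean_space \<Rightarrow> ereal"
  assumes f: "convex_normal_integrand M f" and z[measurable]: "z \<in> borel_measurable M"
  shows "(\<lambda>\<omega>. f \<omega> (z \<omega>)) \<in> borel_measurable M"
proof (rule borel_measurable_ereal_iff_atMost_real)
  fix r :: real
  obtain c where c[measurable]: "\<And>j::nat. c j \<in> borel_measurable M" and
    cl: "\<And>\<omega>. \<omega> \<in> space M \<Longrightarrow> epi (f \<omega>) \<noteq> {} \<Longrightarrow> closure (range (\<lambda>j. c j \<omega>)) = epi (f \<omega>)"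
    using normal_integrand_castaing[OF f] by blast
  have [measurable]: "Measurable.pred M (\<lambda>\<omega>. epi (f \<omega>) \<noteq> {})"
    using f measurable_multifun_nonempty by (auto simp: pred_def convex_normal_integrand_def)
  have "f \<omega> (z \<omega>) \<le> ereal r \<longleftrightarrow> epi (f \<omega>) \<noteq> {} \<and> (\<forall>n::nat. \<exists>j. dist (c j \<omega>) (z \<omega>, r) < 1 / real (Suc n))"
    (is "?l \<longleftrightarrow> ?r")
    if "\<omega> \<in> space M" for \<omega>
  proof -
    have "?l \<longleftrightarrow> (z \<omega>, r) \<in> epi (f \<omega>)" by (simp add: epi_def)
    also have "\<dots> \<longleftrightarrow> epi (f \<omega>) \<noteq> {} \<and> (z \<omega>, r) \<in> closure (range (\<lambda>j. c j \<omega>))"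
      using cl[OF that] by (cases "epi (f \<omega>) = {}") auto
    also have "(z \<omega>, r) \<in> closure (range (\<lambda>j. c j \<omega>)) \<longleftrightarrow> (\<forall>n::nat. \<exists>j. dist (c j \<omega>) (z \<omega>, r) < 1 / real (Suc n))"
      unfolding closure_approachable
    proof safe
      fix n :: nat
      assume "\<forall>e>0. \<exists>y\<in>range (\<lambda>j. c j \<omega>). dist y (z \<omega>, r) < e"
      then have "\<exists>y\<in>range (\<lambda>j. c j \<omega>). dist y (z \<omega>, r) < 1 / real (Suc n)"
        by (rule allE[of _ "1 / real (Suc n)"]) simp
      then show "\<exists>j. dist (c j \<omega>) (z \<omega>, r) < 1 / real (Suc n)" by blast
    next
      fix e :: real assume *: "\<forall>n. \<exists>j. dist (c j \<omega>) (z \<omega>, r) < 1 / real (Suc n)" and "0 < e"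
      then obtain n where "1 / real (Suc n) < e" using nat_approx_posE by blast
      with * show "\<exists>y\<in>range (\<lambda>j. c j \<omega>). dist y (z \<omega>, r) < e" by (meson less_trans rangeI)
    qed
    finally show ?thesis .
  qed
  then have "{\<omega> \<in> space M. f \<omega> (z \<omega>) \<le> ereal r} =
    {\<omega> \<in> space M. epi (f \<omega>) \<noteq> {} \<and> (\<forall>n::nat. \<exists>j. dist (c j \<omega>) (z \<omega>, r) < 1 / real (Suc n))}" by auto
  also have "\<dots> \<in> sets M" by measurable
  finally show "{\<omega> \<in> space M. f \<omega> (z \<omega>) \<le> ereal r} \<in> sets M" .
qed

text \<open>The epigraph form involves real numbers only and describes a closed halfspace containing
  the epigraph. It can therefore be tested on a dense sequence of selections.\<close>

lemma conj_fun_le_iff: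
  fixes g :: "'a::real_inner \<Rightarrow> ereal"
  shows "conj_fun g v \<le> ereal t \<longleftrightarrow> (\<forall>(z, \<alpha>)\<in>epi g. z \<bullet> v - \<alpha> \<le> t)"
proof
  assume *: "conj_fun g v \<le> ereal t"
  show "\<forall>(z, \<alpha>)\<in>epi g. z \<bullet> v - \<alpha> \<le> t"
  proof safe
    fix z \<alpha> assume "(z, \<alpha>) \<in> epi g"
    then have "g z \<le> ereal \<alpha>" by (simp add: epi_def)
    moreover have "ereal (z \<bullet> v) - g z \<le> ereal t"
      using * unfolding conj_fun_def by (meson SUP_le_iff UNIV_I)
    ultimately show "z \<bullet> v - \<alpha> \<le> t" by (cases "g z") auto
  qed
next
  assume *: "\<forall>(z, \<alpha>)\<in>epi g. z \<bullet> v - \<alpha> \<le> t"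
  show "conj_fun g v \<le> ereal t"
    unfolding conj_fun_def
  proof (rule SUP_least)
    fix z
    show "ereal (z \<bullet> v) - g z \<le> ereal t"
    proof (cases "g z")
      case (real r)
      then show ?thesis using * by (auto simp: epi_def)
    next
      case MInf
      \<comment> \<open>At a point with value minus infinity every height is available; this one
        exceeds the bound t by 1.\<close>
      then have "(z, z \<bullet> v - t - 1) \<in> epi g" by (simp add: epi_def)
      with * show ?thesis by force
    qed simp
  qed
qed

text \<open>The closed halfspace \<open>?H\<close> contains the epigraph iff it contains the dense
  selections, which leaves countably many measurable conditions.\<close>

lemma borel_measurable_conj_fun:
  fixes f :: "'w \<Rightarrow> 'a::euclidean_space \<Rightarrow> ereal"
  assumes f: "convex_normal_integrand M f" and v[measurable]: "v \<in> borel_measurable M"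
  shows "(\<lambda>\<omega>. conj_fun (f \<omega>) (v \<omega>)) \<in> borel_measurable M"
proof (rule borel_measurable_ereal_iff_atMost_real)
  fix t :: real
  obtain c where c[measurable]: "\<And>j::nat. c j \<in> borel_measurable M" and
    cl: "\<And>\<omega>. \<omega> \<in> space M \<Longrightarrow> epi (f \<omega>) \<noteq> {} \<Longrightarrow> closure (range (\<lambda>j. c j \<omega>)) = epi (f \<omega>)"
    using normal_integrand_castaing[OF f] by blast
  have [measurable]: "Measurable.pred M (\<lambda>\<omega>. epi (f \<omega>) \<noteq> {})"
    using f measurable_multifun_nonempty by (auto simp: pred_def convex_normal_integrand_def)
  have "conj_fun (f \<omega>) (v \<omega>) \<le> ereal t \<longleftrightarrow>
      \<not> epi (f \<omega>) \<noteq> {} \<or> (\<forall>j. fst (c j \<omega>) \<bullet> v \<omega> - snd (c j \<omega>) \<le> t)"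
    if "\<omega> \<in> space M" for \<omega>
  proof (cases "epi (f \<omega>) = {}")
    case True
    then show ?thesis by (simp add: conj_fun_le_iff)
  next
    case False
    let ?H = "{s::'a \<times> real. fst s \<bullet> v \<omega> - snd s \<le> t}"
    have "closed ?H" by (intro closed_Collect_le continuous_intros)
    then have "closure (range (\<lambda>j. c j \<omega>)) \<subseteq> ?H \<longleftrightarrow> range (\<lambda>j. c j \<omega>) \<subseteq> ?H"
      using closure_minimal[of _ ?H] closure_subset[of "range (\<lambda>j. c j \<omega>)"] by blast
    then have "epi (f \<omega>) \<subseteq> ?H \<longleftrightarrow> (\<forall>j. c j \<omega> \<in> ?H)"
      by (simp add: cl[OF that False] image_subset_iff)
    moreover have "conj_fun (f \<omega>) (v \<omega>) \<le> ereal t \<longleftrightarrow> epi (f \<omega>) \<subseteq> ?H"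
      unfolding conj_fun_le_iff by auto
    ultimately show ?thesis using False by simp
  qed
  then have "{\<omega> \<in> space M. conj_fun (f \<omega>) (v \<omega>) \<le> ereal t} =
    {\<omega> \<in> space M. \<not> epi (f \<omega>) \<noteq> {} \<or> (\<forall>j. fst (c j \<omega>) \<bullet> v \<omega> - snd (c j \<omega>) \<le> t)}" by auto
  also have "\<dots> \<in> sets M" by measurable
  finally show "{\<omega> \<in> space M. conj_fun (f \<omega>) (v \<omega>) \<le> ereal t} \<in> sets M" .
qed

section \<open>Perspective cones\<close>

text \<open>The closed perspective cone, cut out by the halfspaces containing \<open>S\<close>: at height \<open>1\<close> it is
  \<open>S\<close>, at height \<open>0\<close> the recession cone of \<open>S\<close>.\<close>

definition pcone :: "'e::euclidean_space set \<Rightarrow> ('e \<times> real) set" where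
  "pcone S = {(s, t). 0 \<le> t \<and> (\<forall>a b. (\<forall>z\<in>S. a \<bullet> z \<le> b) \<longrightarrow> a \<bullet> s \<le> b * t)}"

lemma closed_pcone: "closed (pcone S)"
proof -
  have "pcone S = {u. 0 \<le> snd u} \<inter> (\<Inter>(a, b)\<in>{(a, b). \<forall>z\<in>S. a \<bullet> z \<le> b}. {u. a \<bullet> fst u \<le> b * snd u})"
    by (auto simp: pcone_def)
  also have "closed \<dots>"
    by (intro closed_Int closed_INT ballI) (auto intro!: closed_Collect_le continuous_intros)
  finally show ?thesis .
qed

lemma convex_cone_pcone: "convex_cone (pcone S)"
  unfolding convex_cone_iff
proof safe
  show "0 \<in> pcone S" by (auto simp: pcone_def zero_prod_def)
next
  fix s t s' t' assume "(s, t) \<in> pcone S" "(s', t') \<in> pcone S"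
  then show "(s, t) + (s', t') \<in> pcone S"
    by (auto simp: pcone_def inner_add_right distrib_left intro!: add_mono)
next
  fix s t and c :: real assume "(s, t) \<in> pcone S" "0 \<le> c"
  then show "c *\<^sub>R (s, t) \<in> pcone S"
    by (auto simp: pcone_def mult.left_commute[of _ c] intro!: mult_left_mono)
qed

lemma pcone_1_iff:
  assumes "closed S" "convex S"
  shows "(s, 1) \<in> pcone S \<longleftrightarrow> s \<in> S"
proof
  assume s: "(s, 1) \<in> pcone S"
  show "s \<in> S"
  proof (rule ccontr)
    assume "s \<notin> S"
    then obtain a b where ab: "a \<bullet> s < b" "\<forall>x\<in>S. a \<bullet> x > b"
      using separating_hyperplane_closed_point assms by blast
    then have "\<forall>z\<in>S. (- a) \<bullet> z \<le> - b" by auto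
    with s have "(- a) \<bullet> s \<le> - b * 1" unfolding pcone_def by blast
    with ab show False by simp
  qed
qed (auto simp: pcone_def)

text \<open>Adding a multiple of a cone element of height 0 to (z, 1) stays in the convex cone and
  keeps the height 1.\<close>

lemma pcone_0_imp:
  assumes "closed S" "convex S" "(s, 0) \<in> pcone S" "z \<in> S" "0 \<le> c"
  shows "z + c *\<^sub>R s \<in> S"
proof -
  have "(z, 1) \<in> pcone S" using assms by (simp add: pcone_1_iff)
  then have "(z, 1) + c *\<^sub>R (s, 0) \<in> pcone S"
    using assms convex_cone_pcone by (intro convex_cone_add convex_cone_scaleR)
  then show ?thesis using assms by (simp add: pcone_1_iff)
qed

lemma pcone_0I:
  assumes "z \<in> S" "\<And>c. 0 < c \<Longrightarrow> z + c *\<^sub>R s \<in> S"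
  shows "(s, 0) \<in> pcone S"
  unfolding pcone_def
proof (clarsimp)
  fix a b assume ab: "\<forall>z\<in>S. a \<bullet> z \<le> b"
  show "a \<bullet> s \<le> 0"
  proof (rule ccontr)
    assume "\<not> ?thesis"
    then have pos: "a \<bullet> s > 0" by simp
    \<comment> \<open>Chosen so that the functional a grows by \<bar>b - a . z\<bar> + 1 along the
      ray, which carries it beyond b.\<close>
    define c where "c = (\<bar>b - a \<bullet> z\<bar> + 1) / (a \<bullet> s)"
    have "c > 0" using pos by (simp add: c_def)
    with ab assms(2) have "a \<bullet> (z + c *\<^sub>R s) \<le> b" by blast
    then have "a \<bullet> z + (\<bar>b - a \<bullet> z\<bar> + 1) \<le> b" using pos by (simp add: inner_add_right c_def)
    then show False by linarith
  qed
qed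

section \<open>Adapted processes\<close>

locale staged = prob_space M for M :: "'w measure" +
  fixes F :: "nat \<Rightarrow> 'w measure" and stage :: "'n::finite \<Rightarrow> nat"
  assumes sub: "\<And>i. subalgebra M (F (stage i))"
    and sub_mono: "\<And>i j. stage i \<le> stage j \<Longrightarrow> subalgebra (F (stage j)) (F (stage i))"
begin

text \<open>The strict notion, without exceptional null sets. Truncations and random indices can
  then be handled pointwise; a strategy in \<open>adapted_strategies\<close> is replaced by such a
  version in \<open>N_version\<close>.\<close>

definition adapted :: "('w \<Rightarrow> real ^ 'n) set" where
  "adapted = {x. \<forall>i. (\<lambda>\<omega>. x \<omega> $ i) \<in> borel_measurable (F (stage i))}"

lemma measurable_stage_M: "g \<in> measurable (F (stage i)) N \<Longrightarrow> g \<in> measurable M N"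
  using sub measurable_from_subalg by blast

lemma measurable_stage_mono:
  "g \<in> measurable (F (stage i)) N \<Longrightarrow> stage i \<le> stage j \<Longrightarrow> g \<in> measurable (F (stage j)) N"
  using sub_mono measurable_from_subalg by blast

lemma adapted_measurable:
  assumes "x \<in> adapted" shows "x \<in> borel_measurable M"
proof (subst borel_measurable_euclidean_space, intro ballI)
  fix b :: "real ^ 'n" assume "b \<in> Basis"
  then obtain i where "b = axis i 1" by (auto simp: Basis_vec_def)
  moreover have "(\<lambda>\<omega>. x \<omega> $ i) \<in> borel_measurable M"
    using assms by (auto simp: adapted_def intro: measurable_stage_M)
  ultimately show "(\<lambda>\<omega>. x \<omega> \<bullet> b) \<in> borel_measurable M" by (simp add: inner_axis)
qed

lemma adapted_nth: "x \<in> adapted \<Longrightarrow> (\<lambda>\<omega>. x \<omega> $ i) \<in> borel_measurable (F (stage i))"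
  by (simp add: adapted_def)

lemma adapted_0: "(\<lambda>_. 0) \<in> adapted"
  by (simp add: adapted_def)

lemma adapted_add: "x \<in> adapted \<Longrightarrow> y \<in> adapted \<Longrightarrow> (\<lambda>\<omega>. x \<omega> + y \<omega>) \<in> adapted"
  by (auto simp: adapted_def intro!: borel_measurable_add)

lemma adapted_diff: "x \<in> adapted \<Longrightarrow> y \<in> adapted \<Longrightarrow> (\<lambda>\<omega>. x \<omega> - y \<omega>) \<in> adapted"
  by (auto simp: adapted_def intro!: borel_measurable_diff)

lemma adapted_scaleR: "x \<in> adapted \<Longrightarrow> (\<lambda>\<omega>. (c::real) *\<^sub>R x \<omega>) \<in> adapted"
  by (auto simp: adapted_def intro!: borel_measurable_times)

lemma adapted_sum: "(\<And>j. j \<in> J \<Longrightarrow> x j \<in> adapted) \<Longrightarrow> (\<lambda>\<omega>. \<Sum>j\<in>J. x j \<omega>) \<in> adapted"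
  by (induction J rule: infinite_finite_induct) (auto intro: adapted_0 adapted_add)

text \<open>A factor known only at the stage of i would spoil coordinates observed earlier, but
  those vanish here. This is why the inductions below remove coordinates in the order of their
  stages.\<close>

lemma adapted_scale_stage:
  assumes "x \<in> adapted" "c \<in> borel_measurable (F (stage i))"
    and "\<And>j \<omega>. stage j < stage i \<Longrightarrow> x \<omega> $ j = 0"
  shows "(\<lambda>\<omega>. c \<omega> *\<^sub>R x \<omega>) \<in> adapted"
  unfolding adapted_def
proof (clarify)
  fix j
  show "(\<lambda>\<omega>. (c \<omega> *\<^sub>R x \<omega>) $ j) \<in> borel_measurable (F (stage j))"
  proof (cases "stage j < stage i")
    case True then show ?thesis using assms(3) by simp
  next
    case False
    then have "c \<in> borel_measurable (F (stage j))"
      using assms(2) measurable_stage_mono by (meson not_le)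
    then show ?thesis using adapted_nth[OF assms(1), of j] by simp
  qed
qed

lemma adapted_axis:
  assumes "c \<in> borel_measurable (F (stage i))"
  shows "(\<lambda>\<omega>. c \<omega> *\<^sub>R axis i 1) \<in> adapted"
  unfolding adapted_def
proof (clarify)
  fix j
  show "(\<lambda>\<omega>. (c \<omega> *\<^sub>R (axis i 1 :: real ^ 'n)) $ j) \<in> borel_measurable (F (stage j))"
    using assms by (cases "j = i") (auto simp: axis_def intro!: borel_measurable_scaleR)
qed

lemma adapted_random_index:
  assumes "\<And>k::nat. x k \<in> adapted" "\<tau> \<in> measurable (F (stage i)) (count_space UNIV)"
    and "\<And>k j \<omega>. stage j < stage i \<Longrightarrow> x k \<omega> $ j = 0"
  shows "(\<lambda>\<omega>. x (\<tau> \<omega>) \<omega>) \<in> adapted"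
  unfolding adapted_def
proof (clarify)
  fix j
  show "(\<lambda>\<omega>. x (\<tau> \<omega>) \<omega> $ j) \<in> borel_measurable (F (stage j))"
  proof (cases "stage j < stage i")
    case True then show ?thesis using assms(3) by simp
  next
    case False
    then have "\<tau> \<in> measurable (F (stage j)) (count_space UNIV)"
      using assms(2) measurable_stage_mono by (meson not_le)
    then show ?thesis
      by (rule measurable_compose_countable[of "\<lambda>k \<omega>. x k \<omega> $ j", OF adapted_nth[OF assms(1)]])
  qed
qed

subsection \<open>Annihilating bounded strategies\<close>

text \<open>Truncating the coordinate of the earliest stage in \<open>I\<close> keeps \<open>x\<close> adapted, as all its other
  nonzero coordinates are observed later.\<close>

lemma adapted_annihilator_aux:
  fixes q :: "'w \<Rightarrow> real ^ 'n"
  assumes q: "\<And>i. integrable M (\<lambda>\<omega>. q \<omega> $ i)"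
    and perp: "\<And>x c. x \<in> adapted \<Longrightarrow> \<forall>\<omega>. norm (x \<omega>) \<le> c \<Longrightarrow> (\<integral>\<omega>. x \<omega> \<bullet> q \<omega> \<partial>M) = 0"
  shows "x \<in> adapted \<Longrightarrow> (\<And>\<omega> i. i \<notin> I \<Longrightarrow> x \<omega> $ i = 0) \<Longrightarrow> integrable M h \<Longrightarrow>
    (AE \<omega> in M. h \<omega> \<le> x \<omega> \<bullet> q \<omega>) \<Longrightarrow>
    integrable M (\<lambda>\<omega>. x \<omega> \<bullet> q \<omega>) \<and> (\<integral>\<omega>. x \<omega> \<bullet> q \<omega> \<partial>M) = 0"
  using finite[of I]
\<comment> \<open>The ranking induction adds an element of largest rank; with the negated stage as
  rank, the coordinate \<open>i\<close> split off belongs to the earliest stage.\<close>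
proof (induction I arbitrary: x h rule: finite_ranking_induct[where f = "\<lambda>i. - int (stage i)"])
  case empty
  then have "x \<omega> = 0" for \<omega> by (simp add: vec_eq_iff)
  then show ?case by simp
next
  case (insert i I)
  note x = \<open>x \<in> adapted\<close>
  have [measurable]: "q \<in> borel_measurable M"
  proof (subst borel_measurable_euclidean_space, intro ballI)
    fix b :: "real ^ 'n" assume "b \<in> Basis"
    then show "(\<lambda>\<omega>. q \<omega> \<bullet> b) \<in> borel_measurable M"
      using q by (auto simp: Basis_vec_def inner_axis)
  qed
  have [measurable]: "x \<in> borel_measurable M" using x by (rule adapted_measurable)
  have xi: "(\<lambda>\<omega>. x \<omega> $ i) \<in> borel_measurable (F (stage i))" using x by (rule adapted_nth)
  have low: "x \<omega> $ j = 0" if "stage j < stage i" for j \<omega>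
  proof -
    have "j \<notin> insert i I" using insert.hyps(2)[of j] that by auto
    then show ?thesis by (rule insert.prems(2))
  qed
  have [measurable]: "(\<lambda>\<omega>. x \<omega> $ i) \<in> borel_measurable M" using xi by (rule measurable_stage_M)
  have [measurable]: "(\<lambda>\<omega>. q \<omega> $ i) \<in> borel_measurable M" using q[of i] by simp
  define A where "A k \<omega> = (if \<bar>x \<omega> $ i\<bar> \<le> real k then 1 else 0::real)" for k :: nat and \<omega>
  have A: "A k \<in> borel_measurable (F (stage i))" for k unfolding A_def using xi by measurable
  have [measurable]: "A k \<in> borel_measurable M" for k using A by (rule measurable_stage_M)
  have part: "integrable M (\<lambda>\<omega>. A k \<omega> * (x \<omega> \<bullet> q \<omega>)) \<and> (\<integral>\<omega>. A k \<omega> * (x \<omega> \<bullet> q \<omega>) \<partial>M) = 0" for k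
  proof -
    \<comment> \<open>The truncated coordinate alone is bounded, so \<open>perp\<close> applies to
      it. The remainder \<open>y\<close> has lost this coordinate and falls under the induction
      hypothesis.\<close>
    define b where "b \<omega> = (A k \<omega> * x \<omega> $ i) *\<^sub>R (axis i 1 :: real ^ 'n)" for \<omega>
    have b: "b \<in> adapted" unfolding b_def by (intro adapted_axis borel_measurable_times A xi)
    have "norm (b \<omega>) \<le> real k" for \<omega> by (simp add: b_def A_def norm_axis_1)
    then have b0: "(\<integral>\<omega>. b \<omega> \<bullet> q \<omega> \<partial>M) = 0" using perp[OF b] by blast
    have bq: "b \<omega> \<bullet> q \<omega> = A k \<omega> * x \<omega> $ i * q \<omega> $ i" for \<omega> by (simp add: b_def inner_axis' )
    have bi: "integrable M (\<lambda>\<omega>. b \<omega> \<bullet> q \<omega>)"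
      unfolding bq
    proof (rule Bochner_Integration.integrable_bound[OF integrable_mult_right[OF q[of i], of "real k"]])
      show "AE \<omega> in M. norm (A k \<omega> * x \<omega> $ i * q \<omega> $ i) \<le> norm (real k * q \<omega> $ i)"
        by (auto simp: A_def abs_mult intro!: mult_right_mono)
    qed measurable
    define y where "y \<omega> = A k \<omega> *\<^sub>R x \<omega> - b \<omega>" for \<omega>
    have y: "y \<in> adapted" unfolding y_def
      by (intro adapted_diff b adapted_scale_stage[OF x A]) (rule low)
    have yq: "y \<omega> \<bullet> q \<omega> = A k \<omega> * (x \<omega> \<bullet> q \<omega>) - b \<omega> \<bullet> q \<omega>" for \<omega> by (simp add: y_def inner_diff_left)
    have "integrable M (\<lambda>\<omega>. y \<omega> \<bullet> q \<omega>) \<and> (\<integral>\<omega>. y \<omega> \<bullet> q \<omega> \<partial>M) = 0"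
    proof (rule insert.IH[OF y, of "\<lambda>\<omega>. - \<bar>h \<omega>\<bar> - \<bar>b \<omega> \<bullet> q \<omega>\<bar>"])
      show "y \<omega> $ j = 0" if "j \<notin> I" for \<omega> j
        using that insert.prems(2)[of j \<omega>] by (cases "j = i") (auto simp: y_def b_def axis_def)
      show "integrable M (\<lambda>\<omega>. - \<bar>h \<omega>\<bar> - \<bar>b \<omega> \<bullet> q \<omega>\<bar>)" using bi insert.prems(3) by auto
      show "AE \<omega> in M. - \<bar>h \<omega>\<bar> - \<bar>b \<omega> \<bullet> q \<omega>\<bar> \<le> y \<omega> \<bullet> q \<omega>"
        using insert.prems(4) by eventually_elim (auto simp: yq A_def)
    qed
    then have "integrable M (\<lambda>\<omega>. y \<omega> \<bullet> q \<omega> + b \<omega> \<bullet> q \<omega>) \<and> (\<integral>\<omega>. y \<omega> \<bullet> q \<omega> + b \<omega> \<bullet> q \<omega> \<partial>M) = 0"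
      using bi b0 by simp
    then show ?thesis by (simp add: yq)
  qed
  \<comment> \<open>The truncated integrals vanish, so Fatou bounds the integral of the nonnegative
    function x . q + \<bar>h\<bar> by that of \<bar>h\<bar>. This gives integrability, and only then
    can dominated convergence remove the truncation.\<close>
  let ?u = "\<lambda>\<omega>. x \<omega> \<bullet> q \<omega>"
  have lim: "(\<lambda>k. A k \<omega> * g) \<longlonglongrightarrow> g" for \<omega> g
  proof (rule tendsto_eventually)
    obtain n :: nat where "\<bar>x \<omega> $ i\<bar> \<le> real n" using real_arch_simple by blast
    then show "\<forall>\<^sub>F k in sequentially. A k \<omega> * g = g"
      unfolding eventually_sequentially by (intro exI[of _ n]) (auto simp: A_def)
  qed
  have "(\<integral>\<^sup>+\<omega>. ennreal (?u \<omega> + \<bar>h \<omega>\<bar>) \<partial>M) \<le> ennreal (\<integral>\<omega>. \<bar>h \<omega>\<bar> \<partial>M)"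
  proof -
    have "(\<integral>\<^sup>+\<omega>. ennreal (?u \<omega> + \<bar>h \<omega>\<bar>) \<partial>M) = (\<integral>\<^sup>+\<omega>. liminf (\<lambda>k. ennreal (A k \<omega> * (?u \<omega> + \<bar>h \<omega>\<bar>))) \<partial>M)"
      by (intro nn_integral_cong lim_imp_Liminf[symmetric] tendsto_ennrealI lim) simp
    also have "\<dots> \<le> liminf (\<lambda>k. \<integral>\<^sup>+\<omega>. ennreal (A k \<omega> * (?u \<omega> + \<bar>h \<omega>\<bar>)) \<partial>M)"
      by (rule nn_integral_liminf) (use insert.prems(3) in measurable)
    also have "\<dots> \<le> ennreal (\<integral>\<omega>. \<bar>h \<omega>\<bar> \<partial>M)"
    proof (rule Liminf_le[OF _ always_eventually, rotated], rule)
      fix k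
      have hA: "integrable M (\<lambda>\<omega>. A k \<omega> * \<bar>h \<omega>\<bar>)"
      proof (rule Bochner_Integration.integrable_bound[OF insert.prems(3)])
        show "AE \<omega> in M. norm (A k \<omega> * \<bar>h \<omega>\<bar>) \<le> norm (h \<omega>)" by (auto simp: A_def)
      qed (use insert.prems(3) in measurable)
      have "(\<integral>\<^sup>+\<omega>. ennreal (A k \<omega> * (?u \<omega> + \<bar>h \<omega>\<bar>)) \<partial>M) = ennreal (\<integral>\<omega>. A k \<omega> * ?u \<omega> + A k \<omega> * \<bar>h \<omega>\<bar> \<partial>M)"
        unfolding distrib_left
      proof (rule nn_integral_eq_integral)
        show "AE \<omega> in M. 0 \<le> A k \<omega> * ?u \<omega> + A k \<omega> * \<bar>h \<omega>\<bar>"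
          using insert.prems(4) by eventually_elim (auto simp: A_def)
      qed (use part hA in auto)
      also have "(\<integral>\<omega>. A k \<omega> * ?u \<omega> + A k \<omega> * \<bar>h \<omega>\<bar> \<partial>M) = (\<integral>\<omega>. A k \<omega> * \<bar>h \<omega>\<bar> \<partial>M)"
        using part[of k] hA by simp
      also have "\<dots> \<le> (\<integral>\<omega>. \<bar>h \<omega>\<bar> \<partial>M)"
        using hA insert.prems(3) by (intro integral_mono) (auto simp: A_def)
      finally show "(\<integral>\<^sup>+\<omega>. ennreal (A k \<omega> * (?u \<omega> + \<bar>h \<omega>\<bar>)) \<partial>M) \<le> ennreal (\<integral>\<omega>. \<bar>h \<omega>\<bar> \<partial>M)"
        by (simp add: ennreal_leI)
    qed simp
    finally show ?thesis .
  qed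
  then have "integrable M (\<lambda>\<omega>. ?u \<omega> + \<bar>h \<omega>\<bar>)"
  proof (intro integrableI_nonneg)
    show "AE \<omega> in M. 0 \<le> ?u \<omega> + \<bar>h \<omega>\<bar>"
      using insert.prems(4) by eventually_elim auto
  qed (use insert.prems(3) in \<open>auto simp: le_less_trans\<close>)
  then have "integrable M (\<lambda>\<omega>. (?u \<omega> + \<bar>h \<omega>\<bar>) - \<bar>h \<omega>\<bar>)"
    using insert.prems(3) by (intro Bochner_Integration.integrable_diff) auto
  then have int: "integrable M ?u" by simp
  have "(\<lambda>k. \<integral>\<omega>. A k \<omega> * ?u \<omega> \<partial>M) \<longlonglongrightarrow> (\<integral>\<omega>. ?u \<omega> \<partial>M)"
    by (rule integral_dominated_convergence[where w = "\<lambda>\<omega>. \<bar>?u \<omega>\<bar>"]) (use int in \<open>auto simp: A_def intro!: lim[unfolded A_def]\<close>)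
  then have "(\<integral>\<omega>. ?u \<omega> \<partial>M) = 0" using part by (simp add: LIMSEQ_const_iff)
  with int show ?case by simp
qed

lemma adapted_annihilator:
  fixes q :: "'w \<Rightarrow> real ^ 'n"
  assumes "\<And>i. integrable M (\<lambda>\<omega>. q \<omega> $ i)"
    and "\<And>x c. x \<in> adapted \<Longrightarrow> \<forall>\<omega>. norm (x \<omega>) \<le> c \<Longrightarrow> (\<integral>\<omega>. x \<omega> \<bullet> q \<omega> \<partial>M) = 0"
    and "x \<in> adapted" "integrable M h" "AE \<omega> in M. h \<omega> \<le> x \<omega> \<bullet> q \<omega>"
  shows "integrable M (\<lambda>\<omega>. x \<omega> \<bullet> q \<omega>)" "(\<integral>\<omega>. x \<omega> \<bullet> q \<omega> \<partial>M) = 0"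
  using adapted_annihilator_aux[OF assms(1,2,3) _ assms(4,5), where I = UNIV] by auto

subsection \<open>Closedness of projected conic constraints\<close>

text \<open>The compactification by \<open>arctan\<close> provides a cluster point of every real sequence,
  attained along random indices.\<close>

lemma random_subsequence:
  fixes y :: "nat \<Rightarrow> 'w \<Rightarrow> real"
  assumes y [measurable]: "\<And>k. y k \<in> borel_measurable N"
  obtains \<tau> :: "nat \<Rightarrow> 'w \<Rightarrow> nat" and A l \<sigma> where
    "\<And>k. \<tau> k \<in> measurable N (count_space UNIV)" "\<And>k \<omega>. k \<le> \<tau> k \<omega>"
    "A \<in> borel_measurable N" "l \<in> borel_measurable N" "\<sigma> \<in> borel_measurable N"
    "\<And>\<omega>. A \<omega> = (0::real) \<or> A \<omega> = 1"
    "\<And>\<omega>. A \<omega> = 1 \<Longrightarrow> (\<lambda>k. y (\<tau> k \<omega>) \<omega>) \<longlonglongrightarrow> (l \<omega> :: real)"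
    "\<And>\<omega>. A \<omega> = 0 \<Longrightarrow> filterlim (\<lambda>k. \<bar>y (\<tau> k \<omega>) \<omega>\<bar>) at_top sequentially"
    "\<And>\<omega>. A \<omega> = 0 \<Longrightarrow> (\<lambda>k. sgn (y (\<tau> k \<omega>) \<omega>)) \<longlonglongrightarrow> \<sigma> \<omega>"
    "\<And>\<omega>. \<sigma> \<omega> * \<sigma> \<omega> = (1 :: real)"
proof -
  define w where "w k \<omega> = arctan (y k \<omega>)" for k \<omega>
  have [measurable]: "w k \<in> borel_measurable N" for k unfolding w_def by measurable
  have wl: "- (pi / 2) < w k \<omega>" and wu: "w k \<omega> < pi / 2" for k \<omega>
    using arctan_bounded[of "y k \<omega>"] by (auto simp: w_def)
  define L where "L \<omega> = liminf (\<lambda>k. ereal (w k \<omega>))" for \<omega>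
  define c where "c \<omega> = real_of_ereal (L \<omega>)" for \<omega>
  have [measurable]: "L \<in> borel_measurable N" unfolding L_def by measurable
  have [measurable]: "c \<in> borel_measurable N" unfolding c_def by measurable
  have Lge: "ereal (- (pi / 2)) \<le> L \<omega>" for \<omega>
    unfolding L_def by (intro Liminf_bounded always_eventually allI) (simp only: ereal_less_eq less_imp_le[OF wl])
  have Lle: "L \<omega> \<le> ereal (pi / 2)" for \<omega>
    unfolding L_def by (intro Liminf_le always_eventually allI) (simp_all only: ereal_less_eq less_imp_le[OF wu] sequentially_bot not_False_eq_True)
  have Lc: "L \<omega> = ereal (c \<omega>)" for \<omega>
    unfolding c_def using Lge[of \<omega>] Lle[of \<omega>] by (cases "L \<omega>") auto
  have cb: "\<bar>c \<omega>\<bar> \<le> pi / 2" for \<omega> using Lge[of \<omega>] Lle[of \<omega>] by (simp add: Lc abs_le_iff)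
  have cluster: "\<exists>n\<ge>k. \<bar>w n \<omega> - c \<omega>\<bar> < e" if "e > 0" for k e \<omega>
  proof -
    have 1: "\<forall>\<^sub>F n in sequentially. c \<omega> - e < w n \<omega>"
      using less_LiminfD[of "ereal (c \<omega> - e)" sequentially "\<lambda>n. ereal (w n \<omega>)"] that
      by (simp add: L_def[symmetric] Lc)
    have "\<exists>n\<ge>m. w n \<omega> < c \<omega> + e" for m
    proof (rule ccontr)
      assume "\<not> ?thesis"
      then have "\<forall>\<^sub>F n in sequentially. ereal (c \<omega> + e) \<le> ereal (w n \<omega>)"
        unfolding eventually_sequentially by (auto simp: not_less)
      then have "ereal (c \<omega> + e) \<le> L \<omega>" unfolding L_def by (rule Liminf_bounded)
      with that show False by (simp add: Lc)
    qed
    moreover obtain m where "\<And>n. n \<ge> m \<Longrightarrow> c \<omega> - e < w n \<omega>" using 1 by (auto simp: eventually_sequentially)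
    ultimately obtain n where "n \<ge> max k m" "w n \<omega> < c \<omega> + e" "c \<omega> - e < w n \<omega>"
      by (meson max.bounded_iff order_refl)
    then show ?thesis by (auto intro!: exI[of _ n] simp: abs_less_iff)
  qed
  \<comment> \<open>The first index from k on at which the values come within 1 / (k + 1) of the
    cluster point; taking the least one keeps the choice measurable.\<close>
  define \<tau> where "\<tau> k \<omega> = (LEAST n. k \<le> n \<and> \<bar>w n \<omega> - c \<omega>\<bar> < 1 / real (Suc k))" for k \<omega>
  have \<tau>: "k \<le> \<tau> k \<omega> \<and> \<bar>w (\<tau> k \<omega>) \<omega> - c \<omega>\<bar> < 1 / real (Suc k)" for k \<omega>
    unfolding \<tau>_def by (rule LeastI_ex) (use cluster[of "1 / real (Suc k)" k \<omega>] in auto)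
  have m\<tau>: "\<tau> k \<in> measurable N (count_space UNIV)" for k unfolding \<tau>_def by measurable
  have lim: "(\<lambda>k. w (\<tau> k \<omega>) \<omega>) \<longlonglongrightarrow> c \<omega>" for \<omega>
  proof (rule Lim_null[THEN iffD2], rule Lim_null_comparison)
    show "\<forall>\<^sub>F k in sequentially. norm (w (\<tau> k \<omega>) \<omega> - c \<omega>) \<le> 1 / real (Suc k)"
      using \<tau> by (auto intro!: always_eventually less_imp_le)
    show "(\<lambda>k. 1 / real (Suc k)) \<longlonglongrightarrow> 0"
      using LIMSEQ_inverse_real_of_nat by (simp add: inverse_eq_divide)
  qed
  have tw: "y k \<omega> = tan (w k \<omega>)" for k \<omega> by (simp add: w_def tan_arctan)
  \<comment> \<open>\<open>A\<close> marks the points whose cluster value is interior to the range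
    of arctan, where the original values converge. At an end point they diverge with eventually
    constant sign \<sigma>.\<close>
  define A where "A \<omega> = (if \<bar>c \<omega>\<bar> < pi / 2 then 1 else 0 :: real)" for \<omega>
  define \<sigma> where "\<sigma> \<omega> = (if c \<omega> < 0 then - 1 else 1 :: real)" for \<omega>
  show ?thesis
  proof (rule that[of \<tau> A "\<lambda>\<omega>. tan (c \<omega>)" \<sigma>])
    show "(\<lambda>\<omega>. tan (c \<omega>)) \<in> borel_measurable N" unfolding tan_def by measurable
    show "A \<in> borel_measurable N" "\<sigma> \<in> borel_measurable N" unfolding A_def \<sigma>_def by measurable
    show "(\<lambda>k. y (\<tau> k \<omega>) \<omega>) \<longlonglongrightarrow> tan (c \<omega>)" if "A \<omega> = 1" for \<omega>
      unfolding tw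
    proof (rule isCont_tendsto_compose[OF isCont_tan lim])
      have "\<bar>c \<omega>\<bar> < pi / 2" using that by (simp add: A_def split: if_splits)
      then have "- (pi / 2) < c \<omega>" "c \<omega> < pi / 2" by linarith+
      from cos_gt_zero_pi[OF this] show "cos (c \<omega>) \<noteq> 0" by simp
    qed
    fix \<omega> assume A0: "A \<omega> = 0"
    then have c2: "\<bar>c \<omega>\<bar> = pi / 2" using cb[of \<omega>] by (simp add: A_def split: if_splits)
    show "filterlim (\<lambda>k. \<bar>y (\<tau> k \<omega>) \<omega>\<bar>) at_top sequentially"
      unfolding filterlim_at_top
    proof
      fix Z :: real
      have "(\<lambda>k. \<bar>w (\<tau> k \<omega>) \<omega>\<bar>) \<longlonglongrightarrow> pi / 2"
        using tendsto_rabs[OF lim[of \<omega>]] by (simp add: c2)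
      then have "\<forall>\<^sub>F k in sequentially. arctan Z < \<bar>w (\<tau> k \<omega>) \<omega>\<bar>"
        by (rule order_tendstoD) (rule arctan_ubound)
      then show "\<forall>\<^sub>F k in sequentially. Z \<le> \<bar>y (\<tau> k \<omega>) \<omega>\<bar>"
      proof eventually_elim
        case (elim k)
        have "\<bar>w (\<tau> k \<omega>) \<omega>\<bar> = arctan \<bar>y (\<tau> k \<omega>) \<omega>\<bar>"
          by (cases "y (\<tau> k \<omega>) \<omega> \<ge> 0") (simp_all add: w_def arctan_minus)
        with elim show ?case by (simp add: arctan_less_iff)
      qed
    qed
    show "(\<lambda>k. sgn (y (\<tau> k \<omega>) \<omega>)) \<longlonglongrightarrow> \<sigma> \<omega>"
    proof (cases "c \<omega> < 0")
      case True
      have "\<forall>\<^sub>F k in sequentially. w (\<tau> k \<omega>) \<omega> < 0" using lim[of \<omega>] True by (rule order_tendstoD)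
      then have "\<forall>\<^sub>F k in sequentially. sgn (y (\<tau> k \<omega>) \<omega>) = \<sigma> \<omega>"
        by eventually_elim (simp add: w_def \<sigma>_def True)
      then show ?thesis by (rule tendsto_eventually)
    next
      case False
      then have "0 < c \<omega>" using c2 pi_gt_zero by linarith
      with lim[of \<omega>] have "\<forall>\<^sub>F k in sequentially. 0 < w (\<tau> k \<omega>) \<omega>" by (rule order_tendstoD)
      then have "\<forall>\<^sub>F k in sequentially. sgn (y (\<tau> k \<omega>) \<omega>) = \<sigma> \<omega>"
        by eventually_elim (simp add: w_def \<sigma>_def False)
      then show ?thesis by (rule tendsto_eventually)
    qed
  qed (use \<tau> m\<tau> in \<open>auto simp: A_def \<sigma>_def\<close>)
qed

text \<open>Coordinates are eliminated in the order of their stages. Along random indices, the earliest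
  coordinate either converges or diverges; where it diverges, dividing by it produces a direction
  \<open>r\<close> with \<open>J r\<close> and \<open>- J r\<close> in \<open>K\<close>, whose multiples cancel that coordinate.\<close>

lemma adapted_cone_closed_aux:
  fixes K :: "'w \<Rightarrow> 'e::euclidean_space set" and J :: "real ^ 'n \<Rightarrow> 'e"
  assumes J: "linear J"
    and K: "AE \<omega> in M. closed (K \<omega>) \<and> convex_cone (K \<omega>)"
    and sym: "\<And>r. r \<in> adapted \<Longrightarrow> AE \<omega> in M. J (r \<omega>) \<in> K \<omega> \<Longrightarrow> AE \<omega> in M. - J (r \<omega>) \<in> K \<omega>"
  shows "(\<And>k. x k \<in> adapted) \<Longrightarrow> (\<And>k \<omega> i. i \<notin> I \<Longrightarrow> x k \<omega> $ i = 0) \<Longrightarrow>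
    AE \<omega> in M. (\<lambda>k. s k \<omega>) \<longlonglongrightarrow> s' \<omega> \<Longrightarrow>
    AE \<omega> in M. \<forall>k. J (x k \<omega>) + s k \<omega> \<in> K \<omega> \<Longrightarrow>
    \<exists>x'\<in>adapted. (\<forall>\<omega> i. i \<notin> I \<longrightarrow> x' \<omega> $ i = 0) \<and> (AE \<omega> in M. J (x' \<omega>) + s' \<omega> \<in> K \<omega>)"
  using finite[of I]
proof (induction I arbitrary: x s s' rule: finite_ranking_induct[where f = "\<lambda>i. - int (stage i)"])
  case empty
  have x0: "x k \<omega> = 0" for k \<omega> using empty.prems(2) by (simp add: vec_eq_iff)
  have "AE \<omega> in M. J 0 + s' \<omega> \<in> K \<omega>"
    using empty.prems(3,4) K
  proof eventually_elim
    case (elim \<omega>)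
    then have "\<forall>k. s k \<omega> \<in> K \<omega>" by (simp add: x0 linear_0[OF J])
    with elim show ?case
      by (simp add: linear_0[OF J]) (meson closed_sequentially)
  qed
  then show ?case by (intro bexI[of _ "\<lambda>_. 0"]) (auto intro: adapted_0)
next
  case (insert i I)
  show ?case
  \<comment> \<open>The ranking induction does not promise that the inserted coordinate is
    new.\<close>
  proof (cases "i \<in> I")
    case True
    then have eq: "insert i I = I" by auto
    show ?thesis unfolding eq
      by (rule insert.IH[OF insert.prems(1) _ insert.prems(3,4)]) (use insert.prems(2) eq in auto)
  next
    case iI: False
    have low: "x k \<omega> $ j = 0" if "stage j < stage i" for j k \<omega>
    proof -
      have "j \<notin> insert i I" using insert.hyps(2)[of j] that by auto
      then show ?thesis by (rule insert.prems(2))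
    qed
    define y where "y k \<omega> = x k \<omega> $ i" for k \<omega>
    have my: "y k \<in> borel_measurable (F (stage i))" for k
      unfolding y_def using insert.prems(1) by (rule adapted_nth)
    obtain \<tau> A l \<sigma> where \<tau>: "\<And>k. \<tau> k \<in> measurable (F (stage i)) (count_space UNIV)" "\<And>k \<omega>. k \<le> \<tau> k \<omega>"
      and m [measurable]: "A \<in> borel_measurable (F (stage i))" "l \<in> borel_measurable (F (stage i))" "\<sigma> \<in> borel_measurable (F (stage i))"
      and A01: "\<And>\<omega>. A \<omega> = (0::real) \<or> A \<omega> = 1"
      and A1: "\<And>\<omega>. A \<omega> = 1 \<Longrightarrow> (\<lambda>k. y (\<tau> k \<omega>) \<omega>) \<longlonglongrightarrow> l \<omega>"
      and A0: "\<And>\<omega>. A \<omega> = 0 \<Longrightarrow> filterlim (\<lambda>k. \<bar>y (\<tau> k \<omega>) \<omega>\<bar>) at_top sequentially"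
        "\<And>\<omega>. A \<omega> = 0 \<Longrightarrow> (\<lambda>k. sgn (y (\<tau> k \<omega>) \<omega>)) \<longlonglongrightarrow> \<sigma> \<omega>"
      and \<sigma>2: "\<And>\<omega>. \<sigma> \<omega> * \<sigma> \<omega> = 1"
      by (rule random_subsequence[of y, OF my]) (rule that)
    define e :: "real ^ 'n" where "e = axis i 1"
    define xt where "xt k \<omega> = x (\<tau> k \<omega>) \<omega>" for k \<omega>
    define yt where "yt k \<omega> = y (\<tau> k \<omega>) \<omega>" for k \<omega>
    define st where "st k \<omega> = s (\<tau> k \<omega>) \<omega>" for k \<omega>
    have xt: "xt k \<in> adapted" for k
      unfolding xt_def[abs_def] by (rule adapted_random_index[of x "\<tau> k" i, OF insert.prems(1) \<tau>(1) low])
    have yt[measurable]: "yt k \<in> borel_measurable (F (stage i))" for k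
      unfolding yt_def[abs_def] by (rule measurable_compose_countable[of y, OF my \<tau>(1)])
    have xti: "xt k \<omega> $ i = yt k \<omega>" for k \<omega> by (simp add: xt_def yt_def y_def)
    have xtI: "xt k \<omega> $ j = 0" if "j \<notin> insert i I" for k \<omega> j using insert.prems(2)[OF that] by (simp add: xt_def)
    have xtlow: "xt k \<omega> $ j = 0" if "stage j < stage i" for j k \<omega> using low[OF that] by (simp add: xt_def)
    have st: "AE \<omega> in M. (\<lambda>k. st k \<omega>) \<longlonglongrightarrow> s' \<omega>"
      using insert.prems(3)
    proof eventually_elim
      case (elim \<omega>)
      have "filterlim (\<lambda>k. \<tau> k \<omega>) sequentially sequentially"
        by (rule filterlim_at_top_mono[OF filterlim_ident]) (simp add: \<tau>)
      with elim show ?case unfolding st_def by (rule filterlim_compose)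
    qed
    have JK: "AE \<omega> in M. \<forall>k. J (xt k \<omega>) + st k \<omega> \<in> K \<omega>"
      using insert.prems(4) by eventually_elim (simp add: xt_def st_def)
    \<comment> \<open>Division by the size of the coordinate on the event of divergence, and 0
      elsewhere. As inverse 0 = 0, the scaled coordinate is exactly the sign of \<open>yt\<close>,
      even where \<open>yt\<close> vanishes.\<close>
    define \<rho> where "\<rho> k \<omega> = (1 - A \<omega>) * inverse \<bar>yt k \<omega>\<bar>" for k \<omega>
    have [measurable]: "\<rho> k \<in> borel_measurable (F (stage i))" for k unfolding \<rho>_def by measurable
    have \<rho>0: "0 \<le> \<rho> k \<omega>" for k \<omega> using A01[of \<omega>] by (auto simp: \<rho>_def)
    have \<rho>y: "\<rho> k \<omega> * yt k \<omega> = (1 - A \<omega>) * sgn (yt k \<omega>)" for k \<omega>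
      by (simp add: \<rho>_def sgn_real_def)
    have \<rho>lim: "(\<lambda>k. \<rho> k \<omega>) \<longlonglongrightarrow> 0" for \<omega>
      using A01[of \<omega>] tendsto_inverse_0_at_top[OF A0(1)[of \<omega>]] by (auto simp: \<rho>_def yt_def)
    \<comment> \<open>The i-th coordinate of the scaled strategy is moved into the convergent term,
      so the induction hypothesis for I applies. In the limit the old term vanishes with \<rho> and
      only the sign \<sigma> remains.\<close>
    have "\<exists>r'\<in>adapted. (\<forall>\<omega> j. j \<notin> I \<longrightarrow> r' \<omega> $ j = 0) \<and> (AE \<omega> in M. J (r' \<omega>) + ((1 - A \<omega>) * \<sigma> \<omega>) *\<^sub>R J e \<in> K \<omega>)"
    proof (rule insert.IH)
      show "(\<lambda>\<omega>. \<rho> k \<omega> *\<^sub>R xt k \<omega> - ((1 - A \<omega>) * sgn (yt k \<omega>)) *\<^sub>R e) \<in> adapted" for k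
        unfolding e_def by (intro adapted_diff adapted_scale_stage[OF xt] adapted_axis xtlow) measurable
      show "(\<rho> k \<omega> *\<^sub>R xt k \<omega> - ((1 - A \<omega>) * sgn (yt k \<omega>)) *\<^sub>R e) $ j = 0" if "j \<notin> I" for k \<omega> j
        using xtI[of j k \<omega>] that by (cases "j = i") (auto simp: e_def axis_def xti \<rho>y)
      show "AE \<omega> in M. (\<lambda>k. \<rho> k \<omega> *\<^sub>R st k \<omega> + ((1 - A \<omega>) * sgn (yt k \<omega>)) *\<^sub>R J e) \<longlonglongrightarrow> ((1 - A \<omega>) * \<sigma> \<omega>) *\<^sub>R J e"
        using st
      proof eventually_elim
        case (elim \<omega>)
        have "(\<lambda>k. (1 - A \<omega>) * sgn (yt k \<omega>)) \<longlonglongrightarrow> (1 - A \<omega>) * \<sigma> \<omega>"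
          using A01[of \<omega>] A0(2)[of \<omega>] by (auto simp: yt_def)
        from tendsto_add[OF tendsto_scaleR[OF \<rho>lim elim] tendsto_scaleR[OF this tendsto_const[of "J e"]]]
        show ?case by simp
      qed
      show "AE \<omega> in M. \<forall>k. J (\<rho> k \<omega> *\<^sub>R xt k \<omega> - ((1 - A \<omega>) * sgn (yt k \<omega>)) *\<^sub>R e) + (\<rho> k \<omega> *\<^sub>R st k \<omega> + ((1 - A \<omega>) * sgn (yt k \<omega>)) *\<^sub>R J e) \<in> K \<omega>"
        using JK K
      proof eventually_elim
        case (elim \<omega>)
        show ?case
        proof
          fix k
          have "\<rho> k \<omega> *\<^sub>R (J (xt k \<omega>) + st k \<omega>) \<in> K \<omega>" using elim \<rho>0 by (intro convex_cone_scaleR) auto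
          then show "J (\<rho> k \<omega> *\<^sub>R xt k \<omega> - ((1 - A \<omega>) * sgn (yt k \<omega>)) *\<^sub>R e) + (\<rho> k \<omega> *\<^sub>R st k \<omega> + ((1 - A \<omega>) * sgn (yt k \<omega>)) *\<^sub>R J e) \<in> K \<omega>"
            by (simp add: linear_diff[OF J] linear_cmul[OF J] scaleR_add_right)
        qed
      qed
    qed
    then obtain r' where r': "r' \<in> adapted" "\<And>\<omega> j. j \<notin> I \<Longrightarrow> r' \<omega> $ j = 0"
      "AE \<omega> in M. J (r' \<omega>) + ((1 - A \<omega>) * \<sigma> \<omega>) *\<^sub>R J e \<in> K \<omega>" by blast
    define r where "r \<omega> = r' \<omega> + ((1 - A \<omega>) * \<sigma> \<omega>) *\<^sub>R e" for \<omega>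
    have r: "r \<in> adapted" unfolding r_def e_def by (intro adapted_add r' adapted_axis) measurable
    have JrK: "AE \<omega> in M. J (r \<omega>) \<in> K \<omega>"
      using r'(3) by (simp add: r_def linear_add[OF J] linear_cmul[OF J])
    have JrK': "AE \<omega> in M. - J (r \<omega>) \<in> K \<omega>" by (rule sym[OF r JrK])
    have ri: "r \<omega> $ i = (1 - A \<omega>) * \<sigma> \<omega>" for \<omega> using r'(2)[OF iI] by (simp add: r_def e_def)
    have rI: "r \<omega> $ j = 0" if "j \<notin> insert i I" for \<omega> j using r'(2)[of j \<omega>] that by (simp add: r_def e_def axis_def)
    have rlow: "r \<omega> $ j = 0" if "stage j < stage i" for j \<omega>
    proof -
      have "j \<notin> insert i I" using insert.hyps(2)[of j] that by auto
      then show ?thesis by (rule rI)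
    qed
    \<comment> \<open>On the event of divergence the i-th coordinate of \<open>r\<close> is
      \<sigma>, which is its own inverse; subtracting c times r therefore cancels \<open>yt\<close>
      there.\<close>
    define c where "c k \<omega> = (1 - A \<omega>) * yt k \<omega> * \<sigma> \<omega>" for k \<omega>
    have [measurable]: "c k \<in> borel_measurable (F (stage i))" for k unfolding c_def by measurable
    have "\<exists>x'\<in>adapted. (\<forall>\<omega> j. j \<notin> I \<longrightarrow> x' \<omega> $ j = 0) \<and> (AE \<omega> in M. J (x' \<omega>) + (s' \<omega> + (A \<omega> * l \<omega>) *\<^sub>R J e) \<in> K \<omega>)"
    proof (rule insert.IH)
      show "(\<lambda>\<omega>. xt k \<omega> - c k \<omega> *\<^sub>R r \<omega> - (A \<omega> * yt k \<omega>) *\<^sub>R e) \<in> adapted" for k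
        unfolding e_def by (intro adapted_diff adapted_scale_stage[OF r] adapted_axis xt rlow) measurable
      show "(xt k \<omega> - c k \<omega> *\<^sub>R r \<omega> - (A \<omega> * yt k \<omega>) *\<^sub>R e) $ j = 0" if "j \<notin> I" for k \<omega> j
      proof (cases "j = i")
        case True
        have "c k \<omega> * r \<omega> $ i = (1 - A \<omega>) * yt k \<omega>"
          using A01[of \<omega>] \<sigma>2[of \<omega>] by (auto simp: c_def ri)
        with True show ?thesis by (simp add: e_def xti algebra_simps)
      next
        case False
        with that show ?thesis using xtI[of j k \<omega>] rI[of j \<omega>] by (simp add: e_def axis_def)
      qed
      show "AE \<omega> in M. (\<lambda>k. st k \<omega> + (A \<omega> * yt k \<omega>) *\<^sub>R J e) \<longlonglongrightarrow> s' \<omega> + (A \<omega> * l \<omega>) *\<^sub>R J e"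
        using st
      proof eventually_elim
        case (elim \<omega>)
        have "(\<lambda>k. A \<omega> * yt k \<omega>) \<longlonglongrightarrow> A \<omega> * l \<omega>"
          using A01[of \<omega>] A1[of \<omega>] by (auto simp: yt_def)
        from tendsto_add[OF elim tendsto_scaleR[OF this tendsto_const[of "J e"]]] show ?case .
      qed
      show "AE \<omega> in M. \<forall>k. J (xt k \<omega> - c k \<omega> *\<^sub>R r \<omega> - (A \<omega> * yt k \<omega>) *\<^sub>R e) + (st k \<omega> + (A \<omega> * yt k \<omega>) *\<^sub>R J e) \<in> K \<omega>"
        using JK K JrK JrK'
      proof eventually_elim
        case (elim \<omega>)
        show ?case
        proof
          fix k
          \<comment> \<open>The cone contains r and its negative under \<open>J\<close>, hence real
            multiples of either sign.\<close>
          have "\<bar>c k \<omega>\<bar> *\<^sub>R (if c k \<omega> \<ge> 0 then - J (r \<omega>) else J (r \<omega>)) \<in> K \<omega>"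
            using elim by (intro convex_cone_scaleR) auto
          also have "\<bar>c k \<omega>\<bar> *\<^sub>R (if c k \<omega> \<ge> 0 then - J (r \<omega>) else J (r \<omega>)) = - (c k \<omega> *\<^sub>R J (r \<omega>))" by simp
          finally have neg: "- (c k \<omega> *\<^sub>R J (r \<omega>)) \<in> K \<omega>" .
          have "(J (xt k \<omega>) + st k \<omega>) + - (c k \<omega> *\<^sub>R J (r \<omega>)) \<in> K \<omega>"
            by (rule convex_cone_add) (use elim neg in auto)
          then show "J (xt k \<omega> - c k \<omega> *\<^sub>R r \<omega> - (A \<omega> * yt k \<omega>) *\<^sub>R e) + (st k \<omega> + (A \<omega> * yt k \<omega>) *\<^sub>R J e) \<in> K \<omega>"
            by (simp add: linear_diff[OF J] linear_add[OF J] linear_cmul[OF J] algebra_simps)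
        qed
      qed
    qed
    then obtain x' where x': "x' \<in> adapted" "\<And>\<omega> j. j \<notin> I \<Longrightarrow> x' \<omega> $ j = 0"
      "AE \<omega> in M. J (x' \<omega>) + (s' \<omega> + (A \<omega> * l \<omega>) *\<^sub>R J e) \<in> K \<omega>" by blast
    show ?thesis
    proof (intro bexI[of _ "\<lambda>\<omega>. x' \<omega> + (A \<omega> * l \<omega>) *\<^sub>R e"] conjI allI impI)
      show "(\<lambda>\<omega>. x' \<omega> + (A \<omega> * l \<omega>) *\<^sub>R e) \<in> adapted"
        unfolding e_def by (intro adapted_add x' adapted_axis) measurable
      show "(x' \<omega> + (A \<omega> * l \<omega>) *\<^sub>R e) $ j = 0" if "j \<notin> insert i I" for \<omega> j
        using that x'(2)[of j \<omega>] by (simp add: e_def axis_def)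
      show "AE \<omega> in M. J (x' \<omega> + (A \<omega> * l \<omega>) *\<^sub>R e) + s' \<omega> \<in> K \<omega>"
        using x'(3) by (simp add: linear_add[OF J] linear_cmul[OF J] algebra_simps)
    qed
  qed
qed

text \<open>Only the terms \<open>s\<close> have to converge. The strategy x' need not be a limit of
  the \<open>x k\<close>, since multiples of symmetric directions are subtracted on the way.\<close>

lemma adapted_cone_closed:
  fixes K :: "'w \<Rightarrow> 'e::euclidean_space set" and J :: "real ^ 'n \<Rightarrow> 'e"
  assumes "linear J"
    and "AE \<omega> in M. closed (K \<omega>) \<and> convex_cone (K \<omega>)"
    and "\<And>r. r \<in> adapted \<Longrightarrow> AE \<omega> in M. J (r \<omega>) \<in> K \<omega> \<Longrightarrow> AE \<omega> in M. - J (r \<omega>) \<in> K \<omega>"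
    and "\<And>k. x k \<in> adapted"
    and "AE \<omega> in M. (\<lambda>k. s k \<omega>) \<longlonglongrightarrow> s' \<omega>"
    and "AE \<omega> in M. \<forall>k. J (x k \<omega>) + s k \<omega> \<in> K \<omega>"
  obtains x' where "x' \<in> adapted" "AE \<omega> in M. J (x' \<omega>) + s' \<omega> \<in> K \<omega>"
  using adapted_cone_closed_aux[OF assms(1-4) _ assms(5,6), where I = UNIV] by auto

end

section \<open>Forward convex combinations\<close>

definition cweights :: "nat \<Rightarrow> (nat \<Rightarrow> real) set" where
  "cweights k = {c. (\<forall>j. 0 \<le> c j) \<and> finite {j. c j \<noteq> 0} \<and> {j. c j \<noteq> 0} \<subseteq> {k..} \<and> (\<Sum>j | c j \<noteq> 0. c j) = 1}"

definition ccomb :: "(nat \<Rightarrow> real) \<Rightarrow> (nat \<Rightarrow> 'a::real_vector) \<Rightarrow> 'a" where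
  "ccomb c a = (\<Sum>j | c j \<noteq> 0. c j *\<^sub>R a j)"

lemma cweightsD:
  assumes "c \<in> cweights k"
  shows "0 \<le> c j" "finite {j. c j \<noteq> 0}" "c j \<noteq> 0 \<Longrightarrow> k \<le> j" "(\<Sum>j | c j \<noteq> 0. c j) = 1"
  using assms by (auto simp: cweights_def)

lemma cweights_antimono: "k \<le> m \<Longrightarrow> cweights m \<subseteq> cweights k"
  by (auto simp: cweights_def)

lemma cweights_single: "(\<lambda>j. if j = k then 1 else 0) \<in> cweights k"
  by (simp add: cweights_def)

lemma ccomb_superset:
  assumes "finite S" "{j. c j \<noteq> 0} \<subseteq> S"
  shows "ccomb c a = (\<Sum>j\<in>S. c j *\<^sub>R a j)"
  unfolding ccomb_def by (rule sum.mono_neutral_left) (use assms in auto)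

lemma ccomb_const: "c \<in> cweights k \<Longrightarrow> ccomb c (\<lambda>_. a) = a"
  by (simp add: ccomb_def scaleR_sum_left[symmetric] cweightsD(4))

lemma ccomb_add: "ccomb c (\<lambda>j. a j + b j) = ccomb c a + ccomb c b"
  by (simp add: ccomb_def scaleR_add_right sum.distrib)

lemma ccomb_linear: "linear h \<Longrightarrow> h (ccomb c a) = ccomb c (\<lambda>j. h (a j))"
  by (simp add: ccomb_def linear_sum linear_cmul)

lemma ccomb_Pair: "ccomb c (\<lambda>j. (a j, b j)) = (ccomb c a, ccomb c b)"
proof -
  have "finite S \<Longrightarrow> (\<Sum>j\<in>S. c j *\<^sub>R (a j, b j)) = (\<Sum>j\<in>S. c j *\<^sub>R a j, \<Sum>j\<in>S. c j *\<^sub>R b j)" for S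
    by (induction S rule: finite_induct) (auto simp: zero_prod_def)
  then show ?thesis unfolding ccomb_def
    by (cases "finite {j. c j \<noteq> 0}") (auto simp: zero_prod_def)
qed

lemma ccomb_mono:
  fixes a b :: "nat \<Rightarrow> real"
  assumes "c \<in> cweights k" "\<And>j. k \<le> j \<Longrightarrow> a j \<le> b j"
  shows "ccomb c a \<le> ccomb c b"
  unfolding ccomb_def using assms(2) cweightsD(1,3)[OF assms(1)] by (auto intro!: sum_mono mult_left_mono)

lemma ccomb_norm_le:
  assumes "c \<in> cweights k"
  shows "norm (ccomb c a) \<le> ccomb c (\<lambda>j. norm (a j))"
  unfolding ccomb_def using cweightsD(1)[OF assms]
  by (intro order_trans[OF norm_sum]) simp

lemma ccomb_in_convex:
  assumes "c \<in> cweights k" "convex C" "\<And>j. a j \<in> C"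
  shows "ccomb c a \<in> C"
  unfolding ccomb_def using assms cweightsD[OF assms(1)] by (intro convex_sum) auto

lemma cweights_midpoint:
  assumes "c \<in> cweights k" "d \<in> cweights k"
  shows "(\<lambda>j. (c j + d j) / 2) \<in> cweights k"
    and "ccomb (\<lambda>j. (c j + d j) / 2) a = (1 / 2) *\<^sub>R (ccomb c a + ccomb d a)"
proof -
  let ?S = "{j. c j \<noteq> 0} \<union> {j. d j \<noteq> 0}"
  have S: "finite ?S" using assms by (auto dest: cweightsD(2))
  have sub: "{j. (c j + d j) / 2 \<noteq> 0} \<subseteq> ?S" by auto
  have eq: "ccomb (\<lambda>j. (c j + d j) / 2) b = (1 / 2) *\<^sub>R (ccomb c b + ccomb d b)" for b :: "nat \<Rightarrow> 'b::real_vector"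
    unfolding ccomb_superset[OF S sub] ccomb_superset[OF S Un_upper1] ccomb_superset[OF S Un_upper2]
    by (simp add: sum.distrib[symmetric] scaleR_sum_right scaleR_add_left[symmetric])
  then show "ccomb (\<lambda>j. (c j + d j) / 2) a = (1 / 2) *\<^sub>R (ccomb c a + ccomb d a)" .
  have "(\<Sum>j | (c j + d j) / 2 \<noteq> 0. (c j + d j) / 2) = 1"
    using eq[of "\<lambda>_. 1 :: real"] ccomb_const[OF assms(1), of "1::real"] ccomb_const[OF assms(2), of "1::real"]
    by (simp add: ccomb_def)
  moreover have "finite {j. (c j + d j) / 2 \<noteq> 0}" using S sub by (rule rev_finite_subset)
  ultimately show "(\<lambda>j. (c j + d j) / 2) \<in> cweights k"
    using assms sub by (auto simp: cweights_def)
qed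

lemma borel_measurable_ccomb [measurable (raw)]:
  fixes a :: "nat \<Rightarrow> 'w \<Rightarrow> 'a::euclidean_space"
  assumes "\<And>j. a j \<in> borel_measurable M"
  shows "(\<lambda>\<omega>. ccomb c (\<lambda>j. a j \<omega>)) \<in> borel_measurable M"
  unfolding ccomb_def using assms by measurable

lemma nn_integral_ccomb_le:
  fixes r :: "nat \<Rightarrow> 'w \<Rightarrow> real"
  assumes c: "c \<in> cweights k" and [measurable]: "\<And>j. r j \<in> borel_measurable M"
    and "\<And>j \<omega>. 0 \<le> r j \<omega>" "\<And>j. k \<le> j \<Longrightarrow> (\<integral>\<^sup>+\<omega>. ennreal (r j \<omega>) \<partial>M) \<le> B"
  shows "(\<integral>\<^sup>+\<omega>. ennreal (ccomb c (\<lambda>j. r j \<omega>)) \<partial>M) \<le> B"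
proof -
  have "(\<integral>\<^sup>+\<omega>. ennreal (ccomb c (\<lambda>j. r j \<omega>)) \<partial>M) = (\<integral>\<^sup>+\<omega>. (\<Sum>j | c j \<noteq> 0. ennreal (c j) * ennreal (r j \<omega>)) \<partial>M)"
    unfolding ccomb_def using cweightsD(1)[OF c] assms(3)
    by (intro nn_integral_cong) (simp add: sum_ennreal[symmetric] ennreal_mult')
  also have "\<dots> = (\<Sum>j | c j \<noteq> 0. ennreal (c j) * (\<integral>\<^sup>+\<omega>. ennreal (r j \<omega>) \<partial>M))"
    by (simp add: nn_integral_sum nn_integral_cmult)
  also have "\<dots> \<le> (\<Sum>j | c j \<noteq> 0. ennreal (c j) * B)"
    using assms(4) cweightsD(3)[OF c] by (intro sum_mono mult_left_mono) auto
  also have "\<dots> = ennreal (\<Sum>j | c j \<noteq> 0. c j) * B"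
    using cweightsD(1)[OF c] by (simp add: sum_distrib_right[symmetric] sum_ennreal)
  also have "\<dots> = B" using cweightsD(4)[OF c] by simp
  finally show ?thesis .
qed

text \<open>The sum of the absolute increments has finite integral, so it is finite almost
  everywhere and the telescoping series converges absolutely there.\<close>

lemma (in finite_measure) AE_convergent_of_summable_L1:
  fixes U :: "nat \<Rightarrow> 'a \<Rightarrow> real"
  assumes [measurable]: "\<And>n. U n \<in> borel_measurable M"
    and s: "summable b" and b: "\<And>n. (\<integral>\<^sup>+\<omega>. ennreal \<bar>U (Suc n) \<omega> - U n \<omega>\<bar> \<partial>M) \<le> ennreal (b n)" "\<And>n. 0 \<le> b n"
  shows "AE \<omega> in M. convergent (\<lambda>n. U n \<omega>)"
proof -
  have "(\<integral>\<^sup>+\<omega>. (\<Sum>n. ennreal \<bar>U (Suc n) \<omega> - U n \<omega>\<bar>) \<partial>M) = (\<Sum>n. \<integral>\<^sup>+\<omega>. ennreal \<bar>U (Suc n) \<omega> - U n \<omega>\<bar> \<partial>M)"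
    by (rule nn_integral_suminf) measurable
  also have "\<dots> \<le> (\<Sum>n. ennreal (b n))" by (intro suminf_le b) auto
  also have "\<dots> = ennreal (\<Sum>n. b n)" by (rule suminf_ennreal2[OF b(2) s])
  finally have "AE \<omega> in M. (\<Sum>n. ennreal \<bar>U (Suc n) \<omega> - U n \<omega>\<bar>) \<noteq> \<infinity>"
    by (intro nn_integral_PInf_AE) (auto simp: top_unique)
  then show ?thesis
  proof eventually_elim
    case (elim \<omega>)
    then have "summable (\<lambda>n. \<bar>U (Suc n) \<omega> - U n \<omega>\<bar>)"
      by (intro summable_suminf_not_top) auto
    then have "summable (\<lambda>n. U (Suc n) \<omega> - U n \<omega>)" by (rule summable_rabs_cancel)
    then have "convergent (\<lambda>n. \<Sum>i<n. U (Suc i) \<omega> - U i \<omega>)" by (simp add: summable_iff_convergent)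
    then have "convergent (\<lambda>n. (U n \<omega> - U 0 \<omega>) + U 0 \<omega>)"
      unfolding sum_lessThan_telescope[of "\<lambda>n. U n \<omega>"] by (intro convergent_add convergent_const)
    then show ?case by simp
  qed
qed

text \<open>Komlos' theorem for nonnegative functions: combinations almost minimizing
  \<open>\<Sum>i. E[exp (- r i)]\<close> are Cauchy, because of
  \<open>(exp (- s) + exp (- t)) / 2 - exp (- (s + t) / 2) = (exp (- s / 2) - exp (- t / 2))\<^sup>2 / 2\<close>.\<close>

theorem (in prob_space) forward_convex_combinations:
  fixes r :: "'i \<Rightarrow> nat \<Rightarrow> 'a \<Rightarrow> real"
  assumes I: "finite I" and m [measurable]: "\<And>i j. r i j \<in> borel_measurable M"
    and r0: "\<And>i j \<omega>. 0 \<le> r i j \<omega>"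
    and B: "\<And>i j. i \<in> I \<Longrightarrow> (\<integral>\<^sup>+\<omega>. ennreal (r i j \<omega>) \<partial>M) \<le> B" "B < \<infinity>"
  obtains c where "\<And>k::nat. c k \<in> cweights k"
    "\<And>i. i \<in> I \<Longrightarrow> AE \<omega> in M. convergent (\<lambda>k. ccomb (c k) (\<lambda>j. r i j \<omega>))"
proof -
  define R where "R i d \<omega> = ccomb d (\<lambda>j. r i j \<omega>)" for i d \<omega>
  \<comment> \<open>Half the exponent: the square of \<open>U\<close> is exp (- R), and its square
    at a midpoint is the product of the two factors. The convexity defect thus becomes the square of
    a difference.\<close>
  define U where "U i d \<omega> = exp (- R i d \<omega> / 2)" for i d \<omega>
  have [measurable]: "R i d \<in> borel_measurable M" "U i d \<in> borel_measurable M" for i d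
    unfolding R_def U_def by measurable
  have R0: "0 \<le> R i d \<omega>" if "d \<in> cweights k" for i d \<omega> k
    using ccomb_mono[OF that, of "\<lambda>_. 0" "\<lambda>j. r i j \<omega>"] ccomb_const[OF that, of "0::real"] r0 by (simp add: R_def)
  have U01: "0 < U i d \<omega>" "U i d \<omega> \<le> 1" if "d \<in> cweights k" for i d \<omega> k
    using R0[OF that] by (auto simp: U_def)
  define \<Phi> where "\<Phi> d = (\<Sum>i\<in>I. \<integral>\<omega>. (U i d \<omega>)\<^sup>2 \<partial>M)" for d
  have bd: "integrable M (\<lambda>\<omega>. U i d \<omega> * U i e \<omega>)" if "d \<in> cweights k" "e \<in> cweights k'" for i d e k k'
  proof (rule integrable_const_bound[of _ 1])
    show "AE \<omega> in M. norm (U i d \<omega> * U i e \<omega>) \<le> 1"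
      using U01[OF that(1), of i] U01[OF that(2), of i]
      by (intro always_eventually allI) (simp add: abs_mult less_imp_le mult_le_one abs_of_pos)
  qed measurable
  have mid: "\<Phi> d + \<Phi> e - 2 * \<Phi> (\<lambda>j. (d j + e j) / 2) = (\<Sum>i\<in>I. \<integral>\<omega>. (U i d \<omega> - U i e \<omega>)\<^sup>2 \<partial>M)"
    if d: "d \<in> cweights k" and e: "e \<in> cweights k" for d e k
  proof -
    have "(U i (\<lambda>j. (d j + e j) / 2) \<omega>)\<^sup>2 = U i d \<omega> * U i e \<omega>" for i \<omega>
      unfolding U_def R_def cweights_midpoint(2)[OF d e]
      by (simp add: power2_eq_square exp_add[symmetric] field_simps)
    then have "\<Phi> d + \<Phi> e - 2 * \<Phi> (\<lambda>j. (d j + e j) / 2) =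
      (\<Sum>i\<in>I. (\<integral>\<omega>. U i d \<omega> * U i d \<omega> \<partial>M) + (\<integral>\<omega>. U i e \<omega> * U i e \<omega> \<partial>M) - 2 * (\<integral>\<omega>. U i d \<omega> * U i e \<omega> \<partial>M))"
      by (simp add: \<Phi>_def power2_eq_square sum.distrib sum_subtractf sum_distrib_left)
    also have "\<dots> = (\<Sum>i\<in>I. \<integral>\<omega>. U i d \<omega> * U i d \<omega> + U i e \<omega> * U i e \<omega> - 2 * (U i d \<omega> * U i e \<omega>) \<partial>M)"
      using bd[OF d d] bd[OF e e] bd[OF d e] by simp
    also have "\<dots> = (\<Sum>i\<in>I. \<integral>\<omega>. (U i d \<omega> - U i e \<omega>)\<^sup>2 \<partial>M)"
      by (simp add: power2_eq_square algebra_simps)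
    finally show ?thesis .
  qed
  have \<Phi>0: "0 \<le> \<Phi> d" for d unfolding \<Phi>_def by (intro sum_nonneg) simp
  have \<Phi>1: "\<Phi> d \<le> card I" if "d \<in> cweights k" for d k
  proof -
    have "\<Phi> d \<le> (\<Sum>i\<in>I. 1)" unfolding \<Phi>_def power2_eq_square
    proof (rule sum_mono)
      fix i
      have "(\<integral>\<omega>. U i d \<omega> * U i d \<omega> \<partial>M) \<le> (\<integral>\<omega>. 1 \<partial>M)"
        using bd[OF that that] U01[OF that, of i] by (intro integral_mono) (simp_all add: mult_le_one less_imp_le)
      then show "(\<integral>\<omega>. U i d \<omega> * U i d \<omega> \<partial>M) \<le> 1" by (simp add: prob_space)
    qed
    then show ?thesis by simp
  qed
  \<comment> \<open>These infima increase, because later combinations have fewer competitors, and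
    they are bounded by the number of indices.\<close>
  define V where "V k = Inf (\<Phi> ` cweights k)" for k
  have bb: "bdd_below (\<Phi> ` S)" for S using \<Phi>0 by (auto intro!: bdd_belowI[of _ 0])
  have V_le: "V k \<le> \<Phi> d" if "d \<in> cweights k" for k d
    unfolding V_def using that by (intro cInf_lower bb) auto
  have ne: "cweights k \<noteq> {}" for k using cweights_single by blast
  have "incseq V"
    unfolding V_def by (intro incseq_SucI cInf_superset_mono bb image_mono cweights_antimono) (use ne in auto)
  moreover have "V k \<le> card I" for k using V_le[OF cweights_single] \<Phi>1[OF cweights_single] by (rule order_trans)
  ultimately obtain L where L: "V \<longlonglongrightarrow> L" "\<And>k. V k \<le> L"
    using incseq_convergent[of V "card I"] by (metis)
  have "\<exists>d\<in>cweights k. \<Phi> d < V k + 1 / real (Suc k)" for k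
  proof -
    have "Inf (\<Phi> ` cweights k) < V k + 1 / real (Suc k)" by (simp add: V_def)
    then show ?thesis using cInf_lessD[of "\<Phi> ` cweights k"] ne by auto
  qed
  then obtain d where d: "\<And>k. d k \<in> cweights k" "\<And>k. \<Phi> (d k) < V k + 1 / real (Suc k)" by metis
  \<comment> \<open>The midpoint of \<open>d k\<close> and \<open>d l\<close> competes for
    \<open>V k\<close>, while V l is at most L. The defect is then at most L - V k plus the two
    tolerances, each at most 1 / (k + 1).\<close>
  define \<epsilon> where "\<epsilon> k = (L - V k) + 2 / real (Suc k)" for k
  have D: "(\<Sum>i\<in>I. \<integral>\<omega>. (U i (d k) \<omega> - U i (d l) \<omega>)\<^sup>2 \<partial>M) \<le> \<epsilon> k" if "k \<le> l" for k l
  proof -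
    have l: "d l \<in> cweights k" using d(1)[of l] cweights_antimono[OF that] by blast
    have "V k \<le> \<Phi> (\<lambda>j. (d k j + d l j) / 2)" by (intro V_le cweights_midpoint(1) d l)
    moreover have "1 / real (Suc l) \<le> 1 / real (Suc k)" using that by (intro divide_left_mono) auto
    ultimately show ?thesis
      using d(2)[of k] d(2)[of l] L(2)[of l] mid[OF d(1)[of k] l] unfolding \<epsilon>_def by linarith
  qed
  have "\<epsilon> \<longlonglongrightarrow> (L - L) + 2 * 0"
    unfolding \<epsilon>_def using LIMSEQ_inverse_real_of_nat
    by (intro tendsto_add tendsto_diff tendsto_const L) (auto simp: divide_inverse intro!: tendsto_mult_right_zero)
  then have \<epsilon>0: "\<epsilon> \<longlonglongrightarrow> 0" by simp
  have "\<exists>m. \<forall>k\<ge>m. \<epsilon> k < (1 / 4) ^ n" for n :: nat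
    using order_tendstoD(2)[OF \<epsilon>0, of "(1 / 4) ^ n"] by (simp add: eventually_sequentially)
  then obtain m where m: "\<And>n k. m n \<le> k \<Longrightarrow> \<epsilon> k < (1 / 4) ^ n" by metis
  \<comment> \<open>The partial sums make the index monotone and at least \<open>m n\<close>; the
    summand n keeps the combinations forward.\<close>
  define \<kappa> where "\<kappa> n = n + (\<Sum>j\<le>n. m j)" for n
  have \<kappa>m: "m n \<le> \<kappa> n" for n
    unfolding \<kappa>_def by (rule trans_le_add2) (rule member_le_sum, auto)
  have \<kappa>n: "n \<le> \<kappa> n" for n by (simp add: \<kappa>_def)
  have \<kappa>S: "\<kappa> n \<le> \<kappa> (Suc n)" for n by (simp add: \<kappa>_def)
  have conv: "AE \<omega> in M. convergent (\<lambda>n. U i (d (\<kappa> n)) \<omega>)" if i: "i \<in> I" for i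
  proof (rule AE_convergent_of_summable_L1[where b = "\<lambda>n. (1 / 2) ^ n"])
    fix n
    let ?x = "\<lambda>\<omega>. U i (d (\<kappa> (Suc n))) \<omega> - U i (d (\<kappa> n)) \<omega>"
    have xi: "integrable M (\<lambda>\<omega>. (?x \<omega>)\<^sup>2)"
    proof -
      have "(?x \<omega>)\<^sup>2 = U i (d (\<kappa> (Suc n))) \<omega> * U i (d (\<kappa> (Suc n))) \<omega> + U i (d (\<kappa> n)) \<omega> * U i (d (\<kappa> n)) \<omega>
        - 2 * (U i (d (\<kappa> (Suc n))) \<omega> * U i (d (\<kappa> n)) \<omega>)" for \<omega>
        by (simp add: power2_eq_square algebra_simps)
      then show ?thesis using bd[OF d(1) d(1), of i] by simp
    qed
    have "(\<integral>\<omega>. (?x \<omega>)\<^sup>2 \<partial>M) \<le> (\<Sum>i\<in>I. \<integral>\<omega>. (U i (d (\<kappa> n)) \<omega> - U i (d (\<kappa> (Suc n))) \<omega>)\<^sup>2 \<partial>M)"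
      unfolding power2_commute[of "U i (d (\<kappa> (Suc n))) _"]
      by (rule member_le_sum[OF i _ I]) simp
    also have "\<dots> \<le> (1 / 4) ^ n" using D[OF \<kappa>S[of n]] m[OF \<kappa>m[of n]] by linarith
    finally have x2: "(\<integral>\<omega>. (?x \<omega>)\<^sup>2 \<partial>M) \<le> (1 / 4) ^ n" .
    \<comment> \<open>The weighted arithmetic-geometric inequality turns the mean-square bound (1 /
      4) ^ n into the summable mean bound (1 / 2) ^ n.\<close>
    have "\<bar>y\<bar> \<le> ((1 / 2) ^ n + 2 ^ n * y\<^sup>2) / 2" for y :: real
    proof -
      have "0 \<le> (1 / 2) ^ n * (1 - 2 ^ n * \<bar>y\<bar>)\<^sup>2" by simp
      also have "\<dots> = (1 / 2) ^ n - 2 * \<bar>y\<bar> + 2 ^ n * y\<^sup>2"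
        by (simp add: power2_eq_square algebra_simps power_divide)
      finally show ?thesis by simp
    qed
    then have "(\<integral>\<^sup>+\<omega>. ennreal \<bar>?x \<omega>\<bar> \<partial>M) \<le> (\<integral>\<^sup>+\<omega>. ennreal (((1 / 2) ^ n + 2 ^ n * (?x \<omega>)\<^sup>2) / 2) \<partial>M)"
      by (intro nn_integral_mono ennreal_leI)
    also have "\<dots> = ennreal (\<integral>\<omega>. ((1 / 2) ^ n + 2 ^ n * (?x \<omega>)\<^sup>2) / 2 \<partial>M)"
      using xi by (intro nn_integral_eq_integral) auto
    also have "(\<integral>\<omega>. ((1 / 2) ^ n + 2 ^ n * (?x \<omega>)\<^sup>2) / 2 \<partial>M) = ((1 / 2) ^ n + 2 ^ n * (\<integral>\<omega>. (?x \<omega>)\<^sup>2 \<partial>M)) / 2"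
      using xi by (simp add: prob_space)
    also have "ennreal \<dots> \<le> ennreal ((1 / 2) ^ n)"
    proof (rule ennreal_leI)
      have "2 ^ n * (\<integral>\<omega>. (?x \<omega>)\<^sup>2 \<partial>M) \<le> 2 ^ n * (1 / 4) ^ n" using x2 by (intro mult_left_mono) auto
      also have "\<dots> = (1 / 2 :: real) ^ n" by (simp add: power_mult_distrib[symmetric])
      finally show "((1 / 2) ^ n + 2 ^ n * (\<integral>\<omega>. (?x \<omega>)\<^sup>2 \<partial>M)) / 2 \<le> (1 / 2) ^ n" by simp
    qed
    finally show "(\<integral>\<^sup>+\<omega>. ennreal \<bar>?x \<omega>\<bar> \<partial>M) \<le> ennreal ((1 / 2) ^ n)" .
  qed (auto intro: summable_geometric)
  \<comment> \<open>Convergence of \<open>U\<close> to 0 would mean divergence of the combinations.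
    Fatou and the bound B exclude this almost everywhere.\<close>
  have fin: "AE \<omega> in M. liminf (\<lambda>n. ennreal (R i (d (\<kappa> n)) \<omega>)) \<noteq> \<infinity>" if i: "i \<in> I" for i
  proof (rule nn_integral_PInf_AE)
    have "(\<integral>\<^sup>+\<omega>. liminf (\<lambda>n. ennreal (R i (d (\<kappa> n)) \<omega>)) \<partial>M) \<le> liminf (\<lambda>n. \<integral>\<^sup>+\<omega>. ennreal (R i (d (\<kappa> n)) \<omega>) \<partial>M)"
      by (rule nn_integral_liminf) measurable
    also have "\<dots> \<le> B"
      by (rule Liminf_le[OF _ always_eventually, rotated], unfold R_def)
        (auto intro!: nn_integral_ccomb_le[OF d(1)] r0 B(1)[OF i])
    finally show "(\<integral>\<^sup>+\<omega>. liminf (\<lambda>n. ennreal (R i (d (\<kappa> n)) \<omega>)) \<partial>M) \<noteq> \<infinity>" using B(2) by (auto simp: top_unique)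
  qed measurable
  show ?thesis
  proof (rule that[of "\<lambda>n. d (\<kappa> n)"])
    show "d (\<kappa> k) \<in> cweights k" for k using d(1) cweights_antimono[OF \<kappa>n] by blast
    fix i assume i: "i \<in> I"
    show "AE \<omega> in M. convergent (\<lambda>k. ccomb (d (\<kappa> k)) (\<lambda>j. r i j \<omega>))"
      using conv[OF i] fin[OF i]
    proof eventually_elim
      case (elim \<omega>)
      then obtain u where u: "(\<lambda>n. U i (d (\<kappa> n)) \<omega>) \<longlonglongrightarrow> u" by (auto simp: convergent_def)
      have "0 \<le> u" by (rule LIMSEQ_le_const[OF u]) (use less_imp_le[OF U01(1)[OF d(1)]] in blast)
      have R: "R i (d (\<kappa> n)) \<omega> = - 2 * ln (U i (d (\<kappa> n)) \<omega>)" for n by (simp add: U_def)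
      show ?case
      proof (cases "u = 0")
        case True
        have ge: "ennreal Z \<le> liminf (\<lambda>n. ennreal (R i (d (\<kappa> n)) \<omega>))" for Z
        proof (rule Liminf_bounded)
          have "\<forall>\<^sub>F n in sequentially. U i (d (\<kappa> n)) \<omega> < exp (- Z / 2)"
            using u True by (intro order_tendstoD(2)[of _ 0]) auto
          then show "\<forall>\<^sub>F n in sequentially. ennreal Z \<le> ennreal (R i (d (\<kappa> n)) \<omega>)"
            by eventually_elim (auto simp: U_def intro!: ennreal_leI)
        qed
        obtain z where z: "liminf (\<lambda>n. ennreal (R i (d (\<kappa> n)) \<omega>)) = ennreal z" "0 \<le> z"
          using elim(2) by (cases "liminf (\<lambda>n. ennreal (R i (d (\<kappa> n)) \<omega>))") auto
        have False using ge[of "z + 1"] z by simp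
        then show ?thesis ..
      next
        case False
        with \<open>0 \<le> u\<close> have "(\<lambda>n. - 2 * ln (U i (d (\<kappa> n)) \<omega>)) \<longlonglongrightarrow> - 2 * ln u"
          by (intro tendsto_mult tendsto_ln tendsto_const u) auto
        then show ?thesis unfolding R[symmetric] unfolding R_def by (rule convergentI)
      qed
    qed
  qed
qed

section \<open>Compactness of strategies with integrable costs\<close>

text \<open>This is sqrt (1 + \<bar>z\<bar>^2) - 1, written as a norm in a product space so that
  convexity and continuity are inherited from the norm.\<close>

definition soft :: "'e::real_inner \<Rightarrow> real" where
  "soft z = norm (1 :: real, z) - 1"

lemma soft_nonneg: "0 \<le> soft z"
  using norm_fst_le[of "1::real" z] by (simp add: soft_def)

lemma norm_le_soft: "norm z \<le> soft z + 1"
  using norm_snd_le[of z "1::real"] by (simp add: soft_def)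

lemma soft_eq_0_iff: "soft z = 0 \<longleftrightarrow> z = 0"
proof
  assume "soft z = 0"
  then have "(norm (1 :: real, z))\<^sup>2 = 1" by (simp add: soft_def)
  then show "z = 0" by (simp add: norm_Pair)
qed (simp add: soft_def norm_Pair)

lemma soft_0 [simp]: "soft 0 = 0"
  by (simp add: soft_eq_0_iff)

lemma borel_measurable_soft [measurable]: "soft \<in> borel_measurable borel"
  unfolding soft_def[abs_def] by (intro borel_measurable_continuous_onI continuous_intros)

lemma tendsto_soft: "(f \<longlongrightarrow> l) G \<Longrightarrow> ((\<lambda>x. soft (f x)) \<longlongrightarrow> soft l) G"
  unfolding soft_def by (intro tendsto_intros)

lemma soft_ccomb_le:
  assumes "c \<in> cweights k"
  shows "soft (ccomb c a) \<le> ccomb c (\<lambda>j. soft (a j))"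
proof -
  have "norm (1 :: real, ccomb c a) = norm (ccomb c (\<lambda>j. (1 :: real, a j)))"
    by (simp add: ccomb_Pair ccomb_const[OF assms])
  also have "\<dots> \<le> ccomb c (\<lambda>j. norm (1 :: real, a j))" by (rule ccomb_norm_le[OF assms])
  finally show ?thesis
    using ccomb_add[of c "\<lambda>j. norm (1 :: real, a j)" "\<lambda>_. - 1"] ccomb_const[OF assms, of "- 1 :: real"]
    by (simp add: soft_def)
qed

text \<open>The gradient of \<open>soft\<close>.\<close>

definition dsoft :: "'e::real_inner \<Rightarrow> 'e" where
  "dsoft z = (1 / norm (1 :: real, z)) *\<^sub>R z"

lemma norm_one_Pair_ge: "1 \<le> norm (1 :: real, z)"
  using norm_fst_le[of "1::real" z] by simp

lemma norm_dsoft_le: "norm (dsoft z) \<le> 1"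
proof -
  have "norm z \<le> norm (1 :: real, z)" by (rule norm_snd_le)
  then show ?thesis
    using norm_one_Pair_ge[of z] by (simp add: dsoft_def divide_le_eq)
qed

lemma borel_measurable_dsoft [measurable]:
  "(dsoft :: 'e::euclidean_space \<Rightarrow> 'e) \<in> borel_measurable borel"
proof -
  have "norm (1 :: real, z) \<noteq> 0" for z :: 'e using norm_one_Pair_ge[of z] by linarith
  then show ?thesis
    unfolding dsoft_def[abs_def] by (intro borel_measurable_continuous_onI continuous_intros) auto
qed

text \<open>The concave square root lies below its tangent at \<open>h\<close>^2; this tangent value
  is \<open>t\<close>. Since \<open>h\<close> is at least 1, the second-order coefficient is at most
  1 / 2 uniformly in z, so variations of the penalty have an error that is quadratic in the
  step.\<close>

lemma soft_quadratic: "soft (z + y) \<le> soft z + dsoft z \<bullet> y + (norm y)\<^sup>2 / 2"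
proof -
  define h where "h = norm (1 :: real, z)"
  have h1: "1 \<le> h" unfolding h_def by (rule norm_one_Pair_ge)
  have h2: "h\<^sup>2 = 1 + (norm z)\<^sup>2" by (simp add: h_def norm_Pair)
  define t where "t = h + (z \<bullet> y) / h + (norm y)\<^sup>2 / (2 * h)"
  have "2 * h * t = 2 * h\<^sup>2 + 2 * (z \<bullet> y) + (norm y)\<^sup>2"
    using h1 by (simp add: t_def field_simps power2_eq_square)
  moreover have "(norm (z + y))\<^sup>2 = (norm z)\<^sup>2 + 2 * (z \<bullet> y) + (norm y)\<^sup>2"
    unfolding power2_norm_eq_inner by (simp add: inner_add_left inner_add_right inner_commute)
  ultimately have eq: "2 * h * t = h\<^sup>2 + (1 + (norm (z + y))\<^sup>2)" using h2 by simp
  have "0 \<le> 2 * h * t" unfolding eq by simp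
  then have "0 \<le> t" using h1 by (simp add: zero_le_mult_iff)
  have "2 * h * t \<le> h\<^sup>2 + t\<^sup>2" using sum_squares_bound[of h t] by simp
  then have "1 + (norm (z + y))\<^sup>2 \<le> t\<^sup>2" using eq by simp
  then have "sqrt (1 + (norm (z + y))\<^sup>2) \<le> t" using \<open>0 \<le> t\<close> by (intro real_le_lsqrt)
  moreover have "(norm y)\<^sup>2 / (2 * h) \<le> (norm y)\<^sup>2 / 2" using h1 by (intro divide_left_mono) auto
  ultimately show ?thesis by (simp add: soft_def dsoft_def norm_Pair t_def h_def)
qed

text \<open>The gradient inequality of a convex function that vanishes at 0.\<close>

lemma soft_le_dsoft_inner: "soft z \<le> dsoft z \<bullet> z"
proof -
  define h where "h = norm (1 :: real, z)"
  have h1: "1 \<le> h" unfolding h_def by (rule norm_one_Pair_ge)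
  have h2: "h\<^sup>2 = 1 + (norm z)\<^sup>2" by (simp add: h_def norm_Pair)
  have "(h - 1) * h \<le> (norm z)\<^sup>2" using h1 h2 by (simp add: power2_eq_square algebra_simps)
  then have "h - 1 \<le> (norm z)\<^sup>2 / h" using h1 by (simp add: le_divide_eq)
  then show ?thesis by (simp add: soft_def dsoft_def h_def power2_norm_eq_inner)
qed

context staged begin

lemma adapted_ccomb: "(\<And>j. x j \<in> adapted) \<Longrightarrow> (\<lambda>\<omega>. ccomb c (\<lambda>j. x j \<omega>)) \<in> adapted"
  unfolding ccomb_def by (intro adapted_sum adapted_scaleR)

text \<open>Convex combinations make the heights and perturbations converge; the strategies may
  diverge, and the closed cone supplies x' in place of a limit. In the last conclusion one limit
  serves every \<kappa>, as is needed when the weight grows along the sequence.\<close>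

theorem strategy_compactness:
  fixes C :: "'w \<Rightarrow> ('e::euclidean_space \<times> real) set" and J :: "real ^ 'n \<Rightarrow> 'e"
  assumes J: "linear J"
    and C: "AE \<omega> in M. closed (C \<omega>) \<and> convex (C \<omega>)"
    and sym: "\<And>r. r \<in> adapted \<Longrightarrow> AE \<omega> in M. ((J (r \<omega>), 0), 0) \<in> pcone (C \<omega>) \<Longrightarrow>
      AE \<omega> in M. ((- J (r \<omega>), 0), 0) \<in> pcone (C \<omega>)"
    and v [measurable]: "v \<in> borel_measurable M" and v01: "\<And>\<omega>. 0 < v \<omega>" "\<And>\<omega>. v \<omega> \<le> 1"
    and x: "\<And>k. x k \<in> adapted"
    and \<zeta> [measurable]: "\<And>k. \<zeta> k \<in> borel_measurable M"
    and r [measurable]: "\<And>k. r k \<in> borel_measurable M" and r0: "\<And>k \<omega>. 0 \<le> r k \<omega>"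
    and mem: "\<And>k. AE \<omega> in M. (a \<omega> + J (x k \<omega>) + \<zeta> k \<omega>, r k \<omega>) \<in> C \<omega>"
    and B: "\<And>k. (\<integral>\<^sup>+\<omega>. ennreal (r k \<omega> + v \<omega> * soft (\<zeta> k \<omega>)) \<partial>M) \<le> B" "B < \<infinity>"
  obtains x' \<zeta>' r' where "x' \<in> adapted" "\<zeta>' \<in> borel_measurable M" "r' \<in> borel_measurable M"
    "\<And>\<omega>. 0 \<le> r' \<omega>" "AE \<omega> in M. (a \<omega> + J (x' \<omega>) + \<zeta>' \<omega>, r' \<omega>) \<in> C \<omega>"
    "\<And>\<kappa> b. 0 \<le> \<kappa> \<Longrightarrow> \<forall>\<^sub>F k in sequentially. (\<integral>\<^sup>+\<omega>. ennreal (r k \<omega> + \<kappa> * (v \<omega> * soft (\<zeta> k \<omega>))) \<partial>M) \<le> b \<Longrightarrow>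
      (\<integral>\<^sup>+\<omega>. ennreal (r' \<omega> + \<kappa> * (v \<omega> * soft (\<zeta>' \<omega>))) \<partial>M) \<le> b"
proof -
  \<comment> \<open>the components of \<open>v *\<^sub>R \<zeta>\<close> are split as differences of nonnegative functions\<close>
  define g :: "'e option \<Rightarrow> nat \<Rightarrow> 'w \<Rightarrow> real" where
    "g i k \<omega> = (case i of None \<Rightarrow> r k \<omega> | Some b \<Rightarrow> if norm b \<le> 1 then v \<omega> * (norm (\<zeta> k \<omega>) + \<zeta> k \<omega> \<bullet> b) else 0)" for i k \<omega>
  \<comment> \<open>Index \<open>Some 0\<close> gives the weighted norm alone; subtracting it from
    \<open>Some b\<close> leaves a component of the weighted perturbation. For indices outside this
    set the test on \<open>norm b\<close> still guarantees nonnegativity, which the combination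
    theorem demands of all indices.\<close>
  let ?I = "insert None (Some ` insert 0 Basis)"
  have gm: "g i k \<in> borel_measurable M" for i k unfolding g_def by (cases i) auto
  have ib: "\<bar>z \<bullet> b\<bar> \<le> norm z" if "norm b \<le> 1" for z b :: 'e
    using order_trans[OF Cauchy_Schwarz_ineq2[of z b] mult_left_mono[OF that norm_ge_zero, of z]] by simp
  have g0: "0 \<le> g i k \<omega>" for i k \<omega>
  proof (cases i)
    case (Some b)
    have "0 \<le> norm (\<zeta> k \<omega>) + \<zeta> k \<omega> \<bullet> b" if "norm b \<le> 1"
      using ib[OF that, of "\<zeta> k \<omega>"] by linarith
    then show ?thesis using v01(1)[of \<omega>] by (simp add: g_def Some less_imp_le)
  qed (simp add: g_def r0)
  \<comment> \<open>The constants come from norm \<zeta> \<le> soft \<zeta> + 1, the factor 2 in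
    norm plus component, and v \<le> 1.\<close>
  have gB: "(\<integral>\<^sup>+\<omega>. ennreal (g i k \<omega>) \<partial>M) \<le> 2 * B + 2" for i k
  proof -
    have "g i k \<omega> \<le> 2 * (r k \<omega> + v \<omega> * soft (\<zeta> k \<omega>)) + 2" for \<omega>
    proof (cases i)
      case None
      then show ?thesis using r0[of k \<omega>] mult_nonneg_nonneg[OF less_imp_le[OF v01(1)[of \<omega>]] soft_nonneg[of "\<zeta> k \<omega>"]]
        by (simp add: g_def)
    next
      case (Some b)
      have "norm (\<zeta> k \<omega>) + \<zeta> k \<omega> \<bullet> b \<le> 2 * soft (\<zeta> k \<omega>) + 2" if "norm b \<le> 1"
        using ib[OF that, of "\<zeta> k \<omega>"] norm_le_soft[of "\<zeta> k \<omega>"] by linarith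
      from mult_left_mono[OF this less_imp_le[OF v01(1)[of \<omega>]]]
      have "g i k \<omega> \<le> v \<omega> * (2 * soft (\<zeta> k \<omega>) + 2)"
        using v01(1)[of \<omega>] soft_nonneg[of "\<zeta> k \<omega>"] by (auto simp: g_def Some)
      then show ?thesis using v01(2)[of \<omega>] r0[of k \<omega>] by (simp add: algebra_simps)
    qed
    then have "(\<integral>\<^sup>+\<omega>. ennreal (g i k \<omega>) \<partial>M) \<le> (\<integral>\<^sup>+\<omega>. 2 * ennreal (r k \<omega> + v \<omega> * soft (\<zeta> k \<omega>)) + 2 \<partial>M)"
    proof (intro nn_integral_mono)
      fix \<omega>
      have e2: "2 * ennreal X + 2 = ennreal (2 * X + 2)" if "0 \<le> X" for X
        using ennreal_plus[of "2 * X" 2] ennreal_mult[of 2 X] that by simp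
      have "0 \<le> r k \<omega> + v \<omega> * soft (\<zeta> k \<omega>)" by (intro add_nonneg_nonneg mult_nonneg_nonneg r0 soft_nonneg less_imp_le v01)
      then have "2 * ennreal (r k \<omega> + v \<omega> * soft (\<zeta> k \<omega>)) + 2 = ennreal (2 * (r k \<omega> + v \<omega> * soft (\<zeta> k \<omega>)) + 2)"
        by (rule e2)
      then show "ennreal (g i k \<omega>) \<le> 2 * ennreal (r k \<omega> + v \<omega> * soft (\<zeta> k \<omega>)) + 2"
        using \<open>\<And>\<omega>. g i k \<omega> \<le> 2 * (r k \<omega> + v \<omega> * soft (\<zeta> k \<omega>)) + 2\<close>[of \<omega>] by (simp add: ennreal_leI)
    qed
    also have "\<dots> = 2 * (\<integral>\<^sup>+\<omega>. ennreal (r k \<omega> + v \<omega> * soft (\<zeta> k \<omega>)) \<partial>M) + 2"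
      by (simp add: nn_integral_add nn_integral_cmult emeasure_space_1)
    also have "\<dots> \<le> 2 * B + 2" using B(1)[of k] by (intro add_mono mult_left_mono) auto
    finally show ?thesis .
  qed
  have Bfin: "2 * B + 2 < \<infinity>" using B(2) by (simp add: ennreal_mult_less_top)
  obtain c where c: "\<And>k::nat. c k \<in> cweights k"
    and conv: "\<And>i. i \<in> ?I \<Longrightarrow> AE \<omega> in M. convergent (\<lambda>k. ccomb (c k) (\<lambda>j. g i j \<omega>))"
    by (rule forward_convex_combinations[of ?I g, OF _ gm g0 gB Bfin]) (simp, rule that)
  define G where "G i \<omega> = lim (\<lambda>k. ccomb (c k) (\<lambda>j. g i j \<omega>))" for i \<omega>
  have [measurable]: "G i \<in> borel_measurable M" for i
    unfolding G_def using gm by measurable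
  have lim: "AE \<omega> in M. \<forall>i\<in>?I. (\<lambda>k. ccomb (c k) (\<lambda>j. g i j \<omega>)) \<longlonglongrightarrow> G i \<omega>"
    using conv by (intro AE_finite_allI) (auto simp: G_def convergent_LIMSEQ_iff)
  define \<zeta>' where "\<zeta>' \<omega> = (\<Sum>b\<in>Basis. ((G (Some b) \<omega> - G (Some 0) \<omega>) / v \<omega>) *\<^sub>R b)" for \<omega>
  \<comment> \<open>The limit is nonnegative where it exists; the maximum extends this to the
    exceptional null set.\<close>
  define r' where "r' \<omega> = max 0 (G None \<omega>)" for \<omega>
  define xc where "xc k \<omega> = ccomb (c k) (\<lambda>j. x j \<omega>)" for k \<omega>
  define zc where "zc k \<omega> = ccomb (c k) (\<lambda>j. \<zeta> j \<omega>)" for k \<omega>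
  define rc where "rc k \<omega> = ccomb (c k) (\<lambda>j. r j \<omega>)" for k \<omega>
  have [measurable]: "\<zeta>' \<in> borel_measurable M" "r' \<in> borel_measurable M"
    "\<And>k. zc k \<in> borel_measurable M" "\<And>k. rc k \<in> borel_measurable M"
    unfolding \<zeta>'_def r'_def zc_def rc_def by measurable
  have xc: "xc k \<in> adapted" for k unfolding xc_def by (rule adapted_ccomb[OF x])
  have rc0: "0 \<le> rc k \<omega>" for k \<omega>
    using ccomb_mono[OF c, of k "\<lambda>_. 0" "\<lambda>j. r j \<omega>"] r0 ccomb_const[OF c, of k "0::real"] by (simp add: rc_def)
  have rlim: "AE \<omega> in M. (\<lambda>k. rc k \<omega>) \<longlonglongrightarrow> r' \<omega>"
    using lim
  proof eventually_elim
    case (elim \<omega>)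
    then have l: "(\<lambda>k. rc k \<omega>) \<longlonglongrightarrow> G None \<omega>" by (simp add: rc_def g_def)
    moreover have "0 \<le> G None \<omega>" by (rule LIMSEQ_le_const[OF l]) (simp add: rc0)
    ultimately show ?case by (simp add: r'_def)
  qed
  have zlim: "AE \<omega> in M. (\<lambda>k. zc k \<omega>) \<longlonglongrightarrow> \<zeta>' \<omega>"
    using lim
  proof eventually_elim
    case (elim \<omega>)
    have "(\<lambda>k. zc k \<omega> \<bullet> b) \<longlonglongrightarrow> (G (Some b) \<omega> - G (Some 0) \<omega>) / v \<omega>" if b: "b \<in> Basis" for b
    proof -
      have "(\<lambda>k. (ccomb (c k) (\<lambda>j. g (Some b) j \<omega>) - ccomb (c k) (\<lambda>j. g (Some 0) j \<omega>)) / v \<omega>)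
        \<longlonglongrightarrow> (G (Some b) \<omega> - G (Some 0) \<omega>) / v \<omega>"
        using elim b v01(1)[of \<omega>] by (intro tendsto_divide tendsto_diff tendsto_const) auto
      moreover have "(ccomb (c k) (\<lambda>j. g (Some b) j \<omega>) - ccomb (c k) (\<lambda>j. g (Some 0) j \<omega>)) / v \<omega> = zc k \<omega> \<bullet> b" for k
        unfolding ccomb_def zc_def sum_subtractf[symmetric] inner_sum_left sum_divide_distrib
        using b v01(1)[of \<omega>] by (intro sum.cong) (auto simp: g_def field_simps)
      ultimately show ?thesis by simp
    qed
    then have "(\<lambda>k. \<Sum>b\<in>Basis. (zc k \<omega> \<bullet> b) *\<^sub>R b) \<longlonglongrightarrow> \<zeta>' \<omega>"
      unfolding \<zeta>'_def by (intro tendsto_sum tendsto_scaleR tendsto_const) auto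
    then show ?case by (simp add: euclidean_representation)
  qed
  \<comment> \<open>In the perspective cone, strategies enter as directions: the inner 0 is the
    epigraph height, the outer 0 the perspective height. The convergent term carries the perspective
    height 1.\<close>
  let ?J = "\<lambda>y. ((J y, 0 :: real), 0 :: real)"
  have lin: "linear ?J"
    by (rule linearI) (simp_all add: linear_add[OF J] linear_cmul[OF J])
  obtain x' where x': "x' \<in> adapted"
    and "AE \<omega> in M. ?J (x' \<omega>) + ((a \<omega> + \<zeta>' \<omega>, r' \<omega>), 1) \<in> pcone (C \<omega>)"
  proof (rule adapted_cone_closed[OF lin, of "\<lambda>\<omega>. pcone (C \<omega>)" xc "\<lambda>k \<omega>. ((a \<omega> + zc k \<omega>, rc k \<omega>), 1)" "\<lambda>\<omega>. ((a \<omega> + \<zeta>' \<omega>, r' \<omega>), 1)"])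
    show "AE \<omega> in M. closed (pcone (C \<omega>)) \<and> convex_cone (pcone (C \<omega>))"
      by (simp add: closed_pcone convex_cone_pcone)
    show "AE \<omega> in M. - ?J (r \<omega>) \<in> pcone (C \<omega>)" if "r \<in> adapted" "AE \<omega> in M. ?J (r \<omega>) \<in> pcone (C \<omega>)" for r
      using sym[OF that] by simp
    show "AE \<omega> in M. (\<lambda>k. ((a \<omega> + zc k \<omega>, rc k \<omega>), 1)) \<longlonglongrightarrow> ((a \<omega> + \<zeta>' \<omega>, r' \<omega>), 1)"
      using zlim rlim by eventually_elim (intro tendsto_Pair tendsto_add tendsto_const)
    show "AE \<omega> in M. \<forall>k. ?J (xc k \<omega>) + ((a \<omega> + zc k \<omega>, rc k \<omega>), 1) \<in> pcone (C \<omega>)"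
    proof -
      have "AE \<omega> in M. \<forall>k. (a \<omega> + J (x k \<omega>) + \<zeta> k \<omega>, r k \<omega>) \<in> C \<omega>" using mem by (simp add: AE_all_countable)
      then show ?thesis using C
      proof eventually_elim
        case (elim \<omega>)
        show ?case
        proof
          fix k
          have "ccomb (c k) (\<lambda>j. (a \<omega> + J (x j \<omega>) + \<zeta> j \<omega>, r j \<omega>)) \<in> C \<omega>"
            using elim by (intro ccomb_in_convex[OF c]) auto
          then have "(a \<omega> + J (xc k \<omega>) + zc k \<omega>, rc k \<omega>) \<in> C \<omega>"
            by (simp add: ccomb_Pair ccomb_add ccomb_const[OF c] ccomb_linear[OF J] xc_def zc_def rc_def)
          then show "?J (xc k \<omega>) + ((a \<omega> + zc k \<omega>, rc k \<omega>), 1) \<in> pcone (C \<omega>)"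
            using elim by (simp add: pcone_1_iff algebra_simps)
        qed
      qed
    qed
  qed (use xc in auto)
  then have mem': "AE \<omega> in M. ?J (x' \<omega>) + ((a \<omega> + \<zeta>' \<omega>, r' \<omega>), 1) \<in> pcone (C \<omega>)" by blast
  show ?thesis
  proof (rule that[of x' \<zeta>' r'])
    show "AE \<omega> in M. (a \<omega> + J (x' \<omega>) + \<zeta>' \<omega>, r' \<omega>) \<in> C \<omega>"
      using mem' C by eventually_elim (simp add: pcone_1_iff algebra_simps)
    fix \<kappa> :: real and b
    assume \<kappa>: "0 \<le> \<kappa>" and ev: "\<forall>\<^sub>F k in sequentially. (\<integral>\<^sup>+\<omega>. ennreal (r k \<omega> + \<kappa> * (v \<omega> * soft (\<zeta> k \<omega>))) \<partial>M) \<le> b"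
    define H where "H k \<omega> = r k \<omega> + \<kappa> * (v \<omega> * soft (\<zeta> k \<omega>))" for k \<omega>
    have [measurable]: "H k \<in> borel_measurable M" for k unfolding H_def by measurable
    have H0: "0 \<le> H k \<omega>" for k \<omega> unfolding H_def by (intro add_nonneg_nonneg mult_nonneg_nonneg r0 soft_nonneg less_imp_le[OF v01(1)] \<kappa>)
    have le: "rc k \<omega> + \<kappa> * (v \<omega> * soft (zc k \<omega>)) \<le> ccomb (c k) (\<lambda>j. H j \<omega>)" for k \<omega>
    proof -
      have "ccomb (c k) (\<lambda>j. H j \<omega>) = rc k \<omega> + \<kappa> * (v \<omega> * ccomb (c k) (\<lambda>j. soft (\<zeta> j \<omega>)))"
        by (simp add: H_def rc_def ccomb_def distrib_left sum.distrib sum_distrib_left algebra_simps)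
      moreover have "\<kappa> * (v \<omega> * soft (zc k \<omega>)) \<le> \<kappa> * (v \<omega> * ccomb (c k) (\<lambda>j. soft (\<zeta> j \<omega>)))"
        unfolding zc_def using \<kappa> v01(1)[of \<omega>] by (intro mult_left_mono soft_ccomb_le[OF c]) auto
      ultimately show ?thesis by simp
    qed
    have "(\<integral>\<^sup>+\<omega>. ennreal (r' \<omega> + \<kappa> * (v \<omega> * soft (\<zeta>' \<omega>))) \<partial>M) =
      (\<integral>\<^sup>+\<omega>. liminf (\<lambda>k. ennreal (rc k \<omega> + \<kappa> * (v \<omega> * soft (zc k \<omega>)))) \<partial>M)"
    proof (rule nn_integral_cong_AE)
      show "AE \<omega> in M. ennreal (r' \<omega> + \<kappa> * (v \<omega> * soft (\<zeta>' \<omega>))) = liminf (\<lambda>k. ennreal (rc k \<omega> + \<kappa> * (v \<omega> * soft (zc k \<omega>))))"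
        using rlim zlim
        by eventually_elim (intro lim_imp_Liminf[symmetric] tendsto_ennrealI tendsto_add tendsto_mult tendsto_const tendsto_soft; simp)
    qed
    also have "\<dots> \<le> liminf (\<lambda>k. \<integral>\<^sup>+\<omega>. ennreal (rc k \<omega> + \<kappa> * (v \<omega> * soft (zc k \<omega>))) \<partial>M)"
      by (rule nn_integral_liminf) measurable
    also have "\<dots> \<le> b"
    proof (rule Liminf_le)
      obtain k0 where k0: "\<And>k. k0 \<le> k \<Longrightarrow> (\<integral>\<^sup>+\<omega>. ennreal (H k \<omega>) \<partial>M) \<le> b"
        using ev by (auto simp: eventually_sequentially H_def)
      have "(\<integral>\<^sup>+\<omega>. ennreal (rc k \<omega> + \<kappa> * (v \<omega> * soft (zc k \<omega>))) \<partial>M) \<le> b" if "k0 \<le> k" for k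
      proof -
        have "(\<integral>\<^sup>+\<omega>. ennreal (rc k \<omega> + \<kappa> * (v \<omega> * soft (zc k \<omega>))) \<partial>M) \<le> (\<integral>\<^sup>+\<omega>. ennreal (ccomb (c k) (\<lambda>j. H j \<omega>)) \<partial>M)"
          by (intro nn_integral_mono ennreal_leI le)
        also have "\<dots> \<le> b" using k0 that by (intro nn_integral_ccomb_le[OF c] H0) auto
        finally show ?thesis .
      qed
      then show "\<forall>\<^sub>F k in sequentially. (\<integral>\<^sup>+\<omega>. ennreal (rc k \<omega> + \<kappa> * (v \<omega> * soft (zc k \<omega>))) \<partial>M) \<le> b"
        by (auto simp: eventually_sequentially)
    qed simp
    finally show "(\<integral>\<^sup>+\<omega>. ennreal (r' \<omega> + \<kappa> * (v \<omega> * soft (\<zeta>' \<omega>))) \<partial>M) \<le> b" .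
  qed (use x' in \<open>auto simp: r'_def\<close>)
qed

end

section \<open>Expectations of extended real-valued functions\<close>

lemma ext_expectation_cong_AE:
  "AE \<omega> in M. X \<omega> = Z \<omega> \<Longrightarrow> ext_expectation M X = ext_expectation M Z"
proof -
  assume *: "AE \<omega> in M. X \<omega> = Z \<omega>"
  have "(\<integral>\<^sup>+\<omega>. e2ennreal (X \<omega>) \<partial>M) = (\<integral>\<^sup>+\<omega>. e2ennreal (Z \<omega>) \<partial>M)"
    "(\<integral>\<^sup>+\<omega>. e2ennreal (- X \<omega>) \<partial>M) = (\<integral>\<^sup>+\<omega>. e2ennreal (- Z \<omega>) \<partial>M)"
    using * by (auto intro!: nn_integral_cong_AE elim!: AE_mp)
  then show ?thesis by (simp add: ext_expectation_def)
qed

lemma integral_eq_nn_integral_diff: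
  fixes h :: "'w \<Rightarrow> real"
  assumes "integrable M h"
  shows "enn2ereal (\<integral>\<^sup>+\<omega>. ennreal (h \<omega>) \<partial>M) - enn2ereal (\<integral>\<^sup>+\<omega>. ennreal (- h \<omega>) \<partial>M) = ereal (\<integral>\<omega>. h \<omega> \<partial>M)"
    and "(\<integral>\<^sup>+\<omega>. ennreal (h \<omega>) \<partial>M) < \<infinity>" "(\<integral>\<^sup>+\<omega>. ennreal (- h \<omega>) \<partial>M) < \<infinity>"
proof -
  show "(\<integral>\<^sup>+\<omega>. ennreal (h \<omega>) \<partial>M) < \<infinity>" "(\<integral>\<^sup>+\<omega>. ennreal (- h \<omega>) \<partial>M) < \<infinity>"
    using assms by (auto elim!: integrableE)
  then obtain a b where ab: "(\<integral>\<^sup>+\<omega>. ennreal (h \<omega>) \<partial>M) = ennreal a" "0 \<le> a"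
    "(\<integral>\<^sup>+\<omega>. ennreal (- h \<omega>) \<partial>M) = ennreal b" "0 \<le> b"
    by (metis ennreal_cases infinity_ennreal_def less_irrefl)
  show "enn2ereal (\<integral>\<^sup>+\<omega>. ennreal (h \<omega>) \<partial>M) - enn2ereal (\<integral>\<^sup>+\<omega>. ennreal (- h \<omega>) \<partial>M) = ereal (\<integral>\<omega>. h \<omega> \<partial>M)"
    using real_lebesgue_integral_def[OF assms] ab by (simp add: enn2ereal_ennreal)
qed

lemma e2ennreal_ereal_mono: "x \<le> ereal h \<Longrightarrow> e2ennreal x \<le> ennreal h"
  by (metis e2ennreal_ereal e2ennreal_mono)

lemma e2ennreal_ereal_mono': "ereal h \<le> x \<Longrightarrow> ennreal h \<le> e2ennreal x"
  by (metis e2ennreal_ereal e2ennreal_mono)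

lemma ext_expectation_le:
  assumes h: "integrable M h" and le: "AE \<omega> in M. X \<omega> \<le> ereal (h \<omega>)"
  shows "ext_expectation M X \<le> ereal (\<integral>\<omega>. h \<omega> \<partial>M)"
proof -
  have p: "(\<integral>\<^sup>+\<omega>. e2ennreal (X \<omega>) \<partial>M) \<le> (\<integral>\<^sup>+\<omega>. ennreal (h \<omega>) \<partial>M)"
    using le by (intro nn_integral_mono_AE) (auto elim!: AE_mp intro!: e2ennreal_ereal_mono)
  have n: "(\<integral>\<^sup>+\<omega>. ennreal (- h \<omega>) \<partial>M) \<le> (\<integral>\<^sup>+\<omega>. e2ennreal (- X \<omega>) \<partial>M)"
    using le by (intro nn_integral_mono_AE) (auto elim!: AE_mp intro!: e2ennreal_ereal_mono' simp flip: uminus_ereal.simps(1))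
  have "ext_expectation M X = enn2ereal (\<integral>\<^sup>+\<omega>. e2ennreal (X \<omega>) \<partial>M) - enn2ereal (\<integral>\<^sup>+\<omega>. e2ennreal (- X \<omega>) \<partial>M)"
    using le_less_trans[OF p integral_eq_nn_integral_diff(2)[OF h]] by (simp add: ext_expectation_def)
  also have "\<dots> \<le> enn2ereal (\<integral>\<^sup>+\<omega>. ennreal (h \<omega>) \<partial>M) - enn2ereal (\<integral>\<^sup>+\<omega>. ennreal (- h \<omega>) \<partial>M)"
    using p n by (intro ereal_minus_mono) (simp_all add: less_eq_ennreal.rep_eq)
  also have "\<dots> = ereal (\<integral>\<omega>. h \<omega> \<partial>M)" by (rule integral_eq_nn_integral_diff(1)[OF h])
  finally show ?thesis .
qed

lemma ext_expectation_ge: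
  assumes h: "integrable M h" and ge: "AE \<omega> in M. ereal (h \<omega>) \<le> X \<omega>"
  shows "ereal (\<integral>\<omega>. h \<omega> \<partial>M) \<le> ext_expectation M X"
proof (cases "(\<integral>\<^sup>+\<omega>. e2ennreal (X \<omega>) \<partial>M) < \<infinity>")
  case True
  have p: "(\<integral>\<^sup>+\<omega>. ennreal (h \<omega>) \<partial>M) \<le> (\<integral>\<^sup>+\<omega>. e2ennreal (X \<omega>) \<partial>M)"
    using ge by (intro nn_integral_mono_AE) (auto elim!: AE_mp intro!: e2ennreal_ereal_mono')
  have n: "(\<integral>\<^sup>+\<omega>. e2ennreal (- X \<omega>) \<partial>M) \<le> (\<integral>\<^sup>+\<omega>. ennreal (- h \<omega>) \<partial>M)"
    using ge by (intro nn_integral_mono_AE) (auto elim!: AE_mp intro!: e2ennreal_ereal_mono simp flip: uminus_ereal.simps(1))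
  have "ereal (\<integral>\<omega>. h \<omega> \<partial>M) = enn2ereal (\<integral>\<^sup>+\<omega>. ennreal (h \<omega>) \<partial>M) - enn2ereal (\<integral>\<^sup>+\<omega>. ennreal (- h \<omega>) \<partial>M)"
    by (rule integral_eq_nn_integral_diff(1)[OF h, symmetric])
  also have "\<dots> \<le> enn2ereal (\<integral>\<^sup>+\<omega>. e2ennreal (X \<omega>) \<partial>M) - enn2ereal (\<integral>\<^sup>+\<omega>. e2ennreal (- X \<omega>) \<partial>M)"
    using p n by (intro ereal_minus_mono) (simp_all add: less_eq_ennreal.rep_eq)
  also have "\<dots> = ext_expectation M X" using True by (simp add: ext_expectation_def)
  finally show ?thesis .
qed (simp add: ext_expectation_def)

lemma ext_expectation_eq:
  assumes "integrable M h" "AE \<omega> in M. X \<omega> = ereal (h \<omega>)"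
  shows "ext_expectation M X = ereal (\<integral>\<omega>. h \<omega> \<partial>M)"
  using assms by (intro antisym ext_expectation_le ext_expectation_ge) (auto elim: AE_mp)

text \<open>By the convention on expectations, a value below infinity means that the positive part
  is integrable; the bound is this positive part.\<close>

lemma ext_expectation_integrable_bound:
  assumes [measurable]: "X \<in> borel_measurable M" and lt: "ext_expectation M X < \<infinity>"
  obtains h :: "'w \<Rightarrow> real" where "integrable M h" "AE \<omega> in M. X \<omega> \<le> ereal (h \<omega>)"
proof -
  have fin: "(\<integral>\<^sup>+\<omega>. e2ennreal (X \<omega>) \<partial>M) < \<infinity>" using lt by (auto simp: ext_expectation_def split: if_splits)
  then have "AE \<omega> in M. e2ennreal (X \<omega>) \<noteq> \<infinity>"
    by (intro nn_integral_PInf_AE) auto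
  then have ae: "AE \<omega> in M. ennreal (enn2real (e2ennreal (X \<omega>))) = e2ennreal (X \<omega>)"
    by eventually_elim (simp add: less_top)
  show thesis
  proof (rule that[of "\<lambda>\<omega>. enn2real (e2ennreal (X \<omega>))"])
    have "(\<integral>\<^sup>+\<omega>. ennreal (enn2real (e2ennreal (X \<omega>))) \<partial>M) = (\<integral>\<^sup>+\<omega>. e2ennreal (X \<omega>) \<partial>M)"
      by (rule nn_integral_cong_AE[OF ae])
    with fin show "integrable M (\<lambda>\<omega>. enn2real (e2ennreal (X \<omega>)))"
      by (intro integrableI_nonneg) auto
    show "AE \<omega> in M. X \<omega> \<le> ereal (enn2real (e2ennreal (X \<omega>)))"
      using ae
    proof eventually_elim
      case (elim \<omega>)
      have "X \<omega> \<le> enn2ereal (e2ennreal (X \<omega>))"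
        by (cases "0 \<le> X \<omega>") (auto simp: enn2ereal_e2ennreal e2ennreal_neg zero_ennreal.rep_eq)
      also have "\<dots> = ereal (enn2real (e2ennreal (X \<omega>)))"
        by (subst elim[symmetric]) (simp add: enn2ereal_ennreal)
      finally show ?case .
    qed
  qed
qed

section \<open>Solid decomposable spaces\<close>

text \<open>Decomposability with the empty set replaces the zero function by \<open>u\<close>
  everywhere.\<close>

lemma solid_decomposable_bounded:
  assumes S: "solid_decomposable_space M S" and u: "u \<in> borel_measurable M" "\<And>\<omega>. norm (u \<omega>) \<le> c"
  shows "u \<in> S"
proof -
  have "u \<in> Linfty M" using u by (auto simp: Linfty_def)
  moreover have "(\<lambda>_. 0) \<in> S" and d: "decomposable M S"
    using S by (auto simp: solid_decomposable_space_def linear_space_def)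
  ultimately show ?thesis
    using d[unfolded decomposable_def, rule_format, of "\<lambda>_. 0" u "{}"] by simp
qed

lemma solid_decomposable_add:
  "solid_decomposable_space M S \<Longrightarrow> u \<in> S \<Longrightarrow> u' \<in> S \<Longrightarrow> (\<lambda>\<omega>. u \<omega> + u' \<omega>) \<in> S"
  by (auto simp: solid_decomposable_space_def linear_space_def)

lemma solid_decomposable_scaleR:
  "solid_decomposable_space M S \<Longrightarrow> u \<in> S \<Longrightarrow> (\<lambda>\<omega>. c *\<^sub>R u \<omega>) \<in> S"
  by (auto simp: solid_decomposable_space_def linear_space_def)

lemma solid_decomposable_measurable:
  "solid_decomposable_space M S \<Longrightarrow> u \<in> S \<Longrightarrow> u \<in> borel_measurable M"
  by (auto simp: solid_decomposable_space_def)

lemma separating_duality_sym: "separating_duality M U Y \<Longrightarrow> separating_duality M Y U"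
  unfolding separating_duality_def pairing_def by (subst (1 2 3) inner_commute) blast

lemma separating_duality_integrable:
  "separating_duality M U Y \<Longrightarrow> u \<in> U \<Longrightarrow> y \<in> Y \<Longrightarrow> integrable M (\<lambda>\<omega>. u \<omega> \<bullet> y \<omega>)"
  by (simp add: separating_duality_def)

lemma separating_duality_integrable_nth:
  assumes "solid_decomposable_space M U" "separating_duality M U Y" "y \<in> Y"
  shows "integrable M (\<lambda>\<omega>. y \<omega> $ i)"
proof -
  have "(\<lambda>_. axis i 1) \<in> U" by (rule solid_decomposable_bounded[OF assms(1), of _ 1]) (auto simp: norm_axis_1)
  from separating_duality_integrable[OF assms(2) this assms(3)] show ?thesis by (simp add: inner_axis')
qed

section \<open>The stochastic program\<close>

lemma fenchel_young:
  assumes "g z \<le> ereal a" "conj_fun g v \<le> ereal b"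
  shows "z \<bullet> v \<le> a + b"
  using assms conj_fun_le_iff[of g v b] by (force simp: epi_def)

locale stochastic_program = staged M F stage
  for M :: "'w measure" and F and stage :: "'n::finite \<Rightarrow> nat" +
  fixes f :: "'w \<Rightarrow> (real ^ 'n) \<times> (real ^ 'm::finite) \<Rightarrow> ereal"
    and X V :: "('w \<Rightarrow> real ^ 'n) set" and U Y :: "('w \<Rightarrow> real ^ 'm) set"
    and ubar :: "'w \<Rightarrow> real ^ 'm"
  assumes normal: "convex_normal_integrand M f"
    and spaces: "solid_decomposable_space M X" "solid_decomposable_space M V"
      "solid_decomposable_space M U" "solid_decomposable_space M Y"
    and duality: "separating_duality M X V" "separating_duality M U Y"
    and ubar: "ubar \<in> U"
begin

abbreviation N :: "('w \<Rightarrow> real ^ 'n) set" where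
  "N \<equiv> adapted_strategies M F stage"

abbreviation Xperp :: "('w \<Rightarrow> real ^ 'n) set" where
  "Xperp \<equiv> annihilator M V (X \<inter> N)"

lemma adapted_in_N: "x \<in> adapted \<Longrightarrow> x \<in> N"
  using adapted_measurable adapted_nth by (fastforce simp: adapted_strategies_def)

lemma N_version:
  assumes "x \<in> N"
  obtains x' where "x' \<in> adapted" "AE \<omega> in M. x \<omega> = x' \<omega>"
proof -
  obtain g where g: "\<And>i. g i \<in> borel_measurable (F (stage i))" "\<And>i. AE \<omega> in M. x \<omega> $ i = g i \<omega>"
    using assms unfolding adapted_strategies_def mem_Collect_eq by metis
  show thesis
  proof (rule that[of "\<lambda>\<omega>. \<chi> i. g i \<omega>"])
    show "(\<lambda>\<omega>. \<chi> i. g i \<omega>) \<in> adapted" using g(1) by (simp add: adapted_def)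
    have "AE \<omega> in M. \<forall>i\<in>UNIV. x \<omega> $ i = g i \<omega>" using g(2) by (intro AE_finite_allI) auto
    then show "AE \<omega> in M. x \<omega> = (\<chi> i. g i \<omega>)" by eventually_elim (simp add: vec_eq_iff)
  qed
qed

lemma ubar_measurable [measurable]: "ubar \<in> borel_measurable M"
  using solid_decomposable_measurable[OF spaces(3) ubar] .

lemma Y_measurable: "y \<in> Y \<Longrightarrow> y \<in> borel_measurable M"
  using solid_decomposable_measurable[OF spaces(4)] .

lemma Xperp_V: "p \<in> Xperp \<Longrightarrow> p \<in> V"
  by (simp add: annihilator_def)

lemma Xperp_measurable: "p \<in> Xperp \<Longrightarrow> p \<in> borel_measurable M"
  using solid_decomposable_measurable[OF spaces(2) Xperp_V] .

lemma V_integrable_nth: "p \<in> V \<Longrightarrow> integrable M (\<lambda>\<omega>. p \<omega> $ i)"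
  by (rule separating_duality_integrable_nth[OF spaces(1) duality(1)])

lemma ubar_integrable_norm: "integrable M (\<lambda>\<omega>. norm (ubar \<omega>))"
proof (rule Bochner_Integration.integrable_bound)
  have "integrable M (\<lambda>\<omega>. ubar \<omega> $ i)" for i
    using separating_duality_integrable_nth[OF spaces(4) separating_duality_sym[OF duality(2)] ubar] .
  then show "integrable M (\<lambda>\<omega>. \<Sum>i\<in>UNIV. \<bar>ubar \<omega> $ i\<bar>)" by simp
  show "AE \<omega> in M. norm (norm (ubar \<omega>)) \<le> norm (\<Sum>i\<in>UNIV. \<bar>ubar \<omega> $ i\<bar>)"
    using norm_le_l1_cart by (auto intro!: always_eventually order_trans[OF norm_le_l1_cart])
qed measurable

lemma bounded_inner_integrable:
  assumes "p \<in> V" "x \<in> borel_measurable M" "\<And>\<omega>. norm (x \<omega>) \<le> c"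
  shows "integrable M (\<lambda>\<omega>. x \<omega> \<bullet> p \<omega>)"
  using separating_duality_integrable[OF duality(1) solid_decomposable_bounded[OF spaces(1) assms(2,3)] assms(1)] .

lemma Xperp_bounded:
  assumes "p \<in> Xperp" "x \<in> adapted" "\<forall>\<omega>. norm (x \<omega>) \<le> c"
  shows "(\<integral>\<omega>. x \<omega> \<bullet> p \<omega> \<partial>M) = 0"
proof -
  have "x \<in> X" using assms(3) by (intro solid_decomposable_bounded[OF spaces(1) adapted_measurable[OF assms(2)]]) auto
  then show ?thesis using assms(1) adapted_in_N[OF assms(2)] by (auto simp: annihilator_def pairing_def)
qed

lemma Xperp_annihilates:
  assumes "p \<in> Xperp" "x \<in> adapted" "integrable M h" "AE \<omega> in M. h \<omega> \<le> x \<omega> \<bullet> p \<omega>"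
  shows "integrable M (\<lambda>\<omega>. x \<omega> \<bullet> p \<omega>)" "(\<integral>\<omega>. x \<omega> \<bullet> p \<omega> \<partial>M) = 0"
  using adapted_annihilator[OF V_integrable_nth[OF Xperp_V[OF assms(1)]] Xperp_bounded[OF assms(1)] assms(2-4)]
  by auto

lemma Xperp_annihilates_upper:
  assumes "p \<in> Xperp" "x \<in> adapted" "integrable M h" "AE \<omega> in M. x \<omega> \<bullet> p \<omega> \<le> h \<omega>"
  shows "integrable M (\<lambda>\<omega>. x \<omega> \<bullet> p \<omega>)" "(\<integral>\<omega>. x \<omega> \<bullet> p \<omega> \<partial>M) = 0"
proof -
  have "AE \<omega> in M. - h \<omega> \<le> ((- 1) *\<^sub>R x \<omega>) \<bullet> p \<omega>" using assms(4) by eventually_elim simp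
  from Xperp_annihilates[OF assms(1) adapted_scaleR[OF assms(2)] _ this] assms(3)
  show "integrable M (\<lambda>\<omega>. x \<omega> \<bullet> p \<omega>)" "(\<integral>\<omega>. x \<omega> \<bullet> p \<omega> \<partial>M) = 0" by auto
qed

text \<open>Bounded adapted strategies suffice as tests: for x in \<open>X\<close> the product x . p
  is integrable by duality, hence serves as its own lower bound in
  \<open>adapted_annihilator\<close>.\<close>

lemma XperpI:
  assumes p: "p \<in> V" and perp: "\<And>x c. x \<in> adapted \<Longrightarrow> \<forall>\<omega>. norm (x \<omega>) \<le> c \<Longrightarrow> (\<integral>\<omega>. x \<omega> \<bullet> p \<omega> \<partial>M) = 0"
  shows "p \<in> Xperp"
  unfolding annihilator_def mem_Collect_eq
proof (intro conjI p ballI)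
  fix x assume x: "x \<in> X \<inter> N"
  then obtain x' where x': "x' \<in> adapted" "AE \<omega> in M. x \<omega> = x' \<omega>" using N_version by blast
  have [measurable]: "x \<in> borel_measurable M" "p \<in> borel_measurable M" "x' \<in> borel_measurable M"
    using x p x' solid_decomposable_measurable[OF spaces(1)] solid_decomposable_measurable[OF spaces(2)] adapted_measurable by auto
  have ae: "AE \<omega> in M. x \<omega> \<bullet> p \<omega> = x' \<omega> \<bullet> p \<omega>" using x'(2) by eventually_elim simp
  have "integrable M (\<lambda>\<omega>. x \<omega> \<bullet> p \<omega>)" using x p by (intro separating_duality_integrable[OF duality(1)]) auto
  then have "integrable M (\<lambda>\<omega>. x' \<omega> \<bullet> p \<omega>)"
    by (rule integrable_cong_AE_imp) (use ae in \<open>auto elim: AE_mp\<close>)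
  from adapted_annihilator(2)[OF V_integrable_nth[OF p] perp x'(1) this]
  have "(\<integral>\<omega>. x' \<omega> \<bullet> p \<omega> \<partial>M) = 0" by simp
  then show "pairing M x p = 0"
    unfolding pairing_def using integral_cong_AE[OF _ _ ae] by simp
qed

lemma Xperp_scaleR: "p \<in> Xperp \<Longrightarrow> (\<lambda>\<omega>. c *\<^sub>R p \<omega>) \<in> Xperp"
  using solid_decomposable_scaleR[OF spaces(2)] by (auto simp: annihilator_def pairing_def)

lemma measurable_primal [measurable]:
  "x \<in> borel_measurable M \<Longrightarrow> (\<lambda>\<omega>. f \<omega> (x \<omega>, ubar \<omega>)) \<in> borel_measurable M"
  by (intro borel_measurable_normal_integrand[OF normal] borel_measurable_Pair) auto

lemma measurable_conj:
  "p \<in> borel_measurable M \<Longrightarrow> y \<in> borel_measurable M \<Longrightarrow> (\<lambda>\<omega>. conj_fun (f \<omega>) (p \<omega>, y \<omega>)) \<in> borel_measurable M"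
  by (intro borel_measurable_conj_fun[OF normal] borel_measurable_Pair) auto

lemma primal_obj_cong: "AE \<omega> in M. x \<omega> = x' \<omega> \<Longrightarrow> primal_obj M f ubar x = primal_obj M f ubar x'"
  unfolding primal_obj_def integral_functional_def by (rule ext_expectation_cong_AE) (auto elim: AE_mp)

text \<open>The Fenchel-Young inequality first bounds x . p above, so that it is integrable with
  mean 0. Read again, it bounds each of the two values from below by integrable functions, which
  makes both integrable.\<close>

lemma feasible_pair:
  assumes x: "x \<in> adapted" "primal_obj M f ubar x < \<infinity>"
    and p: "p \<in> Xperp" and y: "y \<in> Y" and conj: "conj_obj M f p y < \<infinity>"
  obtains fx fs where "integrable M fx" "AE \<omega> in M. f \<omega> (x \<omega>, ubar \<omega>) = ereal (fx \<omega>)"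
    "integrable M fs" "AE \<omega> in M. conj_fun (f \<omega>) (p \<omega>, y \<omega>) = ereal (fs \<omega>)"
    "integrable M (\<lambda>\<omega>. x \<omega> \<bullet> p \<omega>)" "(\<integral>\<omega>. x \<omega> \<bullet> p \<omega> \<partial>M) = 0"
proof -
  have [measurable]: "x \<in> borel_measurable M" "p \<in> borel_measurable M" "y \<in> borel_measurable M"
    using adapted_measurable[OF x(1)] Xperp_measurable[OF p] Y_measurable[OF y] .
  have [measurable]: "(\<lambda>\<omega>. conj_fun (f \<omega>) (p \<omega>, y \<omega>)) \<in> borel_measurable M" by (rule measurable_conj) measurable
  have uy: "integrable M (\<lambda>\<omega>. ubar \<omega> \<bullet> y \<omega>)" by (rule separating_duality_integrable[OF duality(2) ubar y])
  obtain h where h: "integrable M h" "AE \<omega> in M. f \<omega> (x \<omega>, ubar \<omega>) \<le> ereal (h \<omega>)"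
    using ext_expectation_integrable_bound[OF measurable_primal x(2)[unfolded primal_obj_def integral_functional_def]] by auto
  obtain h' where h': "integrable M h'" "AE \<omega> in M. conj_fun (f \<omega>) (p \<omega>, y \<omega>) \<le> ereal (h' \<omega>)"
    using ext_expectation_integrable_bound[OF measurable_conj conj[unfolded conj_obj_def integral_functional_def]] by auto
  have "AE \<omega> in M. x \<omega> \<bullet> p \<omega> \<le> h \<omega> + h' \<omega> - ubar \<omega> \<bullet> y \<omega>"
    using h(2) h'(2)
  proof eventually_elim
    case (elim \<omega>)
    from fenchel_young[OF elim] show ?case by simp
  qed
  from Xperp_annihilates_upper[OF p x(1) _ this] h(1) h'(1) uy
  have xp: "integrable M (\<lambda>\<omega>. x \<omega> \<bullet> p \<omega>)" "(\<integral>\<omega>. x \<omega> \<bullet> p \<omega> \<partial>M) = 0" by auto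
  define fx where "fx \<omega> = real_of_ereal (f \<omega> (x \<omega>, ubar \<omega>))" for \<omega>
  define fs where "fs \<omega> = real_of_ereal (conj_fun (f \<omega>) (p \<omega>, y \<omega>))" for \<omega>
  have [measurable]: "fx \<in> borel_measurable M" "fs \<in> borel_measurable M" unfolding fx_def fs_def by measurable
  have ae: "AE \<omega> in M. f \<omega> (x \<omega>, ubar \<omega>) = ereal (fx \<omega>) \<and> conj_fun (f \<omega>) (p \<omega>, y \<omega>) = ereal (fs \<omega>) \<and>
    fx \<omega> \<le> h \<omega> \<and> fs \<omega> \<le> h' \<omega> \<and> x \<omega> \<bullet> p \<omega> + ubar \<omega> \<bullet> y \<omega> \<le> fx \<omega> + fs \<omega>"
    using h(2) h'(2)
  proof eventually_elim
    case (elim \<omega>)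
    have "f \<omega> (x \<omega>, ubar \<omega>) \<noteq> - \<infinity>"
    proof
      assume *: "f \<omega> (x \<omega>, ubar \<omega>) = - \<infinity>"
      \<comment> \<open>With value minus infinity any height may be inserted; this one contradicts
        the Fenchel-Young inequality by 1.\<close>
      have "(x \<omega>, ubar \<omega>) \<bullet> (p \<omega>, y \<omega>) \<le> ((x \<omega>, ubar \<omega>) \<bullet> (p \<omega>, y \<omega>) - h' \<omega> - 1) + h' \<omega>"
        by (rule fenchel_young[OF _ elim(2)]) (simp add: *)
      then show False by simp
    qed
    then have 1: "f \<omega> (x \<omega>, ubar \<omega>) = ereal (fx \<omega>)" unfolding fx_def using elim(1)
      by (cases "f \<omega> (x \<omega>, ubar \<omega>)") auto
    have "ereal ((x \<omega>, ubar \<omega>) \<bullet> (p \<omega>, y \<omega>)) - f \<omega> (x \<omega>, ubar \<omega>) \<le> conj_fun (f \<omega>) (p \<omega>, y \<omega>)"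
      unfolding conj_fun_def by (rule SUP_upper) simp
    then have 2: "conj_fun (f \<omega>) (p \<omega>, y \<omega>) = ereal (fs \<omega>)" unfolding fs_def using elim(2)
      by (cases "conj_fun (f \<omega>) (p \<omega>, y \<omega>)") (auto simp: 1)
    show ?case using elim fenchel_young[of "f \<omega>" "(x \<omega>, ubar \<omega>)" "fx \<omega>" "(p \<omega>, y \<omega>)" "fs \<omega>"] by (simp add: 1 2)
  qed
  have "integrable M (\<lambda>\<omega>. \<bar>h \<omega>\<bar> + \<bar>h' \<omega>\<bar> + \<bar>x \<omega> \<bullet> p \<omega>\<bar> + \<bar>ubar \<omega> \<bullet> y \<omega>\<bar>)"
    using h(1) h'(1) uy xp(1) by auto
  then have "integrable M fx" "integrable M fs"
    by (rule Bochner_Integration.integrable_bound; use ae in \<open>(auto elim!: AE_mp)\<close>)+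
  then show thesis using ae xp by (intro that[of fx fs]) (auto elim: AE_mp)
qed

theorem weak_duality:
  assumes x: "x \<in> N" and p: "p \<in> Xperp" and y: "y \<in> Y"
  shows "dual_obj M f ubar p y \<le> primal_obj M f ubar x"
proof (cases "primal_obj M f ubar x < \<infinity> \<and> conj_obj M f p y < \<infinity>")
  case True
  obtain x' where x': "x' \<in> adapted" "AE \<omega> in M. x \<omega> = x' \<omega>" using N_version[OF x] .
  have eq: "primal_obj M f ubar x = primal_obj M f ubar x'" by (rule primal_obj_cong[OF x'(2)])
  obtain fx fs where fx: "integrable M fx" "AE \<omega> in M. f \<omega> (x' \<omega>, ubar \<omega>) = ereal (fx \<omega>)"
    and fs: "integrable M fs" "AE \<omega> in M. conj_fun (f \<omega>) (p \<omega>, y \<omega>) = ereal (fs \<omega>)"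
    and xp: "integrable M (\<lambda>\<omega>. x' \<omega> \<bullet> p \<omega>)" "(\<integral>\<omega>. x' \<omega> \<bullet> p \<omega> \<partial>M) = 0"
    by (rule feasible_pair[OF x'(1) _ p y]) (use True eq in auto)
  have uy: "integrable M (\<lambda>\<omega>. ubar \<omega> \<bullet> y \<omega>)" by (rule separating_duality_integrable[OF duality(2) ubar y])
  have "(\<integral>\<omega>. x' \<omega> \<bullet> p \<omega> + ubar \<omega> \<bullet> y \<omega> \<partial>M) \<le> (\<integral>\<omega>. fx \<omega> + fs \<omega> \<partial>M)"
  proof (rule integral_mono_AE)
    show "AE \<omega> in M. x' \<omega> \<bullet> p \<omega> + ubar \<omega> \<bullet> y \<omega> \<le> fx \<omega> + fs \<omega>"
      using fx(2) fs(2)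
    proof eventually_elim
      case (elim \<omega>)
      from fenchel_young[of "f \<omega>" "(x' \<omega>, ubar \<omega>)" "fx \<omega>" "(p \<omega>, y \<omega>)" "fs \<omega>"] elim show ?case by simp
    qed
  qed (use fx fs xp uy in auto)
  then show ?thesis
    using fx fs xp uy eq unfolding dual_obj_def primal_obj_def conj_obj_def integral_functional_def pairing_def
    by (simp add: ext_expectation_eq[OF fx] ext_expectation_eq[OF fs])
next
  case False
  then show ?thesis by (auto simp: dual_obj_def)
qed

end

section \<open>Two facts on one-sided bounds for real multiples\<close>

lemma le_0_of_bounded_multiples:
  fixes a b :: real
  assumes "\<And>c. 0 < c \<Longrightarrow> c * a \<le> b"
  shows "a \<le> 0"
proof (rule ccontr)
  assume "\<not> a \<le> 0"
  then have "0 < a" by simp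
  then have "(\<bar>b\<bar> + 1) / a * a \<le> b" by (intro assms) simp
  then show False using \<open>0 < a\<close> by simp
qed

lemma linear_term_nonneg:
  fixes a b :: real
  assumes "\<And>t. 0 < t \<Longrightarrow> t \<le> 1 \<Longrightarrow> 0 \<le> t * a + t\<^sup>2 * b"
  shows "0 \<le> a"
proof (rule ccontr)
  assume "\<not> 0 \<le> a"
  \<comment> \<open>A step so small that t * b is at most half of - a.\<close>
  define t where "t = min 1 (- a / (2 * (\<bar>b\<bar> + 1)))"
  have "0 < - a / (2 * (\<bar>b\<bar> + 1))" using \<open>\<not> 0 \<le> a\<close> by (intro divide_pos_pos) auto
  then have t: "0 < t" "t \<le> 1" unfolding t_def by simp_all
  have "t * b \<le> t * (\<bar>b\<bar> + 1)" using t by (intro mult_left_mono) auto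
  also have "\<dots> \<le> - a / (2 * (\<bar>b\<bar> + 1)) * (\<bar>b\<bar> + 1)" by (intro mult_right_mono) (auto simp: t_def)
  also have "\<dots> = - a / 2" by (simp add: field_simps)
  finally have "a + t * b < 0" using \<open>\<not> 0 \<le> a\<close> by simp
  then have "t * (a + t * b) < 0" using t(1) by (rule mult_pos_neg[rotated])
  moreover have "0 \<le> t * (a + t * b)" using assms[OF t] by (simp add: power2_eq_square algebra_simps)
  ultimately show False by simp
qed

section \<open>The penalized problems\<close>

text \<open>Real integrable data drawn from the hypotheses: a feasible strategy \<open>xh\<close>, a
  dual point (p, y) of finite value, and conjugate bounds at the multipliers 1 + \<epsilon> and 1 -
  \<epsilon>.\<close>

locale dual_feasible_program = stochastic_program M F stage f X V U Y ubar
  for M :: "'w measure" and F and stage :: "'n::finite \<Rightarrow> nat"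
    and f :: "'w \<Rightarrow> (real ^ 'n) \<times> (real ^ 'm::finite) \<Rightarrow> ereal" and X V U Y ubar +
  fixes p y \<theta> xh fh \<epsilon> y1 y2 \<theta>1 \<theta>2
  assumes p: "p \<in> Xperp" and y: "y \<in> Y"
    and \<theta>: "integrable M \<theta>" "AE \<omega> in M. conj_fun (f \<omega>) (p \<omega>, y \<omega>) = ereal (\<theta> \<omega>)"
    and xh: "xh \<in> adapted" "integrable M (\<lambda>\<omega>. xh \<omega> \<bullet> p \<omega>)"
    and fh: "integrable M fh" "AE \<omega> in M. f \<omega> (xh \<omega>, ubar \<omega>) = ereal (fh \<omega>)"
    and \<epsilon>: "0 < (\<epsilon>::real)" and y12: "y1 \<in> Y" "y2 \<in> Y"
    and \<theta>1: "integrable M \<theta>1" "AE \<omega> in M. conj_fun (f \<omega>) ((1 + \<epsilon>) *\<^sub>R p \<omega>, y1 \<omega>) \<le> ereal (\<theta>1 \<omega>)"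
    and \<theta>2: "integrable M \<theta>2" "AE \<omega> in M. conj_fun (f \<omega>) ((1 - \<epsilon>) *\<^sub>R p \<omega>, y2 \<omega>) \<le> ereal (\<theta>2 \<omega>)"
    and recession: "linear_space {x \<in> N. AE \<omega> in M. recession_fun (f \<omega>) (x \<omega>, 0) \<le> 0}"
begin

definition q :: "'w \<Rightarrow> (real ^ 'n) \<times> (real ^ 'm)" where "q \<omega> = (p \<omega>, y \<omega>)"

definition a :: "'w \<Rightarrow> (real ^ 'n) \<times> (real ^ 'm)" where "a \<omega> = (0, ubar \<omega>)"

definition J :: "real ^ 'n \<Rightarrow> (real ^ 'n) \<times> (real ^ 'm)" where "J z = (z, 0)"

text \<open>The epigraph of \<open>f\<close> after subtraction of the affine minorant with slope \<open>q\<close>; its elements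
  have nonnegative height.\<close>

definition C :: "'w \<Rightarrow> (((real ^ 'n) \<times> (real ^ 'm)) \<times> real) set" where
  "C \<omega> = {(e, r). f \<omega> e \<le> ereal (r + e \<bullet> q \<omega> - \<theta> \<omega>)}"

text \<open>The weight makes every \<open>xh \<bullet> g\<close> with \<open>norm g \<le> \<kappa> * v\<close> integrable, although \<open>xh\<close> itself
  need not be.\<close>

definition v :: "'w \<Rightarrow> real" where "v \<omega> = 1 / (1 + norm (xh \<omega>))"

text \<open>The excess of f over its affine minorant at the feasible point. It is nonnegative only
  almost everywhere; the maximum makes it so at every point, as \<open>admissible\<close>
  demands.\<close>

definition rh :: "'w \<Rightarrow> real" where "rh \<omega> = max 0 (fh \<omega> - (J (xh \<omega>) + a \<omega>) \<bullet> q \<omega> + \<theta> \<omega>)"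

text \<open>The value of f is carried by the epigraph variable r, so that costs are real and
  convexity of \<open>C\<close> passes to admissible triples.\<close>

definition admissible where
  "admissible x \<zeta> r \<longleftrightarrow> x \<in> adapted \<and> \<zeta> \<in> borel_measurable M \<and> r \<in> borel_measurable M \<and>
    (\<forall>\<omega>. 0 \<le> r \<omega>) \<and> (AE \<omega> in M. (a \<omega> + J (x \<omega>) + \<zeta> \<omega>, r \<omega>) \<in> C \<omega>)"

definition cost :: "real \<Rightarrow> ('w \<Rightarrow> (real ^ 'n) \<times> (real ^ 'm)) \<Rightarrow> ('w \<Rightarrow> real) \<Rightarrow> ennreal" where
  "cost \<kappa> \<zeta> r = (\<integral>\<^sup>+\<omega>. ennreal (r \<omega> + \<kappa> * (v \<omega> * soft (\<zeta> \<omega>))) \<partial>M)"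

lemma linear_J: "linear J"
  by (rule linearI) (simp_all add: J_def)

lemma J_inner: "J z \<bullet> w = z \<bullet> fst w"
  by (cases w) (simp add: J_def)

lemma measurables [measurable]:
  "p \<in> borel_measurable M" "y \<in> borel_measurable M" "\<theta> \<in> borel_measurable M" "xh \<in> borel_measurable M"
  "fh \<in> borel_measurable M" "q \<in> borel_measurable M" "a \<in> borel_measurable M" "v \<in> borel_measurable M"
  "J \<in> borel_measurable borel" "rh \<in> borel_measurable M"
proof -
  show [measurable]: "p \<in> borel_measurable M" "y \<in> borel_measurable M" "\<theta> \<in> borel_measurable M" "xh \<in> borel_measurable M"
    "fh \<in> borel_measurable M"
    using Xperp_measurable[OF p] Y_measurable[OF y] adapted_measurable[OF xh(1)] \<theta>(1) fh(1) by auto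
  show [measurable]: "q \<in> borel_measurable M" "a \<in> borel_measurable M"
    unfolding q_def a_def by (intro borel_measurable_Pair; measurable)+
  show "v \<in> borel_measurable M" unfolding v_def by measurable
  show [measurable]: "J \<in> borel_measurable borel"
    unfolding J_def[abs_def] by (intro borel_measurable_continuous_onI continuous_intros)
  show "rh \<in> borel_measurable M" unfolding rh_def by measurable
qed

lemma v01: "0 < v \<omega>" "v \<omega> \<le> 1"
  by (auto simp: v_def add_pos_nonneg)

lemma C_closed_convex:
  assumes "\<omega> \<in> space M"
  shows "closed (C \<omega>) \<and> convex (C \<omega>)"
proof -
  have f: "closed (epi (f \<omega>))" "convex (epi (f \<omega>))"
    using normal assms by (auto simp: convex_normal_integrand_def closed_fun_def convex_fun_def intro: lsc_fun_closed_epi)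
  let ?h = "\<lambda>z. (fst z, snd z + fst z \<bullet> q \<omega> - \<theta> \<omega>)"
  have C: "C \<omega> = ?h -` epi (f \<omega>)" by (auto simp: C_def epi_def)
  have "closed (C \<omega>)" unfolding C using f(1) by (intro closed_vimage continuous_intros)
  moreover have "convex (C \<omega>)"
  proof (rule convexI)
    fix z w and u t :: real assume zw: "z \<in> C \<omega>" "w \<in> C \<omega>" and ut: "0 \<le> u" "0 \<le> t" "u + t = 1"
    have "u *\<^sub>R ?h z + t *\<^sub>R ?h w \<in> epi (f \<omega>)" using zw unfolding C by (intro convexD[OF f(2)] ut) simp_all
    also have "u *\<^sub>R ?h z + t *\<^sub>R ?h w = ?h (u *\<^sub>R z + t *\<^sub>R w)"
      using ut by (simp add: algebra_simps inner_add_left) (metis distrib_right mult_1)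
    finally show "u *\<^sub>R z + t *\<^sub>R w \<in> C \<omega>" unfolding C by simp
  qed
  ultimately show ?thesis by simp
qed

lemma C_nonneg: "AE \<omega> in M. \<forall>(e, r)\<in>C \<omega>. 0 \<le> r"
  using \<theta>(2)
proof eventually_elim
  case (elim \<omega>)
  show ?case
  proof safe
    fix e r assume "(e, r) \<in> C \<omega>"
    then have "e \<bullet> (p \<omega>, y \<omega>) \<le> (r + e \<bullet> q \<omega> - \<theta> \<omega>) + \<theta> \<omega>"
      using elim by (intro fenchel_young[of "f \<omega>"]) (auto simp: C_def)
    then show "0 \<le> r" by (simp add: q_def)
  qed
qed

text \<open>Along a direction d of recession of \<open>C\<close>, f grows at most with slope d . p.
  Comparison with the minorants of slopes (1 + \<epsilon>) p and (1 - \<epsilon>) p gives d . p = 0.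
  Hence d is a direction of recession of f itself, the linearity hypothesis supplies - d, and the
  tilt again contributes nothing.\<close>

lemma C_recession_symmetric:
  assumes d: "d \<in> adapted" and dC: "AE \<omega> in M. ((J (d \<omega>), 0), 0) \<in> pcone (C \<omega>)"
  shows "AE \<omega> in M. ((- J (d \<omega>), 0), 0) \<in> pcone (C \<omega>)"
proof -
  \<comment> \<open>The base point is the very one selected inside \<open>recession_fun\<close>, so
    its value can be unfolded directly.\<close>
  let ?good = "\<lambda>\<omega> z0 \<alpha>. z0 = (SOME z. z \<in> edom (f \<omega>)) \<and> f \<omega> z0 = ereal \<alpha> \<and> (\<forall>e. f \<omega> e \<noteq> - \<infinity>)"
  have base: "AE \<omega> in M. \<exists>z0 \<alpha>. ?good \<omega> z0 \<alpha>"
    using \<theta>(2) fh(2)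
  proof eventually_elim
    case (elim \<omega>)
    have nm: "f \<omega> e \<noteq> - \<infinity>" for e
    proof
      assume "f \<omega> e = - \<infinity>"
      then have "e \<bullet> (p \<omega>, y \<omega>) \<le> (e \<bullet> (p \<omega>, y \<omega>) - \<theta> \<omega> - 1) + \<theta> \<omega>"
        using elim by (intro fenchel_young[of "f \<omega>"]) auto
      then show False by simp
    qed
    have "(xh \<omega>, ubar \<omega>) \<in> edom (f \<omega>)" using elim by (simp add: edom_def)
    then have "(SOME z. z \<in> edom (f \<omega>)) \<in> edom (f \<omega>)" by (rule someI)
    then have "f \<omega> (SOME z. z \<in> edom (f \<omega>)) < \<infinity>" by (simp add: edom_def)
    with nm[of "SOME z. z \<in> edom (f \<omega>)"] show ?case
      using nm by (cases "f \<omega> (SOME z. z \<in> edom (f \<omega>))") auto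
  qed
  have 1: "AE \<omega> in M. d \<omega> \<bullet> p \<omega> = 0 \<and> recession_fun (f \<omega>) (d \<omega>, 0) \<le> 0"
    using base \<theta>1(2) \<theta>2(2) dC AE_space
  proof eventually_elim
    case (elim \<omega>)
    obtain z0 \<alpha> where S: "(SOME z. z \<in> edom (f \<omega>)) = z0" and fz: "f \<omega> z0 = ereal \<alpha>" and nm: "\<And>e. f \<omega> e \<noteq> - \<infinity>"
      using elim(1) by blast
    have cc: "closed (C \<omega>)" "convex (C \<omega>)" using C_closed_convex elim by auto
    have zC: "(z0, \<alpha> - z0 \<bullet> q \<omega> + \<theta> \<omega>) \<in> C \<omega>" by (simp add: C_def fz)
    have ray: "f \<omega> (z0 + c *\<^sub>R J (d \<omega>)) \<le> ereal (\<alpha> + c * (d \<omega> \<bullet> p \<omega>))" if "0 < c" for c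
      using pcone_0_imp[OF cc elim(4) zC, of c] that
      by (simp add: C_def inner_add_left J_inner q_def[of \<omega>])
    \<comment> \<open>On the ray the height grows with slope d . p and the minorant with slope s
      times d . p; the left side is c times the difference of slopes and has to stay bounded as c
      grows.\<close>
    have bound: "c * ((s - 1) * (d \<omega> \<bullet> p \<omega>)) \<le> \<alpha> + t - z0 \<bullet> (s *\<^sub>R p \<omega>, w)"
      if "conj_fun (f \<omega>) (s *\<^sub>R p \<omega>, w) \<le> ereal t" "0 < c" for s w t c
      using fenchel_young[OF ray[OF that(2)] that(1)] by (simp add: inner_add_left J_inner algebra_simps)
    have "\<epsilon> * (d \<omega> \<bullet> p \<omega>) \<le> 0"
      by (rule le_0_of_bounded_multiples) (use bound[OF elim(2)] in simp)
    moreover have "- \<epsilon> * (d \<omega> \<bullet> p \<omega>) \<le> 0"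
      by (rule le_0_of_bounded_multiples) (use bound[OF elim(3)] in simp)
    ultimately have dp: "d \<omega> \<bullet> p \<omega> = 0" using \<epsilon> by (auto simp: mult_le_0_iff zero_le_mult_iff)
    have "recession_fun (f \<omega>) (d \<omega>, 0) \<le> 0"
      unfolding recession_fun_def Let_def
    proof (rule SUP_least)
      fix c :: real assume "c \<in> {0<..}"
      then have c: "0 < c" by simp
      obtain \<beta> where \<beta>: "f \<omega> (z0 + c *\<^sub>R J (d \<omega>)) = ereal \<beta>" "\<beta> \<le> \<alpha>"
        using ray[OF c] nm[of "z0 + c *\<^sub>R J (d \<omega>)"] dp by (cases "f \<omega> (z0 + c *\<^sub>R J (d \<omega>))") auto
      then show "(f \<omega> ((SOME z0. z0 \<in> edom (f \<omega>)) + c *\<^sub>R (d \<omega>, 0)) - f \<omega> (SOME z0. z0 \<in> edom (f \<omega>))) / ereal c \<le> 0"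
        using c by (simp add: S fz J_def divide_nonpos_pos)
    qed
    with dp show ?case by simp
  qed
  then have "d \<in> {x \<in> N. AE \<omega> in M. recession_fun (f \<omega>) (x \<omega>, 0) \<le> 0}"
    using adapted_in_N[OF d] by (auto elim: AE_mp)
  then have "(\<lambda>\<omega>. (- 1) *\<^sub>R d \<omega>) \<in> {x \<in> N. AE \<omega> in M. recession_fun (f \<omega>) (x \<omega>, 0) \<le> 0}"
    using recession unfolding linear_space_def by blast
  then have 2: "AE \<omega> in M. recession_fun (f \<omega>) (- d \<omega>, 0) \<le> 0" by simp
  show ?thesis
    using base 1 2
  proof eventually_elim
    case (elim \<omega>)
    obtain z0 \<alpha> where S: "(SOME z. z \<in> edom (f \<omega>)) = z0" and fz: "f \<omega> z0 = ereal \<alpha>" and nm: "\<And>e. f \<omega> e \<noteq> - \<infinity>"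
      using elim(1) by blast
    have zC: "(z0, \<alpha> - z0 \<bullet> q \<omega> + \<theta> \<omega>) \<in> C \<omega>" by (simp add: C_def fz)
    show ?case
    proof (rule pcone_0I[OF zC])
      fix c :: real assume c: "0 < c"
      have "(f \<omega> (z0 + c *\<^sub>R (- d \<omega>, 0)) - f \<omega> z0) / ereal c \<le> 0"
        using elim(3) c unfolding recession_fun_def Let_def S by (auto simp: SUP_le_iff)
      then have "f \<omega> (z0 + c *\<^sub>R (- d \<omega>, 0)) \<le> ereal \<alpha>"
        using nm[of "z0 + c *\<^sub>R (- d \<omega>, 0)"] c fz by (cases "f \<omega> (z0 + c *\<^sub>R (- d \<omega>, 0))") (auto simp: divide_le_0_iff)
      moreover have "z0 + c *\<^sub>R (- d \<omega>, 0) = z0 - c *\<^sub>R J (d \<omega>)" by (simp add: J_def)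
      ultimately show "(z0, \<alpha> - z0 \<bullet> q \<omega> + \<theta> \<omega>) + c *\<^sub>R (- J (d \<omega>), 0) \<in> C \<omega>"
        using elim(2) by (simp add: C_def inner_diff_left J_inner q_def[of \<omega>])
    qed
  qed
qed

section \<open>Existence of minimizers for each penalty weight\<close>

lemma penalized_compactness:
  assumes "\<And>k. admissible (x k) (\<zeta> k) (r k)" "\<And>k. cost 1 (\<zeta> k) (r k) \<le> B" "B < \<infinity>"
  obtains x' \<zeta>' r' where "admissible x' \<zeta>' r'"
    "\<And>\<kappa> b. 0 \<le> \<kappa> \<Longrightarrow> \<forall>\<^sub>F k in sequentially. cost \<kappa> (\<zeta> k) (r k) \<le> b \<Longrightarrow> cost \<kappa> \<zeta>' r' \<le> b"
proof -
  note adm = assms(1)[unfolded admissible_def]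
  have CC: "AE \<omega> in M. closed (C \<omega>) \<and> convex (C \<omega>)" using C_closed_convex by (intro AE_I2)
  have B: "(\<integral>\<^sup>+\<omega>. ennreal (r k \<omega> + v \<omega> * soft (\<zeta> k \<omega>)) \<partial>M) \<le> B" for k
    using assms(2)[of k] by (simp add: cost_def)
  show thesis
    by (rule strategy_compactness[OF linear_J CC C_recession_symmetric measurables(8) v01, of x \<zeta> r a B])
      (use adm B assms(3) in \<open>auto simp: cost_def admissible_def intro!: that\<close>)
qed

lemma rh_integrable: "integrable M rh"
proof -
  have "integrable M (\<lambda>\<omega>. xh \<omega> \<bullet> p \<omega> + ubar \<omega> \<bullet> y \<omega>)"
    using xh(2) separating_duality_integrable[OF duality(2) ubar y] by auto
  then have "integrable M (\<lambda>\<omega>. (J (xh \<omega>) + a \<omega>) \<bullet> q \<omega>)" by (simp add: J_def a_def q_def)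
  then show ?thesis unfolding rh_def using fh(1) \<theta>(1) by auto
qed

lemma rh_nonneg: "0 \<le> rh \<omega>"
  by (simp add: rh_def)

lemma feasible_admissible: "admissible xh (\<lambda>_. 0) rh"
proof -
  have "AE \<omega> in M. (a \<omega> + J (xh \<omega>) + 0, rh \<omega>) \<in> C \<omega>"
    using fh(2)
  proof eventually_elim
    case (elim \<omega>)
    have "fh \<omega> \<le> rh \<omega> + (J (xh \<omega>) + a \<omega>) \<bullet> q \<omega> - \<theta> \<omega>" by (simp add: rh_def)
    moreover have "a \<omega> + J (xh \<omega>) + 0 = (xh \<omega>, ubar \<omega>)" by (simp add: a_def J_def)
    ultimately show ?case using elim by (simp add: C_def add.commute)
  qed
  then show ?thesis using xh(1) by (simp add: admissible_def rh_def)
qed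

lemma cost_mono:
  assumes "\<kappa> \<le> \<kappa>'" shows "cost \<kappa> \<zeta> r \<le> cost \<kappa>' \<zeta> r"
  unfolding cost_def
  by (intro nn_integral_mono ennreal_leI add_left_mono mult_right_mono assms mult_nonneg_nonneg soft_nonneg less_imp_le[OF v01(1)])

lemma cost_feasible: "cost \<kappa> (\<lambda>_. 0) rh = ennreal (\<integral>\<omega>. rh \<omega> \<partial>M)"
  unfolding cost_def using nn_integral_eq_integral[OF rh_integrable] by (simp add: rh_nonneg)

lemma minimizer_exists:
  assumes "1 \<le> \<kappa>"
  obtains x \<zeta> r where "admissible x \<zeta> r" "cost \<kappa> \<zeta> r < \<infinity>"
    "\<And>x' \<zeta>' r'. admissible x' \<zeta>' r' \<Longrightarrow> cost \<kappa> \<zeta> r \<le> cost \<kappa> \<zeta>' r'"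
proof -
  let ?S = "{cost \<kappa> \<zeta> r | x \<zeta> r. admissible x \<zeta> r}"
  define m where "m = Inf ?S"
  have "m \<le> ennreal (\<integral>\<omega>. rh \<omega> \<partial>M)"
    unfolding m_def using feasible_admissible by (intro Inf_lower) (force simp: cost_feasible)
  then have mfin: "m < \<infinity>" by (simp add: le_less_trans)
  have "\<exists>x \<zeta> r. admissible x \<zeta> r \<and> cost \<kappa> \<zeta> r < m + ennreal (1 / real (Suc k))" for k
  proof -
    have "m < m + ennreal (1 / real (Suc k))" using mfin ennreal_add_left_cancel_less[of m 0 "ennreal (1 / real (Suc k))"] by simp
    then obtain s where "s \<in> ?S" "s < m + ennreal (1 / real (Suc k))" unfolding m_def Inf_less_iff by blast
    then show ?thesis by blast
  qed
  then obtain x \<zeta> r where seq: "\<And>k. admissible (x k) (\<zeta> k) (r k)"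
    "\<And>k. cost \<kappa> (\<zeta> k) (r k) < m + ennreal (1 / real (Suc k))" by metis
  \<comment> \<open>Compactness is stated for weight 1, whose costs are dominated since \<kappa> is
    at least 1.\<close>
  have le1: "cost 1 (\<zeta> k) (r k) \<le> m + 1" for k
  proof -
    have "cost 1 (\<zeta> k) (r k) \<le> m + ennreal (1 / real (Suc k))"
      using cost_mono[OF assms] seq(2)[of k] by (meson le_less_trans less_imp_le)
    also have "\<dots> \<le> m + ennreal 1" by (intro add_left_mono ennreal_leI) simp
    finally show ?thesis by simp
  qed
  have m1: "m + 1 < \<infinity>" using mfin by (simp add: ennreal_add_less_top)
  obtain x' \<zeta>' r' where adm: "admissible x' \<zeta>' r'"
    and lim: "\<And>\<kappa> b. 0 \<le> \<kappa> \<Longrightarrow> \<forall>\<^sub>F k in sequentially. cost \<kappa> (\<zeta> k) (r k) \<le> b \<Longrightarrow> cost \<kappa> \<zeta>' r' \<le> b"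
    by (rule penalized_compactness[of x \<zeta> r "m + 1", OF seq(1) le1 m1]) (rule that)
  have "cost \<kappa> \<zeta>' r' \<le> m"
  proof (rule ennreal_le_epsilon)
    fix e :: real assume "0 < e"
    then obtain n where n: "1 / real (Suc n) < e" using nat_approx_posE by blast
    show "cost \<kappa> \<zeta>' r' \<le> m + ennreal e"
    proof (rule lim)
      have "cost \<kappa> (\<zeta> k) (r k) \<le> m + ennreal e" if "n \<le> k" for k
      proof -
        have "1 / real (Suc k) \<le> 1 / real (Suc n)" using that by (intro divide_left_mono) auto
        then have "m + ennreal (1 / real (Suc k)) \<le> m + ennreal e" using n by (intro add_left_mono ennreal_leI) simp
        then show ?thesis by (rule order_trans[OF less_imp_le[OF seq(2)]])
      qed
      then show "\<forall>\<^sub>F k in sequentially. cost \<kappa> (\<zeta> k) (r k) \<le> m + ennreal e"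
        by (auto simp: eventually_sequentially)
    qed (use assms in simp)
  qed
  show thesis
  proof (rule that[OF adm])
    show "cost \<kappa> \<zeta>' r' < \<infinity>" using \<open>cost \<kappa> \<zeta>' r' \<le> m\<close> mfin by simp
    show "cost \<kappa> \<zeta>' r' \<le> cost \<kappa> \<zeta>'' r''" if "admissible x'' \<zeta>'' r''" for x'' \<zeta>'' r''
    proof -
      have "m \<le> cost \<kappa> \<zeta>'' r''" unfolding m_def using that by (intro Inf_lower) blast
      with \<open>cost \<kappa> \<zeta>' r' \<le> m\<close> show ?thesis by simp
    qed
  qed
qed

text \<open>The negative gradient of the penalty at a minimizer is a feasible correction of \<open>q\<close>.\<close>

lemma near_optimal_dual:
  assumes \<kappa>: "1 \<le> \<kappa>" and adm: "admissible x \<zeta> r" and fin: "cost \<kappa> \<zeta> r < \<infinity>"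
    and min: "\<And>x' \<zeta>' r'. admissible x' \<zeta>' r' \<Longrightarrow> cost \<kappa> \<zeta> r \<le> cost \<kappa> \<zeta>' r'"
  obtains p' y' where "p' \<in> Xperp" "y' \<in> Y"
    "ereal (pairing M ubar y - (\<integral>\<omega>. \<theta> \<omega> \<partial>M)) + enn2ereal (cost \<kappa> \<zeta> r) \<le> dual_obj M f ubar p' y'"
proof -
  have x: "x \<in> adapted" and [measurable]: "\<zeta> \<in> borel_measurable M" "r \<in> borel_measurable M"
    and r0: "\<And>\<omega>. 0 \<le> r \<omega>" and mem: "AE \<omega> in M. (a \<omega> + J (x \<omega>) + \<zeta> \<omega>, r \<omega>) \<in> C \<omega>"
    using adm by (auto simp: admissible_def)
  have [measurable]: "x \<in> borel_measurable M" by (rule adapted_measurable[OF x])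
  have \<kappa>v: "0 \<le> \<kappa> * v \<omega>" "\<kappa> * v \<omega> \<le> \<kappa>" for \<omega>
    using \<kappa> v01[of \<omega>] by (auto simp: mult_le_cancel_left1)
  let ?P = "\<lambda>\<omega>. r \<omega> + \<kappa> * (v \<omega> * soft (\<zeta> \<omega>))"
  have pen0: "0 \<le> \<kappa> * (v \<omega> * soft (z :: (real ^ 'n) \<times> (real ^ 'm)))" for \<omega> z
    using \<kappa>v(1)[of \<omega>] soft_nonneg[of z] by (simp add: mult.assoc[symmetric])
  have P0: "0 \<le> ?P \<omega>" for \<omega> using r0[of \<omega>] pen0[of \<omega> "\<zeta> \<omega>"] by linarith
  have Pint: "integrable M ?P"
    using fin P0 unfolding cost_def by (intro integrableI_nonneg) auto
  have rint: "integrable M r"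
    by (rule Bochner_Integration.integrable_bound[OF Pint]) (use r0 pen0 P0 in auto)
  have sint: "integrable M (\<lambda>\<omega>. \<kappa> * (v \<omega> * soft (\<zeta> \<omega>)))"
    by (rule Bochner_Integration.integrable_bound[OF Pint]) (use r0 pen0 P0 in auto)
  have cost_eq: "cost \<kappa> \<zeta> r = ennreal (\<integral>\<omega>. ?P \<omega> \<partial>M)"
    unfolding cost_def using P0 by (intro nn_integral_eq_integral[OF Pint]) auto
  define g where "g \<omega> = - (\<kappa> * v \<omega>) *\<^sub>R dsoft (\<zeta> \<omega>)" for \<omega>
  have [measurable]: "g \<in> borel_measurable M" unfolding g_def by measurable
  have g_le: "norm (g \<omega>) \<le> \<kappa> * v \<omega>" for \<omega>
    using mult_left_mono[OF norm_dsoft_le \<kappa>v(1), of \<omega> "\<zeta> \<omega>"] by (simp add: g_def abs_of_nonneg[OF \<kappa>v(1)])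
  have g_bd: "norm (g \<omega>) \<le> \<kappa>" for \<omega> using g_le[of \<omega>] \<kappa>v(2)[of \<omega>] by linarith
  have ginner: "\<bar>z \<bullet> g \<omega>\<bar> \<le> norm z * (\<kappa> * v \<omega>)" for z \<omega>
    by (rule order_trans[OF Cauchy_Schwarz_ineq2 mult_left_mono[OF g_le norm_ge_zero]])
  have gint: "integrable M (\<lambda>\<omega>. z \<omega> \<bullet> g \<omega>)" if [measurable]: "z \<in> borel_measurable M" and "\<And>\<omega>. norm (z \<omega>) \<le> c" for z c
  proof (rule integrable_const_bound[of _ "c * \<kappa>"])
    have "\<bar>z \<omega> \<bullet> g \<omega>\<bar> \<le> c * \<kappa>" for \<omega>
      using Cauchy_Schwarz_ineq2[of "z \<omega>" "g \<omega>"] mult_mono[OF that(2) g_bd] that(2)[of \<omega>] norm_ge_zero[of "z \<omega>"]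
      by (meson norm_ge_zero order_trans)
    then show "AE \<omega> in M. norm (z \<omega> \<bullet> g \<omega>) \<le> c * \<kappa>" by simp
  qed measurable

  \<comment> \<open>Minimality against a competitor with perturbation \<zeta> + \<eta>, with the
    penalty expanded by \<open>soft_quadratic\<close>; the factor \<kappa> * v is at most \<kappa>
    in the error term.\<close>
  have variation: "(\<integral>\<omega>. r \<omega> \<partial>M) \<le> (\<integral>\<omega>. r1 \<omega> \<partial>M) - (\<integral>\<omega>. \<eta> \<omega> \<bullet> g \<omega> \<partial>M) + \<kappa> * c\<^sup>2 / 2"
    if adm1: "admissible x1 (\<lambda>\<omega>. \<zeta> \<omega> + \<eta> \<omega>) r1" and \<eta>: "\<eta> \<in> borel_measurable M" "\<And>\<omega>. norm (\<eta> \<omega>) \<le> c"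
      and r1: "integrable M r1" for x1 \<eta> r1 c
  proof -
    let ?Q = "\<lambda>\<omega>. r1 \<omega> + (\<kappa> * (v \<omega> * soft (\<zeta> \<omega>)) - \<eta> \<omega> \<bullet> g \<omega> + \<kappa> * c\<^sup>2 / 2)"
    have \<eta>g: "integrable M (\<lambda>\<omega>. \<eta> \<omega> \<bullet> g \<omega>)" by (rule gint[OF \<eta>])
    have Qint: "integrable M ?Q" using r1 sint \<eta>g by auto
    have le: "r1 \<omega> + \<kappa> * (v \<omega> * soft (\<zeta> \<omega> + \<eta> \<omega>)) \<le> ?Q \<omega>" for \<omega>
    proof -
      have "(norm (\<eta> \<omega>))\<^sup>2 \<le> c\<^sup>2" using \<eta>(2)[of \<omega>] by (intro power_mono) auto
      then have "\<kappa> * v \<omega> * ((norm (\<eta> \<omega>))\<^sup>2 / 2) \<le> \<kappa> * (c\<^sup>2 / 2)"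
        using \<kappa>v[of \<omega>] \<kappa> by (intro mult_mono) auto
      moreover have "\<kappa> * v \<omega> * soft (\<zeta> \<omega> + \<eta> \<omega>) \<le> \<kappa> * v \<omega> * (soft (\<zeta> \<omega>) + dsoft (\<zeta> \<omega>) \<bullet> \<eta> \<omega> + (norm (\<eta> \<omega>))\<^sup>2 / 2)"
        by (rule mult_left_mono[OF soft_quadratic \<kappa>v(1)])
      moreover have "\<eta> \<omega> \<bullet> g \<omega> = - (\<kappa> * v \<omega> * (dsoft (\<zeta> \<omega>) \<bullet> \<eta> \<omega>))" by (simp add: g_def inner_commute)
      ultimately show ?thesis by (simp add: distrib_left mult.assoc)
    qed
    have "0 \<le> r1 \<omega>" for \<omega> using adm1 by (simp add: admissible_def)
    then have Q0: "0 \<le> ?Q \<omega>" for \<omega> using le[of \<omega>] pen0[of \<omega> "\<zeta> \<omega> + \<eta> \<omega>"] by (meson add_nonneg_nonneg order_trans)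
    have "ennreal (\<integral>\<omega>. ?P \<omega> \<partial>M) \<le> cost \<kappa> (\<lambda>\<omega>. \<zeta> \<omega> + \<eta> \<omega>) r1" using min[OF adm1] by (simp add: cost_eq)
    also have "\<dots> \<le> (\<integral>\<^sup>+\<omega>. ennreal (?Q \<omega>) \<partial>M)" unfolding cost_def by (intro nn_integral_mono ennreal_leI le)
    also have "\<dots> = ennreal (\<integral>\<omega>. ?Q \<omega> \<partial>M)" using Q0 by (intro nn_integral_eq_integral[OF Qint]) auto
    finally have "(\<integral>\<omega>. ?P \<omega> \<partial>M) \<le> (\<integral>\<omega>. ?Q \<omega> \<partial>M)"
      using Q0 by (subst (asm) ennreal_le_iff) (auto intro: integral_nonneg)
    then show ?thesis using r1 rint sint \<eta>g by (simp add: prob_space)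
  qed

  have perp: "(\<integral>\<omega>. b \<omega> \<bullet> fst (g \<omega>) \<partial>M) = 0" if b: "b \<in> adapted" "\<forall>\<omega>. norm (b \<omega>) \<le> c" for b c
  proof -
    have [measurable]: "b \<in> borel_measurable M" by (rule adapted_measurable[OF b(1)])
    have nJ: "norm (J (b \<omega>)) \<le> c" for \<omega> using b(2) by (simp add: J_def norm_Pair)
    \<comment> \<open>Here s is 1 or - 1; the two signs together turn the first-order inequality
      into an equation.\<close>
    have "0 \<le> s * (\<integral>\<omega>. J (b \<omega>) \<bullet> g \<omega> \<partial>M)" if s: "\<bar>s\<bar> = 1" for s
    proof (rule linear_term_nonneg)
      fix t :: real assume t: "0 < t" "t \<le> 1"
      have "admissible (\<lambda>\<omega>. x \<omega> + (s * t) *\<^sub>R b \<omega>) (\<lambda>\<omega>. \<zeta> \<omega> + - (s * t) *\<^sub>R J (b \<omega>)) r"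
        unfolding admissible_def
      proof (intro conjI allI r0 adapted_add adapted_scaleR x b)
        show "AE \<omega> in M. (a \<omega> + J (x \<omega> + (s * t) *\<^sub>R b \<omega>) + (\<zeta> \<omega> + - (s * t) *\<^sub>R J (b \<omega>)), r \<omega>) \<in> C \<omega>"
          using mem by (simp add: linear_add[OF linear_J] linear_cmul[OF linear_J] algebra_simps)
      qed measurable
      then have "(\<integral>\<omega>. r \<omega> \<partial>M) \<le> (\<integral>\<omega>. r \<omega> \<partial>M) - (\<integral>\<omega>. (- (s * t) *\<^sub>R J (b \<omega>)) \<bullet> g \<omega> \<partial>M) + \<kappa> * (t * c)\<^sup>2 / 2"
      proof (rule variation)
        show "norm (- (s * t) *\<^sub>R J (b \<omega>)) \<le> t * c" for \<omega>
          using nJ[of \<omega>] t s by (simp add: abs_mult)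
      qed (use rint in measurable)
      then show "0 \<le> t * (s * (\<integral>\<omega>. J (b \<omega>) \<bullet> g \<omega> \<partial>M)) + t\<^sup>2 * (\<kappa> * c\<^sup>2 / 2)"
        by (simp add: power_mult_distrib mult_ac)
    qed
    from this[of 1] this[of "- 1"] have "(\<integral>\<omega>. J (b \<omega>) \<bullet> g \<omega> \<partial>M) = 0" by simp
    then show ?thesis by (simp add: J_inner)
  qed

  let ?e = "\<lambda>\<omega>. a \<omega> + J (x \<omega>) + \<zeta> \<omega>"
  \<comment> \<open>The competitor moves a fraction t along the segment in \<open>C\<close> towards
    the new point. The terms of first order in t compare the two heights without the quadratic
    error.\<close>
  have variation_point: "(\<integral>\<omega>. r \<omega> \<partial>M) \<le> (\<integral>\<omega>. r2 \<omega> \<partial>M) - (\<integral>\<omega>. \<eta> \<omega> \<bullet> g \<omega> \<partial>M)"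
    if \<eta> [measurable]: "\<eta> \<in> borel_measurable M" and \<eta>c: "\<And>\<omega>. norm (\<eta> \<omega>) \<le> c"
      and r2: "integrable M r2" "\<And>\<omega>. 0 \<le> r2 \<omega>" and mem2: "AE \<omega> in M. (?e \<omega> + \<eta> \<omega>, r2 \<omega>) \<in> C \<omega>" for \<eta> r2 c
  proof -
    have [measurable]: "r2 \<in> borel_measurable M" using r2(1) by simp
    have "0 \<le> (\<integral>\<omega>. r2 \<omega> \<partial>M) - (\<integral>\<omega>. r \<omega> \<partial>M) - (\<integral>\<omega>. \<eta> \<omega> \<bullet> g \<omega> \<partial>M)"
    proof (rule linear_term_nonneg)
      fix t :: real assume t: "0 < t" "t \<le> 1"
      have "admissible x (\<lambda>\<omega>. \<zeta> \<omega> + t *\<^sub>R \<eta> \<omega>) (\<lambda>\<omega>. (1 - t) * r \<omega> + t * r2 \<omega>)"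
        unfolding admissible_def
      proof (intro conjI allI x)
        show "0 \<le> (1 - t) * r \<omega> + t * r2 \<omega>" for \<omega> using t r0[of \<omega>] r2(2)[of \<omega>] by simp
        show "AE \<omega> in M. (a \<omega> + J (x \<omega>) + (\<zeta> \<omega> + t *\<^sub>R \<eta> \<omega>), (1 - t) * r \<omega> + t * r2 \<omega>) \<in> C \<omega>"
          using mem mem2 AE_space
        proof eventually_elim
          case (elim \<omega>)
          have "(1 - t) *\<^sub>R (?e \<omega>, r \<omega>) + t *\<^sub>R (?e \<omega> + \<eta> \<omega>, r2 \<omega>) \<in> C \<omega>"
            using C_closed_convex[OF elim(3)] elim t by (intro convexD) auto
          then show ?case by (simp add: algebra_simps)
        qed
      qed measurable
      then have "(\<integral>\<omega>. r \<omega> \<partial>M) \<le> (\<integral>\<omega>. (1 - t) * r \<omega> + t * r2 \<omega> \<partial>M) - (\<integral>\<omega>. (t *\<^sub>R \<eta> \<omega>) \<bullet> g \<omega> \<partial>M) + \<kappa> * (t * c)\<^sup>2 / 2"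
      proof (rule variation)
        show "norm (t *\<^sub>R \<eta> \<omega>) \<le> t * c" for \<omega> using \<eta>c[of \<omega>] t by simp
      qed (use rint r2(1) in auto)
      then show "0 \<le> t * ((\<integral>\<omega>. r2 \<omega> \<partial>M) - (\<integral>\<omega>. r \<omega> \<partial>M) - (\<integral>\<omega>. \<eta> \<omega> \<bullet> g \<omega> \<partial>M)) + t\<^sup>2 * (\<kappa> * c\<^sup>2 / 2)"
        using rint r2(1) by (simp add: power_mult_distrib algebra_simps)
    qed
    then show ?thesis by simp
  qed

  \<comment> \<open>The pointwise subgradient inequality is tested along a dense sequence of
    selections, so that only countably many null sets arise.\<close>
  obtain c where cm [measurable]: "\<And>j::nat. c j \<in> borel_measurable M"
    and cl: "\<And>\<omega>. \<omega> \<in> space M \<Longrightarrow> epi (f \<omega>) \<noteq> {} \<Longrightarrow> closure (range (\<lambda>j. c j \<omega>)) = epi (f \<omega>)"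
    using normal_integrand_castaing[OF normal] by blast
  define R where "R j \<omega> = snd (c j \<omega>) - fst (c j \<omega>) \<bullet> q \<omega> + \<theta> \<omega>" for j \<omega>
  have [measurable]: "R j \<in> borel_measurable M" for j unfolding R_def by measurable
  have epi_ne: "AE \<omega> in M. epi (f \<omega>) \<noteq> {}"
    using mem
  proof eventually_elim
    case (elim \<omega>)
    then have "(?e \<omega>, r \<omega> + ?e \<omega> \<bullet> q \<omega> - \<theta> \<omega>) \<in> epi (f \<omega>)" by (simp add: C_def epi_def)
    then show ?case by blast
  qed
  have cC: "AE \<omega> in M. \<forall>j. (fst (c j \<omega>), R j \<omega>) \<in> C \<omega>"
    using epi_ne AE_space
  proof eventually_elim
    case (elim \<omega>)
    show ?case
    proof
      fix j
      have "c j \<omega> \<in> closure (range (\<lambda>j. c j \<omega>))" by (rule subsetD[OF closure_subset]) (rule rangeI)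
      then have "c j \<omega> \<in> epi (f \<omega>)" by (simp only: cl[OF elim(2,1)])
      then show "(fst (c j \<omega>), R j \<omega>) \<in> C \<omega>" by (auto simp: C_def epi_def R_def split: prod.splits)
    qed
  qed
  have R0: "AE \<omega> in M. \<forall>j. 0 \<le> R j \<omega>"
    using cC C_nonneg by eventually_elim fastforce
  have [measurable]: "?e \<in> borel_measurable M" by measurable
  have sub_j: "AE \<omega> in M. \<not> (R j \<omega> - (fst (c j \<omega>) - ?e \<omega>) \<bullet> g \<omega> < r \<omega> \<and> norm (fst (c j \<omega>) - ?e \<omega>) \<le> real k \<and> \<bar>R j \<omega>\<bar> \<le> real k)"
    for j and k :: nat
  proof -
    \<comment> \<open>The event that selection j violates the subgradient inequality, truncated at
      k. Moving to the selection there and staying put elsewhere is a bounded perturbation with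
      integrable height.\<close>
    define A where "A \<omega> \<longleftrightarrow> R j \<omega> - (fst (c j \<omega>) - ?e \<omega>) \<bullet> g \<omega> < r \<omega> \<and> norm (fst (c j \<omega>) - ?e \<omega>) \<le> real k \<and> \<bar>R j \<omega>\<bar> \<le> real k" for \<omega>
    have [measurable]: "Measurable.pred M A" unfolding A_def by measurable
    define \<eta> where "\<eta> \<omega> = (if A \<omega> then fst (c j \<omega>) - ?e \<omega> else 0)" for \<omega>
    define r2 where "r2 \<omega> = (if A \<omega> then max 0 (R j \<omega>) else r \<omega>)" for \<omega>
    have [measurable]: "\<eta> \<in> borel_measurable M" "r2 \<in> borel_measurable M" unfolding \<eta>_def r2_def by measurable
    have \<eta>k: "norm (\<eta> \<omega>) \<le> real k" for \<omega> by (simp add: \<eta>_def A_def)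
    have r2int: "integrable M r2"
    proof (rule Bochner_Integration.integrable_bound)
      show "integrable M (\<lambda>\<omega>. real k + r \<omega>)" using rint by auto
      show "AE \<omega> in M. norm (r2 \<omega>) \<le> norm (real k + r \<omega>)"
        by (intro always_eventually allI) (use r0 in \<open>auto simp: r2_def A_def abs_le_iff intro: add_increasing2\<close>)
    qed measurable
    have "(\<integral>\<omega>. r \<omega> \<partial>M) \<le> (\<integral>\<omega>. r2 \<omega> \<partial>M) - (\<integral>\<omega>. \<eta> \<omega> \<bullet> g \<omega> \<partial>M)"
    proof (rule variation_point[OF _ \<eta>k r2int])
      show "0 \<le> r2 \<omega>" for \<omega> using r0 by (simp add: r2_def)
      show "AE \<omega> in M. (?e \<omega> + \<eta> \<omega>, r2 \<omega>) \<in> C \<omega>"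
        using mem cC R0 by eventually_elim (auto simp: \<eta>_def r2_def max_absorb2)
    qed measurable
    \<comment> \<open>The gain of the modification: nonnegative almost everywhere, strictly positive
      on \<open>A\<close>, yet of nonpositive integral by \<open>variation_point\<close>. So
      \<open>A\<close> is null.\<close>
    moreover define D where "D \<omega> = \<eta> \<omega> \<bullet> g \<omega> + r \<omega> - r2 \<omega>" for \<omega>
    moreover have Dint: "integrable M D"
      unfolding D_def using r2int rint gint[OF _ \<eta>k] by auto
    ultimately have "(\<integral>\<omega>. D \<omega> \<partial>M) \<le> 0"
      using r2int rint gint[OF _ \<eta>k] by simp
    moreover have ae: "AE \<omega> in M. 0 \<le> D \<omega>"
      using R0 by eventually_elim (auto simp: D_def \<eta>_def r2_def A_def max_absorb2)
    ultimately have "AE \<omega> in M. D \<omega> = 0"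
      using integral_nonneg_AE[OF ae] integral_nonneg_eq_0_iff_AE[OF Dint ae] by simp
    then have "AE \<omega> in M. \<not> A \<omega>"
      using R0
    proof eventually_elim
      case (elim \<omega>)
      show "\<not> A \<omega>"
      proof
        assume "A \<omega>"
        then show False using elim by (auto simp: D_def \<eta>_def r2_def max_absorb2 A_def)
      qed
    qed
    then show ?thesis by (simp add: A_def)
  qed
  \<comment> \<open>Letting k exhaust the truncation gives the inequality at every selection; it
    describes a closed halfspace and hence passes to the whole epigraph.\<close>
  have subgradient: "AE \<omega> in M. \<forall>(z, \<alpha>)\<in>epi (f \<omega>). z \<bullet> (q \<omega> + g \<omega>) - \<alpha> \<le> ?e \<omega> \<bullet> g \<omega> - r \<omega> + \<theta> \<omega>"
  proof -
    have "AE \<omega> in M. \<forall>j k. \<not> (R j \<omega> - (fst (c j \<omega>) - ?e \<omega>) \<bullet> g \<omega> < r \<omega> \<and> norm (fst (c j \<omega>) - ?e \<omega>) \<le> real k \<and> \<bar>R j \<omega>\<bar> \<le> real k)"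
      unfolding AE_all_countable by (intro allI sub_j)
    then show ?thesis using epi_ne AE_space
    proof eventually_elim
      case (elim \<omega>)
      have "r \<omega> \<le> R j \<omega> - (fst (c j \<omega>) - ?e \<omega>) \<bullet> g \<omega>" for j
      proof -
        obtain k :: nat where "max (norm (fst (c j \<omega>) - ?e \<omega>)) \<bar>R j \<omega>\<bar> \<le> real k" using real_arch_simple by blast
        with elim(1) show ?thesis by (force simp: not_less)
      qed
      then have *: "range (\<lambda>j. c j \<omega>) \<subseteq> {u. fst u \<bullet> (q \<omega> + g \<omega>) - snd u \<le> ?e \<omega> \<bullet> g \<omega> - r \<omega> + \<theta> \<omega>}"
        by (auto simp: R_def inner_diff_left inner_add_right algebra_simps)
      have "closure (range (\<lambda>j. c j \<omega>)) \<subseteq> {u. fst u \<bullet> (q \<omega> + g \<omega>) - snd u \<le> ?e \<omega> \<bullet> g \<omega> - r \<omega> + \<theta> \<omega>}"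
        by (rule closure_minimal[OF *]) (intro closed_Collect_le continuous_intros)
      then show ?case unfolding cl[OF elim(3,2)] by auto
    qed
  qed

  have gz: "integrable M (\<lambda>\<omega>. \<zeta> \<omega> \<bullet> g \<omega>)"
  proof (rule Bochner_Integration.integrable_bound)
    show "integrable M (\<lambda>\<omega>. \<kappa> * (v \<omega> * soft (\<zeta> \<omega>)) + \<kappa>)" using sint by auto
    have "\<bar>\<zeta> \<omega> \<bullet> g \<omega>\<bar> \<le> \<kappa> * (v \<omega> * soft (\<zeta> \<omega>)) + \<kappa>" for \<omega>
      using ginner[of "\<zeta> \<omega>" \<omega>] mult_right_mono[OF norm_le_soft \<kappa>v(1), of "\<zeta> \<omega>" \<omega>] \<kappa>v(2)[of \<omega>]
      by (simp add: algebra_simps)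
    then show "AE \<omega> in M. norm (\<zeta> \<omega> \<bullet> g \<omega>) \<le> norm (\<kappa> * (v \<omega> * soft (\<zeta> \<omega>)) + \<kappa>)"
      by (intro always_eventually allI) (auto intro: order_trans[OF _ abs_ge_self])
  qed measurable
  have ga: "integrable M (\<lambda>\<omega>. a \<omega> \<bullet> g \<omega>)"
  proof (rule Bochner_Integration.integrable_bound[OF integrable_mult_right[OF ubar_integrable_norm, of \<kappa>]])
    have "\<bar>a \<omega> \<bullet> g \<omega>\<bar> \<le> \<kappa> * norm (ubar \<omega>)" for \<omega>
    proof -
      have "\<bar>a \<omega> \<bullet> g \<omega>\<bar> \<le> norm (a \<omega>) * norm (g \<omega>)" by (rule Cauchy_Schwarz_ineq2)
      also have "\<dots> \<le> norm (a \<omega>) * \<kappa>" using g_bd by (intro mult_left_mono) auto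
      finally show ?thesis by (simp add: a_def norm_Pair mult.commute)
    qed
    then show "AE \<omega> in M. norm (a \<omega> \<bullet> g \<omega>) \<le> norm (\<kappa> * norm (ubar \<omega>))"
      using \<kappa> by (intro always_eventually allI) (simp add: abs_mult)
  qed measurable
  have gxh: "integrable M (\<lambda>\<omega>. J (xh \<omega>) \<bullet> g \<omega>)"
  proof (rule integrable_const_bound[of _ \<kappa>])
    have "\<bar>J (xh \<omega>) \<bullet> g \<omega>\<bar> \<le> \<kappa>" for \<omega>
    proof -
      have "norm (J (xh \<omega>)) * v \<omega> \<le> 1" by (simp add: J_def norm_Pair v_def divide_le_eq add_pos_nonneg)
      then have "\<kappa> * (norm (J (xh \<omega>)) * v \<omega>) \<le> \<kappa>" using \<kappa> by (simp add: mult_le_cancel_left1)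
      with ginner[of "J (xh \<omega>)" \<omega>] show ?thesis by (simp add: mult_ac)
    qed
    then show "AE \<omega> in M. norm (J (xh \<omega>) \<bullet> g \<omega>) \<le> \<kappa>" by simp
  qed measurable
  have aq: "integrable M (\<lambda>\<omega>. ubar \<omega> \<bullet> y \<omega>)" by (rule separating_duality_integrable[OF duality(2) ubar y])
  have g1int: "integrable M (\<lambda>\<omega>. fst (g \<omega>) $ i)" for i
  proof (rule integrable_const_bound[of _ \<kappa>])
    have "\<bar>fst (g \<omega>) $ i\<bar> \<le> \<kappa>" for \<omega>
      using component_le_norm_cart[of "fst (g \<omega>)" i] norm_fst_le[of "fst (g \<omega>)" "snd (g \<omega>)"] g_bd[of \<omega>] by simp
    then show "AE \<omega> in M. norm (fst (g \<omega>) $ i) \<le> \<kappa>" by simp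
    show "(\<lambda>\<omega>. fst (g \<omega>) $ i) \<in> borel_measurable M" unfolding cart_eq_inner_axis by measurable
  qed
  \<comment> \<open>The subgradient inequality at the feasible point (xh, ubar) provides the
    integrable lower bound with which \<open>adapted_annihilator\<close> gives x . fst g mean 0,
    although x need not be integrable.\<close>
  have lower: "AE \<omega> in M. (xh \<omega> \<bullet> p \<omega> + ubar \<omega> \<bullet> y \<omega> + J (xh \<omega>) \<bullet> g \<omega> + a \<omega> \<bullet> g \<omega>) - fh \<omega> - a \<omega> \<bullet> g \<omega> - \<zeta> \<omega> \<bullet> g \<omega> + r \<omega> - \<theta> \<omega>
      \<le> x \<omega> \<bullet> fst (g \<omega>)"
    using subgradient fh(2)
  proof eventually_elim
    case (elim \<omega>)
    have "((xh \<omega>, ubar \<omega>), fh \<omega>) \<in> epi (f \<omega>)" using elim(2) by (simp add: epi_def)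
    with elim(1) have "(xh \<omega>, ubar \<omega>) \<bullet> (q \<omega> + g \<omega>) - fh \<omega> \<le> ?e \<omega> \<bullet> g \<omega> - r \<omega> + \<theta> \<omega>" by blast
    then show ?case
      by (cases "g \<omega>") (simp add: q_def a_def J_def inner_add_left inner_add_right algebra_simps)
  qed
  have "integrable M (\<lambda>\<omega>. (xh \<omega> \<bullet> p \<omega> + ubar \<omega> \<bullet> y \<omega> + J (xh \<omega>) \<bullet> g \<omega> + a \<omega> \<bullet> g \<omega>) - fh \<omega> - a \<omega> \<bullet> g \<omega> - \<zeta> \<omega> \<bullet> g \<omega> + r \<omega> - \<theta> \<omega>)"
    using xh(2) aq gxh ga fh(1) gz rint \<theta>(1) by auto
  note xg = adapted_annihilator[OF g1int perp x this lower]

  have Vg: "(\<lambda>\<omega>. p \<omega> + fst (g \<omega>)) \<in> V"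
  proof (intro solid_decomposable_add[OF spaces(2)] Xperp_V[OF p] solid_decomposable_bounded[OF spaces(2)])
    show "norm (fst (g \<omega>)) \<le> \<kappa>" for \<omega>
      using norm_fst_le[of "fst (g \<omega>)" "snd (g \<omega>)"] g_bd[of \<omega>] by simp
  qed measurable
  have Yg: "(\<lambda>\<omega>. y \<omega> + snd (g \<omega>)) \<in> Y"
  proof (intro solid_decomposable_add[OF spaces(4)] y solid_decomposable_bounded[OF spaces(4)])
    show "norm (snd (g \<omega>)) \<le> \<kappa>" for \<omega>
      using norm_snd_le[of "snd (g \<omega>)" "fst (g \<omega>)"] g_bd[of \<omega>] by simp
  qed measurable
  show thesis
  proof (rule that[OF XperpI[OF Vg] Yg])
    fix b c assume b: "b \<in> adapted" "\<forall>\<omega>. norm (b \<omega>) \<le> (c :: real)"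
    have bm: "b \<in> borel_measurable M" by (rule adapted_measurable[OF b(1)])
    have "integrable M (\<lambda>\<omega>. b \<omega> \<bullet> p \<omega>)"
      by (rule bounded_inner_integrable[OF Xperp_V[OF p] bm]) (use b(2) in auto)
    moreover have "integrable M (\<lambda>\<omega>. J (b \<omega>) \<bullet> g \<omega>)"
      by (rule gint[of _ c]) (use bm b(2) in \<open>auto simp: J_def norm_Pair intro!: borel_measurable_Pair\<close>)
    ultimately show "(\<integral>\<omega>. b \<omega> \<bullet> (p \<omega> + fst (g \<omega>)) \<partial>M) = 0"
      using Xperp_bounded[OF p b] perp[OF b] by (simp add: inner_add_right J_inner)
  next
    let ?h = "\<lambda>\<omega>. ?e \<omega> \<bullet> g \<omega> - r \<omega> + \<theta> \<omega>"
    have eg: "?e \<omega> \<bullet> g \<omega> = a \<omega> \<bullet> g \<omega> + x \<omega> \<bullet> fst (g \<omega>) + \<zeta> \<omega> \<bullet> g \<omega>" for \<omega>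
      by (simp add: inner_add_left J_inner)
    have hint: "integrable M ?h" unfolding eg using ga xg(1) gz rint \<theta>(1) by auto
    have h_eq: "(\<integral>\<omega>. ?h \<omega> \<partial>M) = (\<integral>\<omega>. a \<omega> \<bullet> g \<omega> \<partial>M) + (\<integral>\<omega>. \<zeta> \<omega> \<bullet> g \<omega> \<partial>M) - (\<integral>\<omega>. r \<omega> \<partial>M) + (\<integral>\<omega>. \<theta> \<omega> \<partial>M)"
      unfolding eg using ga xg gz rint \<theta>(1) by simp
    have "conj_obj M f (\<lambda>\<omega>. p \<omega> + fst (g \<omega>)) (\<lambda>\<omega>. y \<omega> + snd (g \<omega>)) \<le> ereal (\<integral>\<omega>. ?h \<omega> \<partial>M)"
      unfolding conj_obj_def integral_functional_def
    proof (rule ext_expectation_le[OF hint])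
      show "AE \<omega> in M. conj_fun (f \<omega>) (p \<omega> + fst (g \<omega>), y \<omega> + snd (g \<omega>)) \<le> ereal (?h \<omega>)"
        using subgradient
      proof eventually_elim
        case (elim \<omega>)
        have "(p \<omega> + fst (g \<omega>), y \<omega> + snd (g \<omega>)) = q \<omega> + g \<omega>" by (cases "g \<omega>") (simp add: q_def)
        with elim show ?case by (simp only: conj_fun_le_iff)
      qed
    qed
    moreover have "pairing M ubar (\<lambda>\<omega>. y \<omega> + snd (g \<omega>)) = pairing M ubar y + (\<integral>\<omega>. a \<omega> \<bullet> g \<omega> \<partial>M)"
    proof -
      have "a \<omega> \<bullet> g \<omega> = ubar \<omega> \<bullet> snd (g \<omega>)" for \<omega> by (cases "g \<omega>") (simp add: a_def)
      then show ?thesis unfolding pairing_def using aq ga by (simp add: inner_add_right)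
    qed
    ultimately have "ereal (pairing M ubar y + (\<integral>\<omega>. a \<omega> \<bullet> g \<omega> \<partial>M)) - ereal (\<integral>\<omega>. ?h \<omega> \<partial>M)
      \<le> dual_obj M f ubar (\<lambda>\<omega>. p \<omega> + fst (g \<omega>)) (\<lambda>\<omega>. y \<omega> + snd (g \<omega>))"
      unfolding dual_obj_def by (simp only: ereal_minus_mono order_refl)
    \<comment> \<open>By convexity of the penalty, the linear term - \<zeta> . g already covers it.
      The dual value of the corrected point therefore reaches the full minimal cost.\<close>
    moreover have "(\<integral>\<omega>. ?P \<omega> \<partial>M) \<le> (\<integral>\<omega>. r \<omega> \<partial>M) - (\<integral>\<omega>. \<zeta> \<omega> \<bullet> g \<omega> \<partial>M)"
    proof -
      have "(\<integral>\<omega>. ?P \<omega> \<partial>M) \<le> (\<integral>\<omega>. r \<omega> - \<zeta> \<omega> \<bullet> g \<omega> \<partial>M)"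
      proof (rule integral_mono[OF Pint])
        fix \<omega>
        have "\<kappa> * v \<omega> * soft (\<zeta> \<omega>) \<le> \<kappa> * v \<omega> * (dsoft (\<zeta> \<omega>) \<bullet> \<zeta> \<omega>)"
          by (rule mult_left_mono[OF soft_le_dsoft_inner \<kappa>v(1)])
        then show "?P \<omega> \<le> r \<omega> - \<zeta> \<omega> \<bullet> g \<omega>" by (simp add: g_def inner_commute mult.assoc)
      qed (use rint gz in auto)
      then show ?thesis using rint gz by simp
    qed
    moreover have "enn2ereal (cost \<kappa> \<zeta> r) = ereal (\<integral>\<omega>. ?P \<omega> \<partial>M)"
      unfolding cost_eq using P0 by (intro enn2ereal_ennreal integral_nonneg) auto
    ultimately show "ereal (pairing M ubar y - (\<integral>\<omega>. \<theta> \<omega> \<partial>M)) + enn2ereal (cost \<kappa> \<zeta> r)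
      \<le> dual_obj M f ubar (\<lambda>\<omega>. p \<omega> + fst (g \<omega>)) (\<lambda>\<omega>. y \<omega> + snd (g \<omega>))"
      using h_eq by (elim order_trans[rotated]) simp
  qed
qed

theorem strong_duality:
  obtains x where "x \<in> N" "primal_obj M f ubar x \<le> (SUP (p, y)\<in>Xperp \<times> Y. dual_obj M f ubar p y)"
proof -
  let ?S = "SUP (p, y)\<in>Xperp \<times> Y. dual_obj M f ubar p y"
  have "primal_obj M f ubar xh = ereal (\<integral>\<omega>. fh \<omega> \<partial>M)"
    unfolding primal_obj_def integral_functional_def by (rule ext_expectation_eq[OF fh])
  then have "?S \<le> ereal (\<integral>\<omega>. fh \<omega> \<partial>M)"
    using weak_duality[OF adapted_in_N[OF xh(1)]] by (intro SUP_least) auto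
  moreover have "dual_obj M f ubar p y \<le> ?S" using p y by (intro SUP_upper2[of "(p, y)"]) auto
  moreover have "dual_obj M f ubar p y = ereal (pairing M ubar y - (\<integral>\<omega>. \<theta> \<omega> \<partial>M))"
    unfolding dual_obj_def conj_obj_def integral_functional_def by (simp add: ext_expectation_eq[OF \<theta>])
  ultimately obtain s where s: "?S = ereal s" by (cases ?S) auto
  \<comment> \<open>The gap between the supremum of (D) and the value at (p, y). By
    \<open>near_optimal_dual\<close> it bounds every penalized minimum, whatever the weight.\<close>
  define b where "b = s - pairing M ubar y + (\<integral>\<omega>. \<theta> \<omega> \<partial>M)"
  have ex: "0 \<le> b \<and> (\<exists>x \<zeta> r. admissible x \<zeta> r \<and> cost (1 + real k) \<zeta> r \<le> ennreal b)" for k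
  proof -
    obtain x \<zeta> r where m: "admissible x \<zeta> r" "cost (1 + real k) \<zeta> r < \<infinity>"
      "\<And>x' \<zeta>' r'. admissible x' \<zeta>' r' \<Longrightarrow> cost (1 + real k) \<zeta> r \<le> cost (1 + real k) \<zeta>' r'"
      using minimizer_exists[of "1 + real k"] by auto
    obtain p' y' where py: "p' \<in> Xperp" "y' \<in> Y"
      "ereal (pairing M ubar y - (\<integral>\<omega>. \<theta> \<omega> \<partial>M)) + enn2ereal (cost (1 + real k) \<zeta> r) \<le> dual_obj M f ubar p' y'"
      by (rule near_optimal_dual[OF _ m]) auto
    have "dual_obj M f ubar p' y' \<le> ereal s" unfolding s[symmetric] using py by (intro SUP_upper2[of "(p', y')"]) auto
    with py(3) have *: "ereal (pairing M ubar y - (\<integral>\<omega>. \<theta> \<omega> \<partial>M)) + enn2ereal (cost (1 + real k) \<zeta> r) \<le> ereal s"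
      by (rule order_trans)
    obtain t where t: "cost (1 + real k) \<zeta> r = ennreal t" "0 \<le> t" using m(2) by (cases "cost (1 + real k) \<zeta> r") auto
    have "t \<le> b" using * t by (simp add: enn2ereal_ennreal b_def)
    then have "cost (1 + real k) \<zeta> r \<le> ennreal b" "0 \<le> b" using t by (simp_all add: ennreal_leI)
    with m(1) show ?thesis by blast
  qed
  then have b0: "0 \<le> b" by blast
  obtain x \<zeta> r where seq: "\<And>k. admissible (x k) (\<zeta> k) (r k)"
    "\<And>k. cost (1 + real k) (\<zeta> k) (r k) \<le> ennreal b" using ex by metis
  have le: "cost \<kappa> (\<zeta> k) (r k) \<le> ennreal b" if "\<kappa> \<le> 1 + real k" for \<kappa> k
    using cost_mono[OF that] seq(2) by (rule order_trans)
  have le1: "cost 1 (\<zeta> k) (r k) \<le> ennreal b" for k by (rule le) simp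
  obtain x' \<zeta>' r' where adm: "admissible x' \<zeta>' r'"
    and lim: "\<And>\<kappa> b. 0 \<le> \<kappa> \<Longrightarrow> \<forall>\<^sub>F k in sequentially. cost \<kappa> (\<zeta> k) (r k) \<le> b \<Longrightarrow> cost \<kappa> \<zeta>' r' \<le> b"
    by (rule penalized_compactness[of x \<zeta> r "ennreal b", OF seq(1) le1]) (simp, rule that)
  \<comment> \<open>Costs increase with the weight, so for fixed m the bound holds along the
    sequence from k = m on. It passes to the limit, which does not depend on m.\<close>
  have costb: "cost (real m) \<zeta>' r' \<le> ennreal b" for m :: nat
  proof (rule lim)
    show "\<forall>\<^sub>F k in sequentially. cost (real m) (\<zeta> k) (r k) \<le> ennreal b"
      using eventually_ge_at_top[of m] by eventually_elim (rule le, simp)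
  qed simp
  have x': "x' \<in> adapted" and [measurable]: "\<zeta>' \<in> borel_measurable M" "r' \<in> borel_measurable M"
    and r0: "\<And>\<omega>. 0 \<le> r' \<omega>" and mem: "AE \<omega> in M. (a \<omega> + J (x' \<omega>) + \<zeta>' \<omega>, r' \<omega>) \<in> C \<omega>"
    using adm by (auto simp: admissible_def)
  have "cost 0 \<zeta>' r' \<le> ennreal b" using costb[of 0] by simp
  then have rb: "(\<integral>\<^sup>+\<omega>. ennreal (r' \<omega>) \<partial>M) \<le> ennreal b" by (simp add: cost_def)
  have rint: "integrable M r'"
    using rb r0 by (intro integrableI_nonneg) (auto simp: le_less_trans)
  have r_le: "(\<integral>\<omega>. r' \<omega> \<partial>M) \<le> b"
    using rb nn_integral_eq_integral[OF rint] r0 b0 by simp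
  have \<zeta>0: "AE \<omega> in M. \<zeta>' \<omega> = 0"
  proof -
    let ?W = "\<integral>\<^sup>+\<omega>. ennreal (v \<omega> * soft (\<zeta>' \<omega>)) \<partial>M"
    have W0: "0 \<le> v \<omega> * soft (\<zeta>' \<omega>)" for \<omega>
      by (intro mult_nonneg_nonneg soft_nonneg less_imp_le[OF v01(1)])
    have mW: "ennreal (real m) * ?W \<le> ennreal b" for m :: nat
    proof -
      have "ennreal (real m) * ?W = (\<integral>\<^sup>+\<omega>. ennreal (real m) * ennreal (v \<omega> * soft (\<zeta>' \<omega>)) \<partial>M)"
        by (rule nn_integral_cmult[symmetric]) measurable
      also have "\<dots> \<le> cost (real m) \<zeta>' r'"
        unfolding cost_def using W0 r0 by (intro nn_integral_mono) (simp add: ennreal_mult[symmetric] ennreal_leI)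
      also have "\<dots> \<le> ennreal b" by (rule costb)
      finally show ?thesis .
    qed
    have "?W \<le> ennreal b" using mW[of 1] by simp
    then obtain w where w: "?W = ennreal w" "0 \<le> w" by (cases ?W) (auto simp: top_unique)
    have "w = 0"
    proof (rule ccontr)
      assume "w \<noteq> 0"
      then obtain m :: nat where "b < real m * w" using ex_less_of_nat_mult[of w b] w(2) by auto
      moreover have "real m * w \<le> b" using mW[of m] w b0 by (simp add: ennreal_mult[symmetric])
      ultimately show False by simp
    qed
    then have "?W = 0" using w by simp
    then have "AE \<omega> in M. ennreal (v \<omega> * soft (\<zeta>' \<omega>)) = 0" by (subst (asm) nn_integral_0_iff_AE) auto
    then show ?thesis
    proof eventually_elim
      case (elim \<omega>)
      then have "v \<omega> * soft (\<zeta>' \<omega>) = 0" using W0[of \<omega>] by simp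
      then show ?case using v01(1)[of \<omega>] by (simp add: soft_eq_0_iff)
    qed
  qed
  have upper: "AE \<omega> in M. f \<omega> (x' \<omega>, ubar \<omega>) \<le> ereal (r' \<omega> + x' \<omega> \<bullet> p \<omega> + ubar \<omega> \<bullet> y \<omega> - \<theta> \<omega>)"
    using mem \<zeta>0 by eventually_elim (simp add: C_def a_def J_def q_def add.assoc)
  have uy: "integrable M (\<lambda>\<omega>. ubar \<omega> \<bullet> y \<omega>)" "integrable M (\<lambda>\<omega>. ubar \<omega> \<bullet> y1 \<omega>)"
    using separating_duality_integrable[OF duality(2) ubar] y y12(1) by blast+
  \<comment> \<open>The upper estimate of f contains x' . p once, the conjugate at (1 + \<epsilon>)
    p contributes it 1 + \<epsilon> times; Fenchel-Young leaves \<epsilon> times x' . p against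
    integrable terms.\<close>
  have "AE \<omega> in M. x' \<omega> \<bullet> p \<omega> \<le> (r' \<omega> + ubar \<omega> \<bullet> y \<omega> - \<theta> \<omega> - ubar \<omega> \<bullet> y1 \<omega> + \<theta>1 \<omega>) / \<epsilon>"
    using upper \<theta>1(2)
  proof eventually_elim
    case (elim \<omega>)
    from fenchel_young[OF elim] show ?case using \<epsilon> by (simp add: field_simps inner_add_right)
  qed
  from Xperp_annihilates_upper[OF p x' _ this]
  have xp: "integrable M (\<lambda>\<omega>. x' \<omega> \<bullet> p \<omega>)" "(\<integral>\<omega>. x' \<omega> \<bullet> p \<omega> \<partial>M) = 0"
    using rint uy \<theta>(1) \<theta>1(1) by auto
  have "primal_obj M f ubar x' \<le> ereal (\<integral>\<omega>. r' \<omega> + x' \<omega> \<bullet> p \<omega> + ubar \<omega> \<bullet> y \<omega> - \<theta> \<omega> \<partial>M)"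
    unfolding primal_obj_def integral_functional_def
    by (rule ext_expectation_le[OF _ upper]) (use rint xp uy \<theta>(1) in auto)
  also have "(\<integral>\<omega>. r' \<omega> + x' \<omega> \<bullet> p \<omega> + ubar \<omega> \<bullet> y \<omega> - \<theta> \<omega> \<partial>M) = (\<integral>\<omega>. r' \<omega> \<partial>M) + pairing M ubar y - (\<integral>\<omega>. \<theta> \<omega> \<partial>M)"
    using rint xp uy \<theta>(1) by (simp add: pairing_def)
  also have "ereal \<dots> \<le> ?S" using r_le by (simp add: s b_def)
  finally show thesis by (rule that[OF adapted_in_N[OF x']])
qed

end

section \<open>Extraction of the data from the hypotheses and conclusion\<close>

theorem corollary32:
  fixes M :: "'w measure"
    and T :: nat
    and F :: "nat \<Rightarrow> 'w measure"
    and stage :: "'n::finite \<Rightarrow> nat"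
    and f :: "'w \<Rightarrow> (real ^ 'n) \<times> (real ^ 'm::finite) \<Rightarrow> ereal"
    and X V N Xa Xperp :: "('w \<Rightarrow> real ^ 'n) set"
    and U Y :: "('w \<Rightarrow> real ^ 'm) set"
    and ubar :: "'w \<Rightarrow> real ^ 'm"
  defines "N \<equiv> adapted_strategies M F stage"
  defines "Xa \<equiv> X \<inter> N"
  defines "Xperp \<equiv> annihilator M V Xa"
  assumes "prob_space M"
    and "finite_filtration M T F"
    and "\<And>i. stage i \<le> T"
    and "convex_normal_integrand M f"
    and "solid_decomposable_space M X" and "solid_decomposable_space M V"
    and "separating_duality M X V"
    and "solid_decomposable_space M U" and "solid_decomposable_space M Y"
    and "separating_duality M U Y"
    and "ubar \<in> U"
    and feasible: "\<exists>x\<in>N. primal_obj M f ubar x < \<infinity>"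
    and recession: "linear_space {x \<in> N. AE \<omega> in M. recession_fun (f \<omega>) (x \<omega>, 0) \<le> 0}"
    and dual: "\<exists>p\<in>Xperp. \<exists>\<epsilon>>0. \<forall>c\<in>{1 - \<epsilon>..1 + \<epsilon>}.
                 (INF y\<in>Y. conj_obj M f (\<lambda>\<omega>. c *\<^sub>R p \<omega>) y) < \<infinity>"
  shows "(INF x\<in>N. primal_obj M f ubar x) = (SUP (p, y)\<in>Xperp \<times> Y. dual_obj M f ubar p y)
       \<and> (\<exists>x\<in>N. primal_obj M f ubar x = (INF x'\<in>N. primal_obj M f ubar x'))"
proof -
  interpret prob_space M by fact
  interpret stochastic_program M F stage f X V U Y ubar
    by unfold_locales (use assms in \<open>auto simp: finite_filtration_def\<close>)
  obtain x0 where x0: "x0 \<in> N" "primal_obj M f ubar x0 < \<infinity>" using feasible by blast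
  obtain xh where xh: "xh \<in> adapted" "AE \<omega> in M. x0 \<omega> = xh \<omega>"
    using N_version[OF x0(1)[unfolded N_def]] .
  have xh_fin: "primal_obj M f ubar xh < \<infinity>" using x0(2) primal_obj_cong[OF xh(2)] by simp
  obtain p \<epsilon> where p: "p \<in> Xperp" and \<epsilon>: "0 < \<epsilon>"
    and inf: "\<And>c. c \<in> {1 - \<epsilon>..1 + \<epsilon>} \<Longrightarrow> (INF y\<in>Y. conj_obj M f (\<lambda>\<omega>. c *\<^sub>R p \<omega>) y) < \<infinity>"
    using dual by blast
  have p': "p \<in> annihilator M V (X \<inter> adapted_strategies M F stage)" using p by (simp add: Xperp_def Xa_def N_def)
  have fin: "\<exists>y\<in>Y. conj_obj M f (\<lambda>\<omega>. c *\<^sub>R p \<omega>) y < \<infinity>" if "c \<in> {1 - \<epsilon>..1 + \<epsilon>}" for c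
    using inf[OF that] unfolding INF_less_iff .
  \<comment> \<open>The multiplier 1 yields the reference dual point; the two end points yield the
    bounds in both directions along \<open>p\<close>.\<close>
  obtain y where y: "y \<in> Y" "conj_obj M f (\<lambda>\<omega>. 1 *\<^sub>R p \<omega>) y < \<infinity>" using fin[of 1] \<epsilon> by auto
  obtain y1 where y1: "y1 \<in> Y" "conj_obj M f (\<lambda>\<omega>. (1 + \<epsilon>) *\<^sub>R p \<omega>) y1 < \<infinity>" using fin[of "1 + \<epsilon>"] \<epsilon> by auto
  obtain y2 where y2: "y2 \<in> Y" "conj_obj M f (\<lambda>\<omega>. (1 - \<epsilon>) *\<^sub>R p \<omega>) y2 < \<infinity>" using fin[of "1 - \<epsilon>"] \<epsilon> by auto
  obtain fh \<theta> where d: "integrable M fh" "AE \<omega> in M. f \<omega> (xh \<omega>, ubar \<omega>) = ereal (fh \<omega>)"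
    "integrable M \<theta>" "AE \<omega> in M. conj_fun (f \<omega>) (1 *\<^sub>R p \<omega>, y \<omega>) = ereal (\<theta> \<omega>)"
    "integrable M (\<lambda>\<omega>. xh \<omega> \<bullet> 1 *\<^sub>R p \<omega>)"
    by (rule feasible_pair[OF xh(1) xh_fin Xperp_scaleR[OF p'] y])
  obtain \<theta>1 where d1: "integrable M \<theta>1" "AE \<omega> in M. conj_fun (f \<omega>) ((1 + \<epsilon>) *\<^sub>R p \<omega>, y1 \<omega>) = ereal (\<theta>1 \<omega>)"
    by (rule feasible_pair[OF xh(1) xh_fin Xperp_scaleR[OF p'] y1])
  obtain \<theta>2 where d2: "integrable M \<theta>2" "AE \<omega> in M. conj_fun (f \<omega>) ((1 - \<epsilon>) *\<^sub>R p \<omega>, y2 \<omega>) = ereal (\<theta>2 \<omega>)"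
    by (rule feasible_pair[OF xh(1) xh_fin Xperp_scaleR[OF p'] y2])
  interpret dual_feasible_program M F stage f X V U Y ubar p y \<theta> xh fh \<epsilon> y1 y2 \<theta>1 \<theta>2
    by unfold_locales (use p' y y1 y2 d d1 d2 xh \<epsilon> recession in \<open>auto simp: N_def elim: AE_mp\<close>)
  obtain x where x: "x \<in> N" "primal_obj M f ubar x \<le> (SUP (p, y)\<in>Xperp \<times> Y. dual_obj M f ubar p y)"
    using strong_duality unfolding Xperp_def Xa_def N_def .
  have weak: "(SUP (p, y)\<in>Xperp \<times> Y. dual_obj M f ubar p y) \<le> primal_obj M f ubar x'" if "x' \<in> N" for x'
    using weak_duality that by (intro SUP_least) (auto simp: Xperp_def Xa_def N_def)
  have "(SUP (p, y)\<in>Xperp \<times> Y. dual_obj M f ubar p y) \<le> (INF x\<in>N. primal_obj M f ubar x)"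
    using weak by (intro INF_greatest)
  moreover have "(INF x\<in>N. primal_obj M f ubar x) \<le> primal_obj M f ubar x" using x(1) by (rule INF_lower)
  ultimately show ?thesis using x by (intro conjI bexI[of _ x]) auto
qed

end
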